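(* Let $0<\alpha<mn$, $1<p_1,\dots,p_m<\infty$, $\frac1p=\frac1{p_1}+\cdots+\frac1{p_m}$ and $\frac1q=\frac1p-\frac\alpha n$. Let $r>1$ with $0<r\alpha<mn$. If $\vec\omega^{\,r}=(\omega_1^r,\dots,\omega_m^r)\in A_{(\frac{\vec p}{r},\frac qr)}$, $\nu_{\vec\omega}^{\,q}\in A_\infty$, and $\vec b=(b_1,\dots,b_m)\in(BMO(\mathbb{R}^n))^m$, then there is a constant $C>0$ independent of $\vec b$ (and of $\vec f$) such that $$\big\|I_{\alpha,\Pi b}(\vec f)\big\|_{L^q(\nu_{\vec\omega}^{\,q})}\le C\prod_{j=1}^m\|b_j\|_{BMO}\prod_{i=1}^m\|f_i\|_{L^{p_i}(\omega_i^{p_i})}$$ for all $\vec f=(f_1,\dots,f_m)$ with $f_i\in L^{p_i}(\omega_i^{p_i})$.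
   Context: $m,n\ge1$ are integers. The iterated commutator of the multilinear fractional integral is $$I_{\alpha,\Pi b}(\vec f)(x)=\int_{(\mathbb{R}^n)^m}\frac{1}{|(x-y_1,\dots,x-y_m)|^{mn-\alpha}}\prod_{j=1}^m(b_j(x)-b_j(y_j))\prod_{i=1}^mf_i(y_i)\,d\vec y,\qquad d\vec y=dy_1\cdots dy_m.$$ Multiple weights: let $1\le p_1,\dots,p_m<\infty$ and $q>0$, and let $\omega_1,\dots,\omega_m$ be nonnegative functions on $\mathbb{R}^n$. Put $\nu_{\vec\omega}=\prod_{i=1}^m\omega_i$. Then $\vec\omega=(\omega_1,\dots,\omega_m)\in A_{(\vec p,q)}$, $\vec p=(p_1,\dots,p_m)$, means $$\sup_Q\Big(\frac1{|Q|}\int_Q\nu_{\vec\omega}^{\,q}\Big)^{1/q}\prod_{i=1}^m\Big(\frac1{|Q|}\int_Q\omega_i^{-p_i'}\Big)^{1/p_i'}<\infty,$$ the supremum over all cubes $Q\subset\mathbb{R}^n$, where for $p_i=1$ the factor $\big(\frac1{|Q|}\int_Q\omega_i^{-p_i'}\big)^{1/p_i'}$ is understood as $(\inf_Q\omega_i)^{-1}$ (essential infimum). In $A_{(\vec p/r,q/r)}$ the exponents are $p_1/r,\dots,p_m/r$ and $q/r$ (so the hypothesis presupposes $p_i/r\ge1$ and $q>0$). $A_\infty$ is the classical Muckenhoupt class. For a weight $w$, $\|f\|_{L^q(w)}=\big(\int|f|^qw\big)^{1/q}$. *)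

theory Defs
  imports "HOL-Analysis.Analysis"
begin

text \<open>
  \<open>\<real>\<^sup>n\<close> is \<^typ>\<open>real^'n\<close> and the index set \<open>{1,\<dots>,m}\<close> is a finite type \<^typ>\<open>'m\<close>, so that
  \<open>(\<real>\<^sup>n)\<^sup>m\<close> is \<^typ>\<open>(real^'n)^'m\<close>, whose norm and Lebesgue measure are those of \<open>\<real>\<^bsup>mn\<^esup>\<close>.
  Measurability and null sets are in the sense of Lebesgue throughout. Weights are real-valued;
  the functions \<open>b\<^sub>j\<close>, \<open>f\<^sub>i\<close> are complex-valued.
\<close>

text \<open>
  Real powers on \<open>[0,\<infinity>]\<close>, with \<open>0\<^sup>a = \<infinity>\<close> and \<open>\<infinity>\<^sup>a = 0\<close> for \<open>a < 0\<close>. In contrast,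
  \<^term>\<open>(0::real) powr a = 0\<close> for every \<open>a\<close>, which would be wrong for \<open>\<omega>\<^bsup>-p'\<^esup>\<close> where \<open>\<omega>\<close> vanishes.
\<close>

definition epowr :: "ennreal \<Rightarrow> real \<Rightarrow> ennreal" where
  "epowr x a =
    (if a = 0 then 1
     else if x = 0 then (if a > 0 then 0 else \<infinity>)
     else if x = \<infinity> then (if a > 0 then \<infinity> else 0)
     else ennreal (enn2real x powr a))"

text \<open>As usual in this theory, cubes have sides parallel to the coordinate axes.\<close>

definition cubes :: "(real^'n) set set" where
  "cubes = {cbox a (\<chi> i. a $ i + s) | a s. s > 0}"

definition emean :: "(real^'n) set \<Rightarrow> (real^'n \<Rightarrow> ennreal) \<Rightarrow> ennreal" where
  "emean Q g = (\<integral>\<^sup>+x\<in>Q. g x \<partial>lebesgue) / emeasure lebesgue Q"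

definition ess_inf_on :: "(real^'n) set \<Rightarrow> (real^'n \<Rightarrow> ennreal) \<Rightarrow> ennreal" where
  "ess_inf_on Q g = Sup {c. AE x in lebesgue. x \<in> Q \<longrightarrow> c \<le> g x}"

definition conj_exponent :: "real \<Rightarrow> real" where
  "conj_exponent p = p / (p - 1)"

definition dual_factor :: "real \<Rightarrow> (real^'n \<Rightarrow> real) \<Rightarrow> (real^'n) set \<Rightarrow> ennreal" where
  "dual_factor p w Q =
    (if p = 1 then inverse (ess_inf_on Q (\<lambda>x. ennreal (w x)))
     else epowr (emean Q (\<lambda>x. epowr (ennreal (w x)) (- conj_exponent p))) (1 / conj_exponent p))"

definition weight_product :: "('m::finite \<Rightarrow> real^'n \<Rightarrow> real) \<Rightarrow> real^'n \<Rightarrow> real" where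
  "weight_product w x = (\<Prod>i\<in>UNIV. w i x)"

definition multiple_A ::
    "('m::finite \<Rightarrow> real) \<Rightarrow> real \<Rightarrow> ('m \<Rightarrow> real^'n \<Rightarrow> real) set" where
  "multiple_A p q =
    {w. (\<forall>i. 1 \<le> p i) \<and> 0 < q \<and>
        (\<forall>i. w i \<in> borel_measurable lebesgue \<and> (\<forall>x. 0 \<le> w i x)) \<and>
        (SUP Q\<in>cubes.
           epowr (emean Q (\<lambda>x. epowr (ennreal (weight_product w x)) q)) (1 / q)
           * (\<Prod>i\<in>UNIV. dual_factor (p i) (w i) Q)) < \<infinity>}"

definition locally_integrable :: "(real^'n \<Rightarrow> 'b::{banach,second_countable_topology}) \<Rightarrow> bool" where
  "locally_integrable g \<longleftrightarrow> (\<forall>K. compact K \<longrightarrow> set_integrable lebesgue K g)"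

text \<open>
  Membership in a Muckenhoupt class includes being a weight: locally integrable,
  nonnegative and positive almost everywhere.
\<close>

definition Muckenhoupt_A :: "real \<Rightarrow> (real^'n \<Rightarrow> real) set" where
  "Muckenhoupt_A p =
    {w. locally_integrable w \<and> (\<forall>x. 0 \<le> w x) \<and> (AE x in lebesgue. 0 < w x) \<and>
        (SUP Q\<in>cubes.
           emean Q (\<lambda>x. ennreal (w x))
           * epowr (emean Q (\<lambda>x. epowr (ennreal (w x)) (- 1 / (p - 1)))) (p - 1)) < \<infinity>}"

text \<open>\<open>A\<^sub>1\<close> need not be listed in the union, as \<open>A\<^sub>1 \<subseteq> A\<^sub>p\<close> for \<open>p > 1\<close>.\<close>

definition A_infinity :: "(real^'n \<Rightarrow> real) set" where
  "A_infinity = (\<Union>p\<in>{1<..}. Muckenhoupt_A p)"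

definition mean :: "(real^'n) set \<Rightarrow> (real^'n \<Rightarrow> complex) \<Rightarrow> complex" where
  "mean Q b = (LINT x:Q|lebesgue. b x) /\<^sub>R measure lebesgue Q"

definition bmo_norm :: "(real^'n \<Rightarrow> complex) \<Rightarrow> ennreal" where
  "bmo_norm b = (SUP Q\<in>cubes. emean Q (\<lambda>x. ennreal (norm (b x - mean Q b))))"

definition BMO :: "(real^'n \<Rightarrow> complex) set" where
  "BMO = {b. locally_integrable b \<and> bmo_norm b < \<infinity>}"

definition Lp_norm :: "real \<Rightarrow> (real^'n \<Rightarrow> real) \<Rightarrow> (real^'n \<Rightarrow> complex) \<Rightarrow> ennreal" where
  "Lp_norm q w f = epowr (\<integral>\<^sup>+x. ennreal (norm (f x) powr q * w x) \<partial>lebesgue) (1 / q)"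

definition Lp_space :: "real \<Rightarrow> (real^'n \<Rightarrow> real) \<Rightarrow> (real^'n \<Rightarrow> complex) set" where
  "Lp_space q w = {f. f \<in> borel_measurable lebesgue \<and> Lp_norm q w f < \<infinity>}"

definition commutator_integrand ::
    "real \<Rightarrow> ('m::finite \<Rightarrow> real^'n \<Rightarrow> complex) \<Rightarrow> ('m \<Rightarrow> real^'n \<Rightarrow> complex)
      \<Rightarrow> real^'n \<Rightarrow> (real^'n)^'m \<Rightarrow> complex" where
  "commutator_integrand \<alpha> b f x y =
    complex_of_real (1 / norm (\<chi> j. x - y $ j) powr (real CARD('m) * real CARD('n) - \<alpha>))
    * (\<Prod>j\<in>UNIV. b j x - b j (y $ j)) * (\<Prod>i\<in>UNIV. f i (y $ i))"

text \<open>
  This is a Bochner integral, hence \<open>0\<close> at points \<open>x\<close> where the integrand is not absolutely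
  integrable; results about it should also assert integrability for almost every \<open>x\<close>.
\<close>

definition iterated_commutator ::
    "real \<Rightarrow> ('m::finite \<Rightarrow> real^'n \<Rightarrow> complex) \<Rightarrow> ('m \<Rightarrow> real^'n \<Rightarrow> complex)
      \<Rightarrow> real^'n \<Rightarrow> complex" where
  "iterated_commutator \<alpha> b f x = (LINT y|lebesgue. commutator_integrand \<alpha> b f x y)"

end

theory Submission
  imports Defs "HOL-Real_Asymp.Real_Asymp"
begin

text \<open>
  Splitting the kernel dyadically dominates the commutator at \<open>x\<close> by a sum over scales \<open>k\<close> of
  \<open>2\<^bsup>k\<alpha>\<^esup> \<Prod>\<^sub>j \<langle>f\<^sub>j\<rangle>\<^bsub>s,Q\<^esub> (\<bar>b\<^sub>j(x) - b\<^bsub>j,Q\<^esub>\<bar> + C \<parallel>b\<^sub>j\<parallel>)\<close>, where \<open>1 < s < r\<close>, \<open>Q\<close> is a grid cube of side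
  comparable to \<open>2\<^sup>k\<close> near \<open>x\<close>, and \<open>\<langle>\<cdot>\<rangle>\<^bsub>s,Q\<^esub>\<close> is an \<open>L\<^sup>s\<close> average (John--Nirenberg handles the oscillation
  inside the averages). Hedberg's trick bounds the sum over \<open>k\<close> by the geometric mean of the two
  expressions in which the terms are multiplied by \<open>2\<^bsup>\<plusminus>k\<epsilon>\<^esup>\<close> and the sum is replaced by an \<open>\<ell>\<^bsup>q'\<^esup>\<close> sum,
  \<open>1/q' = 1/q \<mp> \<epsilon>/n\<close>. Their \<open>L\<^bsup>q'\<^esup>(\<nu>\<^bsup>q'\<^esup>)\<close> norms are just sums over all grid cubes. On each cube, \<open>\<nu>\<^bsup>q'\<^esup>\<close> and the
  remaining oscillations are averaged by the reverse Hoelder inequality for \<open>\<nu>\<^sup>q \<in> A\<^sub>\<infinity>\<close>, and the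
  power \<open>r > 1\<close> in the weight condition allows passing from \<open>\<langle>f\<^sub>j\<rangle>\<^bsub>s,Q\<^esub>\<close> to \<open>\<langle>f\<^sub>j \<omega>\<^sub>j\<rangle>\<^bsub>t\<^sub>j,Q\<^esub>\<close> with \<open>t\<^sub>j < p\<^sub>j\<close>. What is
  left is unweighted: for \<open>1 < P < R\<close>, the sum of \<open>(\<bar>Q\<bar>\<^bsup>1/P\<^esup> \<langle>h\<rangle>\<^bsub>1,Q\<^esub>)\<^sup>R\<close> over all grid cubes converges because
  \<open>R > P\<close>, as one sees by cutting \<open>h\<close> at height \<open>\<bar>Q\<bar>\<^bsup>-1/P\<^esup>\<close>. This works for every \<open>q > 0\<close>, without
  duality or maximal functions. John--Nirenberg and the reverse Hoelder inequality both follow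
  by iterating the Calderon--Zygmund decomposition.
\<close>

subsection \<open>Powers on \<open>[0,\<infinity>]\<close> and Hoelder's inequality\<close>

text \<open>Three margins carry the proof, each a strict inequality between exponents. Taking s
  strictly between 1 and r makes 1/s - 1/r positive, and this is exactly the amount by which 1/t_j
  exceeds 1/p_j; with t_j = p_j the unweighted grid sum would sit at its endpoint P = 1. That s
  exceeds 1 pays for the oscillation of b_j(y) under the average. The reverse Hoelder exponent 1 +
  \<delta> limits how far q can be raised: \<epsilon> is so small that q1 < q (1 + \<delta>), hence
  \<nu>^q1 = (\<nu>^q)^(q1/q) can still be averaged. Finally \<epsilon> < \<alpha> keeps both
  perturbed exponents above p, which is the condition R > P of the grid sum. Since q may lie below
  1, nothing may rely on a triangle inequality in L^q; all quantities are nonnegative and are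
  handled in [0,\<infinity>] with 0 * \<infinity> = 0. Finiteness of the norms of the f_i enters
  only at the end, where it yields absolute integrability for almost every x.\<close>

lemma epowr_0 [simp]: "0 < a \<Longrightarrow> epowr 0 a = 0"
  by (simp add: epowr_def)

lemma epowr_top [simp]: "0 < a \<Longrightarrow> epowr top a = top"
  by (simp add: epowr_def infinity_ennreal_def)

lemma epowr_ennreal: "0 < a \<Longrightarrow> 0 \<le> x \<Longrightarrow> epowr (ennreal x) a = ennreal (x powr a)"
  by (auto simp: epowr_def)

lemma epowr_ennreal_pos: "0 < x \<Longrightarrow> epowr (ennreal x) a = ennreal (x powr a)"
  by (auto simp: epowr_def)

lemma epowr_one [simp]: "epowr x 1 = x"
  by (cases x) (auto simp: epowr_def)

lemma epowr_1 [simp]: "epowr 1 a = 1"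
  by (auto simp: epowr_def)

lemma epowr_exp_0 [simp]: "epowr x 0 = 1"
  by (auto simp: epowr_def)

lemma epowr_eq_0_iff: "0 < a \<Longrightarrow> epowr x a = 0 \<longleftrightarrow> x = 0"
  by (cases x) (auto simp: epowr_def)

lemma epowr_eq_top_iff: "0 < a \<Longrightarrow> epowr x a = top \<longleftrightarrow> x = top"
  by (cases x) (auto simp: epowr_def)

lemma epowr_less_top: "0 < a \<Longrightarrow> x < top \<Longrightarrow> epowr x a < top"
  using epowr_eq_top_iff[of a x] by (metis less_top)

lemma epowr_mono: "0 \<le> a \<Longrightarrow> x \<le> y \<Longrightarrow> epowr x a \<le> epowr y a"
  by (cases x; cases y) (auto simp: epowr_def powr_mono2 top_unique)

text \<open>The convention 0 * top = 0 is compatible with positive powers, so a product can be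
  raised termwise even when a zero meets an infinite factor.\<close>

lemma epowr_mult: "0 \<le> a \<Longrightarrow> epowr (x * y) a = epowr x a * epowr y a"
  by (cases x; cases y)
    (auto simp: epowr_def powr_mult enn2real_mult ennreal_mult ennreal_mult_top ennreal_top_mult ennreal_mult_eq_top_iff)

lemma epowr_prod: "0 \<le> a \<Longrightarrow> epowr (\<Prod>i\<in>I. f i) a = (\<Prod>i\<in>I. epowr (f i) a)"
  by (induction I rule: infinite_finite_induct) (auto simp: epowr_mult)

lemma epowr_epowr: "0 < a \<Longrightarrow> epowr (epowr x a) b = epowr x (a * b)"
  by (cases x) (auto simp: epowr_def powr_powr zero_less_mult_iff)

lemma epowr_add: "0 \<le> a \<Longrightarrow> 0 \<le> b \<Longrightarrow> epowr x (a + b) = epowr x a * epowr x b"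
  by (cases x) (auto simp: epowr_def powr_add ennreal_mult')

lemma epowr_inverse: "0 < a \<Longrightarrow> epowr (inverse x) a = inverse (epowr x a)"
  by (cases x) (auto simp: epowr_def inverse_ennreal inverse_powr infinity_ennreal_def)

lemma epowr_divide: "0 < a \<Longrightarrow> epowr (x / y) a = epowr x a / epowr y a"
  by (simp add: divide_ennreal_def epowr_mult epowr_inverse)

lemma epowr_le_iff: "0 < a \<Longrightarrow> epowr x a \<le> epowr y a \<longleftrightarrow> x \<le> y"
proof
  assume a: "0 < a" "epowr x a \<le> epowr y a"
  from epowr_mono[OF _ this(2), of "1/a"] a show "x \<le> y" by (simp add: epowr_epowr)
qed (auto intro: epowr_mono)

lemma epowr_le_swap: "0 < a \<Longrightarrow> epowr x a \<le> y \<longleftrightarrow> x \<le> epowr y (1 / a)"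
  using epowr_le_iff[of a x "epowr y (1 / a)"] by (simp add: epowr_epowr)

lemma measurable_epowr [measurable]:
  assumes [measurable]: "f \<in> borel_measurable M"
  shows "(\<lambda>x. epowr (f x) a) \<in> borel_measurable M"
  unfolding epowr_def by measurable

text \<open>Convexity of exp at the points ln (x i). A zero entry, for which ln carries no
  information, makes the left side vanish.\<close>

lemma weighted_am_gm:
  fixes x \<theta> :: "'i \<Rightarrow> real"
  assumes "finite I" "\<And>i. i \<in> I \<Longrightarrow> 0 \<le> x i" "\<And>i. i \<in> I \<Longrightarrow> 0 < \<theta> i" "(\<Sum>i\<in>I. \<theta> i) = 1"
  shows "(\<Prod>i\<in>I. x i powr \<theta> i) \<le> (\<Sum>i\<in>I. \<theta> i * x i)"
proof (cases "\<exists>i\<in>I. x i = 0")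
  case True
  then have "(\<Prod>i\<in>I. x i powr \<theta> i) = 0" using assms(1) by auto
  moreover have "0 \<le> (\<Sum>i\<in>I. \<theta> i * x i)" using assms(2,3) by (intro sum_nonneg mult_nonneg_nonneg) (auto intro: less_imp_le)
  ultimately show ?thesis by simp
next
  case False
  then have pos: "\<And>i. i \<in> I \<Longrightarrow> 0 < x i" using assms(2) by force
  have "I \<noteq> {}" using assms(4) by auto
  have "exp (\<Sum>i\<in>I. \<theta> i *\<^sub>R ln (x i)) \<le> (\<Sum>i\<in>I. \<theta> i * exp (ln (x i)))"
    by (rule convex_on_sum[OF _ _ exp_convex])
      (use assms \<open>I \<noteq> {}\<close> in \<open>auto intro: less_imp_le\<close>)
  also have "\<dots> = (\<Sum>i\<in>I. \<theta> i * x i)" using pos by (intro sum.cong) auto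
  also have "exp (\<Sum>i\<in>I. \<theta> i *\<^sub>R ln (x i)) = (\<Prod>i\<in>I. x i powr \<theta> i)"
    using pos assms(1) by (force simp: exp_sum powr_def intro!: prod.cong)
  finally show ?thesis by simp
qed

lemma epowr_weighted_am_gm:
  fixes x :: "'i \<Rightarrow> ennreal" and \<theta> :: "'i \<Rightarrow> real"
  assumes "finite I" "\<And>i. i \<in> I \<Longrightarrow> 0 < \<theta> i" "(\<Sum>i\<in>I. \<theta> i) = 1"
  shows "(\<Prod>i\<in>I. epowr (x i) (\<theta> i)) \<le> (\<Sum>i\<in>I. ennreal (\<theta> i) * x i)"
proof (cases "\<exists>i\<in>I. x i = top")
  case True
  then obtain i where i: "i \<in> I" "x i = top" by auto
  have "ennreal (\<theta> i) * x i = top" using i assms(2)[of i] by (simp add: ennreal_mult_top ennreal_eq_0_iff)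
  then have "(\<Sum>i\<in>I. ennreal (\<theta> i) * x i) = top" using i(1) assms(1) by (auto simp: ennreal_sum_eq_top)
  then show ?thesis by simp
next
  case False
  define y where "y i = enn2real (x i)" for i
  have y: "x i = ennreal (y i)" if "i \<in> I" for i using False that by (auto simp: y_def less_top)
  have y0: "0 \<le> y i" for i by (simp add: y_def)
  have "(\<Prod>i\<in>I. epowr (x i) (\<theta> i)) = (\<Prod>i\<in>I. ennreal (y i powr \<theta> i))"
    using assms(2) y0 by (intro prod.cong) (auto simp: y epowr_ennreal)
  also have "\<dots> = ennreal (\<Prod>i\<in>I. y i powr \<theta> i)" by (simp add: prod_ennreal)
  also have "\<dots> \<le> ennreal (\<Sum>i\<in>I. \<theta> i * y i)"
    by (intro ennreal_leI weighted_am_gm) (auto simp: y_def assms)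
  also have "\<dots> = (\<Sum>i\<in>I. ennreal (\<theta> i * y i))"
    using assms(2) by (intro sum_ennreal[symmetric]) (auto simp: y_def less_imp_le)
  also have "\<dots> = (\<Sum>i\<in>I. ennreal (\<theta> i) * x i)"
    using assms(2) y0 by (intro sum.cong) (auto simp: y ennreal_mult less_imp_le)
  finally show ?thesis .
qed

text \<open>The product convention \<open>0 \<cdot> \<infinity> = 0\<close> makes Hoelder's inequality hold with no finiteness
  assumptions: a factor with vanishing integral vanishes almost everywhere.\<close>

lemma nn_integral_holder:
  fixes f :: "'i \<Rightarrow> 'a \<Rightarrow> ennreal"
  assumes "finite I" and \<theta>: "\<And>i. i \<in> I \<Longrightarrow> 0 < \<theta> i" "(\<Sum>i\<in>I. \<theta> i) = 1"
    and [measurable]: "\<And>i. i \<in> I \<Longrightarrow> f i \<in> borel_measurable M"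
  shows "(\<integral>\<^sup>+x. (\<Prod>i\<in>I. epowr (f i x) (\<theta> i)) \<partial>M) \<le> (\<Prod>i\<in>I. epowr (\<integral>\<^sup>+x. f i x \<partial>M) (\<theta> i))"
proof -
  define N where "N i = (\<integral>\<^sup>+x. f i x \<partial>M)" for i
  consider "\<exists>i\<in>I. N i = 0" | "\<forall>i\<in>I. N i \<noteq> 0" "\<exists>i\<in>I. N i = top" | "\<forall>i\<in>I. N i \<noteq> 0 \<and> N i \<noteq> top"
    by blast
  then show ?thesis
  proof cases
    case 1
    then obtain i where i: "i \<in> I" "N i = 0" by auto
    then have "AE x in M. f i x = 0" by (simp add: N_def nn_integral_0_iff_AE)
    then have "AE x in M. (\<Prod>i\<in>I. epowr (f i x) (\<theta> i)) = 0"
      by eventually_elim (use i \<theta>(1) assms(1) in \<open>auto intro!: bexI[of _ i]\<close>)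
    then have "(\<integral>\<^sup>+x. (\<Prod>i\<in>I. epowr (f i x) (\<theta> i)) \<partial>M) = 0"
      using nn_integral_cong_AE[of _ "\<lambda>_. 0" M] by simp
    then show ?thesis by simp
  next
    case 2
    then have "(\<Prod>i\<in>I. epowr (N i) (\<theta> i)) = top"
      using \<theta>(1) assms(1) by (auto simp: ennreal_prod_eq_top epowr_eq_0_iff epowr_eq_top_iff)
    then show ?thesis by (simp add: N_def)
  next
    case 3
    \<comment> \<open>After division by the integrals every factor has integral 1, so the pointwise
      bound by the weighted sum integrates to the sum of the \<open>\<theta> i\<close>, which is
      1.\<close>
    have fN: "f i x = N i * (f i x / N i)" if "i \<in> I" for i x
      using 3 that by (metis ennreal_times_divide mult.commute mult_divide_eq_ennreal)
    have "(\<integral>\<^sup>+x. (\<Prod>i\<in>I. epowr (f i x) (\<theta> i)) \<partial>M)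
        = (\<integral>\<^sup>+x. (\<Prod>i\<in>I. epowr (N i) (\<theta> i)) * (\<Prod>i\<in>I. epowr (f i x / N i) (\<theta> i)) \<partial>M)"
      unfolding prod.distrib[symmetric]
    proof (intro nn_integral_cong prod.cong refl)
      fix x i assume i: "i \<in> I"
      show "epowr (f i x) (\<theta> i) = epowr (N i) (\<theta> i) * epowr (f i x / N i) (\<theta> i)"
        using fN[OF i, of x] \<theta>(1)[OF i] by (metis epowr_mult less_imp_le)
    qed
    also have "\<dots> = (\<Prod>i\<in>I. epowr (N i) (\<theta> i)) * (\<integral>\<^sup>+x. (\<Prod>i\<in>I. epowr (f i x / N i) (\<theta> i)) \<partial>M)"
      by (intro nn_integral_cmult) measurable
    also have "(\<integral>\<^sup>+x. (\<Prod>i\<in>I. epowr (f i x / N i) (\<theta> i)) \<partial>M) \<le> (\<integral>\<^sup>+x. (\<Sum>i\<in>I. ennreal (\<theta> i) * (f i x / N i)) \<partial>M)"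
      by (intro nn_integral_mono epowr_weighted_am_gm) (use assms in auto)
    also have "\<dots> = (\<Sum>i\<in>I. ennreal (\<theta> i) * (N i / N i))"
      by (subst nn_integral_sum) (auto simp: nn_integral_cmult nn_integral_divide N_def intro!: sum.cong)
    also have "\<dots> = (\<Sum>i\<in>I. ennreal (\<theta> i))"
      using 3 by (intro sum.cong) (auto simp: less_top)
    also have "\<dots> = 1" using \<theta> by (subst sum_ennreal) (auto intro: less_imp_le)
    finally show ?thesis by (simp add: N_def mult_left_mono)
  qed
qed

lemma nn_integral_holder2:
  fixes f g :: "'a \<Rightarrow> ennreal"
  assumes "0 < a" "0 < b" "a + b = 1"
    and [measurable]: "f \<in> borel_measurable M" "g \<in> borel_measurable M"
  shows "(\<integral>\<^sup>+x. epowr (f x) a * epowr (g x) b \<partial>M) \<le> epowr (\<integral>\<^sup>+x. f x \<partial>M) a * epowr (\<integral>\<^sup>+x. g x \<partial>M) b"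
  using nn_integral_holder[of "UNIV :: bool set" "\<lambda>i. if i then a else b" "\<lambda>i. if i then f else g" M] assms
  by (auto simp: UNIV_bool mult.commute add.commute)

lemma nn_integral_holder2':
  fixes f g :: "'a \<Rightarrow> ennreal"
  assumes "0 < u" "0 < v" "1/u + 1/v = 1"
    and [measurable]: "f \<in> borel_measurable M" "g \<in> borel_measurable M"
  shows "(\<integral>\<^sup>+x. f x * g x \<partial>M) \<le> epowr (\<integral>\<^sup>+x. epowr (f x) u \<partial>M) (1/u) * epowr (\<integral>\<^sup>+x. epowr (g x) v \<partial>M) (1/v)"
  using nn_integral_holder2[of "1/u" "1/v" "\<lambda>x. epowr (f x) u" M "\<lambda>x. epowr (g x) v"] assms
  by (auto simp: epowr_epowr)

subsection \<open>Cubes and dyadic cells\<close>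

definition cube :: "real^'n \<Rightarrow> real \<Rightarrow> (real^'n) set" where
  "cube a s = cbox a (\<chi> i. a $ i + s)"

text \<open>Half-open cubes tile exactly, so the stopping arguments use them; the averages of the
  theorem are over closed cubes, and the two kinds differ by a null set.\<close>

definition half_open_cube :: "real^'n \<Rightarrow> real \<Rightarrow> (real^'n) set" where
  "half_open_cube a s = {x. \<forall>i. a $ i \<le> x $ i \<and> x $ i < a $ i + s}"

lemma mem_cube: "x \<in> cube a s \<longleftrightarrow> (\<forall>i. a $ i \<le> x $ i \<and> x $ i \<le> a $ i + s)"
  by (simp add: cube_def mem_box_cart)

lemma cubes_eq: "Q \<in> cubes \<longleftrightarrow> (\<exists>a s. 0 < s \<and> Q = cube a s)"
  by (auto simp: cubes_def cube_def)

lemma cube_in_cubes: "0 < s \<Longrightarrow> cube a s \<in> cubes"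
  by (auto simp: cubes_eq)

lemma sets_cube [measurable]: "cube a s \<in> sets borel" "cube a s \<in> sets lebesgue"
  by (auto simp: cube_def)

lemma sets_half_open_cube [measurable]:
  "half_open_cube (a :: real^'n) s \<in> sets borel" "half_open_cube a s \<in> sets lebesgue"
proof -
  have "half_open_cube a s = (\<Inter>i. {x. a $ i \<le> x $ i} \<inter> {x. x $ i < a $ i + s})"
    by (auto simp: half_open_cube_def)
  also have "\<dots> \<in> sets borel"
    by (intro sets.finite_INT sets.Int borel_closed borel_open
        closed_halfspace_component_ge_cart open_halfspace_component_lt_cart) auto
  finally show "half_open_cube a s \<in> sets borel" .
  then show "half_open_cube a s \<in> sets lebesgue" by auto
qed

lemma measure_cube: "0 \<le> s \<Longrightarrow> measure lebesgue (cube (a :: real^'n) s) = s ^ CARD('n)"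
  by (simp add: cube_def measure_completion content_cbox_cart interval_ne_empty_cart)

lemma emeasure_cube: "0 \<le> s \<Longrightarrow> emeasure lebesgue (cube (a :: real^'n) s) = ennreal (s ^ CARD('n))"
  using measure_cube[of s a] by (simp add: cube_def emeasure_lborel_cbox_eq emeasure_eq_ennreal_measure)

lemma box_subset_half_open_cube: "box a (\<chi> i. a $ i + s) \<subseteq> half_open_cube a s"
  by (auto simp: half_open_cube_def mem_box_cart less_imp_le)

lemma half_open_cube_subset_cube: "half_open_cube a s \<subseteq> cube a s"
  by (auto simp: half_open_cube_def mem_cube less_imp_le)

lemma AE_cube_iff_half_open_cube:
  "AE x in lebesgue. x \<in> cube a s \<longleftrightarrow> x \<in> half_open_cube a s"
proof -
  have "negligible (cbox a (\<chi> i. a $ i + s) - box a (\<chi> i. a $ i + s))"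
    by (rule negligible_frontier_interval)
  then have "AE x in lebesgue. x \<notin> cbox a (\<chi> i. a $ i + s) - box a (\<chi> i. a $ i + s)"
    unfolding negligible_iff_null_sets by (rule AE_not_in)
  then show ?thesis
    by eventually_elim (use box_subset_half_open_cube[of a s] half_open_cube_subset_cube[of a s] in \<open>auto simp: cube_def\<close>)
qed

lemma nn_integral_half_open_cube:
  "(\<integral>\<^sup>+x\<in>half_open_cube a s. h x \<partial>lebesgue) = (\<integral>\<^sup>+x\<in>cube a s. h x \<partial>lebesgue)"
  by (intro nn_integral_cong_AE, use AE_cube_iff_half_open_cube[of a s] in eventually_elim)
    (auto simp: indicator_def)

lemma emeasure_half_open_cube:
  "emeasure lebesgue (half_open_cube a s) = emeasure lebesgue (cube a s)"
  using nn_integral_half_open_cube[of "\<lambda>_. 1" a s] by simp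

text \<open>A closed cube of positive side is the closure of its interior, so inclusion passes from
  half-open to closed cubes.\<close>

lemma cube_mono:
  assumes "half_open_cube c l \<subseteq> half_open_cube a s" "0 < l"
  shows "cube c l \<subseteq> cube a s"
proof -
  have "box c (\<chi> i. c $ i + l) \<noteq> {}" using assms(2) by (auto simp: interval_ne_empty_cart)
  then have "cube c l = closure (box c (\<chi> i. c $ i + l))" by (simp add: cube_def closure_box)
  also have "\<dots> \<subseteq> closure (cube a s)"
    using box_subset_half_open_cube[of c l] half_open_cube_subset_cube[of a s] assms(1) by (intro closure_mono) auto
  also have "\<dots> = cube a s" by (simp add: cube_def)
  finally show ?thesis .
qed

lemma emean_uniform_measure:
  assumes [measurable]: "Q \<in> sets lebesgue" "g \<in> borel_measurable lebesgue"
  shows "emean Q g = (\<integral>\<^sup>+x. g x \<partial>uniform_measure lebesgue Q)"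
  by (simp add: emean_def nn_integral_uniform_measure)

section \<open>Dyadic cells relative to a base cube\<close>

definition cell_index :: "real^'n \<Rightarrow> real \<Rightarrow> nat \<Rightarrow> real^'n \<Rightarrow> 'n \<Rightarrow> int" where
  "cell_index a s N x i = \<lfloor>(x $ i - a $ i) / s * 2 ^ N\<rfloor>"

text \<open>A cell of generation \<open>N\<close> is represented by its corner, so that sharing a
  cell becomes an equation between corners. The grid continues outside the base cube, which makes
  the definition total.\<close>

definition cell_corner :: "real^'n \<Rightarrow> real \<Rightarrow> nat \<Rightarrow> real^'n \<Rightarrow> real^'n" where
  "cell_corner a s N x = (\<chi> i. a $ i + s / 2 ^ N * of_int (cell_index a s N x i))"

lemma cell_corner_eq_iff:
  "0 < s \<Longrightarrow> cell_corner a s N x = cell_corner a s N y \<longleftrightarrow> (\<forall>i. cell_index a s N x i = cell_index a s N y i)"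
  by (auto simp: cell_corner_def vec_eq_iff)

lemma mem_cell:
  assumes "0 < s"
  shows "y \<in> half_open_cube (cell_corner a s N x) (s / 2 ^ N) \<longleftrightarrow> cell_corner a s N y = cell_corner a s N x"
proof -
  have "(a $ i + s / 2 ^ N * of_int z \<le> y $ i \<and> y $ i < a $ i + s / 2 ^ N * of_int z + s / 2 ^ N) \<longleftrightarrow> cell_index a s N y i = z"
    for i z
  proof -
    have "cell_index a s N y i = z \<longleftrightarrow> of_int z \<le> (y $ i - a $ i) / s * 2 ^ N \<and> (y $ i - a $ i) / s * 2 ^ N < of_int z + 1"
      unfolding cell_index_def by (rule floor_eq_iff)
    then show ?thesis using assms by (simp add: field_simps)
  qed
  then show ?thesis using assms unfolding half_open_cube_def
    by (simp add: cell_corner_eq_iff) (simp add: cell_corner_def)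
qed

text \<open>The index at a coarser generation is the integer quotient of the finer index by 2^(N -
  M), so a common cell determines all common ancestors.\<close>

lemma cell_corner_coarsen:
  assumes "0 < s" "cell_corner a s N x = cell_corner a s N y" "M \<le> N"
  shows "cell_corner a s M x = cell_corner a s M y"
proof -
  have "cell_index a s M z i = cell_index a s N z i div 2 ^ (N - M)" for z i
  proof -
    have "(z $ i - a $ i) / s * 2 ^ M = ((z $ i - a $ i) / s * 2 ^ N) / of_int (2 ^ (N - M))"
    proof -
      have "(2::real) ^ N = 2 ^ M * 2 ^ (N - M)" using assms(3) by (simp flip: power_add)
      then show ?thesis by simp
    qed
    then show ?thesis unfolding cell_index_def
      using floor_divide_real_eq_div[of "2 ^ (N - M)" "(z $ i - a $ i) / s * 2 ^ N"] by simp
  qed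
  then show ?thesis using assms by (simp add: cell_corner_eq_iff)
qed

lemma self_in_cell: "0 < s \<Longrightarrow> x \<in> half_open_cube (cell_corner a s N x) (s / 2 ^ N)"
  by (simp add: mem_cell)

lemma cell_0:
  assumes "0 < s" "x \<in> half_open_cube a s"
  shows "cell_corner a s 0 x = a"
proof -
  have "cell_index a s 0 x i = 0" for i
    using assms by (auto simp: cell_index_def half_open_cube_def floor_eq_iff field_simps)
  then show ?thesis by (simp add: cell_corner_def vec_eq_iff)
qed

lemma cell_antimono:
  assumes "0 < s" "M \<le> N"
  shows "half_open_cube (cell_corner a s N x) (s / 2 ^ N) \<subseteq> half_open_cube (cell_corner a s M x) (s / 2 ^ M)"
  using cell_corner_coarsen[OF assms(1) _ assms(2)] by (auto simp: mem_cell[OF assms(1)])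

lemma cell_subset:
  assumes "0 < s" "x \<in> half_open_cube a s"
  shows "half_open_cube (cell_corner a s N x) (s / 2 ^ N) \<subseteq> half_open_cube a s"
  using cell_antimono[OF assms(1), of 0 N a x] cell_0[OF assms] by simp

lemma countable_cells: "countable (range (\<lambda>(N, x). (cell_corner a s N x, s / 2 ^ N)))"
proof -
  have "range (\<lambda>(N, x). (cell_corner a s N x, s / 2 ^ N))
    \<subseteq> range (\<lambda>(N, z :: 'a \<Rightarrow> int). (\<chi> i. a $ i + s / 2 ^ N * of_int (z i), s / 2 ^ N))"
    by (auto simp: cell_corner_def image_iff intro!: exI)
  then show ?thesis by (rule countable_subset) simp
qed

text \<open>In the last clause, \<open>half_open_cube c' (2 * l)\<close> is the parent cell.\<close>

lemma maximal_cells: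
  fixes P :: "real^'n \<Rightarrow> real \<Rightarrow> bool"
  assumes s: "0 < s"
  obtains I where "countable I" "disjoint_family_on (\<lambda>(c, l). half_open_cube c l) I"
    "(\<Union>(c, l)\<in>I. half_open_cube c l) = {x \<in> half_open_cube a s. \<exists>N. P (cell_corner a s N x) (s / 2 ^ N)}"
    "\<And>c l. (c, l) \<in> I \<Longrightarrow> 0 < l \<and> P c l"
    "\<And>c l. (c, l) \<in> I \<Longrightarrow> \<exists>x N. x \<in> half_open_cube a s \<and> c = cell_corner a s N x \<and> l = s / 2 ^ N"
    "\<And>c l. (c, l) \<in> I \<Longrightarrow> (c, l) = (a, s) \<or>
        (\<exists>c'. half_open_cube c l \<subseteq> half_open_cube c' (2 * l) \<and> \<not> P c' (2 * l))"
proof -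
  define S where "S = {x \<in> half_open_cube a s. \<exists>N. P (cell_corner a s N x) (s / 2 ^ N)}"
  \<comment> \<open>A stopping generation: the first, hence largest, cell around \<open>x\<close>
    with property \<open>P\<close>. The pair \<open>C x\<close> is that stopped cell.\<close>
  define \<tau> where "\<tau> x = (LEAST N. P (cell_corner a s N x) (s / 2 ^ N))" for x
  define C where "C x = (cell_corner a s (\<tau> x) x, s / 2 ^ \<tau> x)" for x
  define H where "H = (\<lambda>(c, l). half_open_cube c l :: (real^'n) set)"
  have P\<tau>: "P (cell_corner a s (\<tau> x) x) (s / 2 ^ \<tau> x)" if "x \<in> S" for x
    using that unfolding \<tau>_def S_def by (auto intro: LeastI_ex)
  have \<tau>_least: "\<not> P (cell_corner a s N x) (s / 2 ^ N)" if "N < \<tau> x" for x N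
    using that not_less_Least unfolding \<tau>_def by blast
  \<comment> \<open>All points of a stopped cell have the same ancestors and therefore stop at the
    same generation, so two stopped cells are equal or disjoint.\<close>
  have Ceq: "C y = C x" "y \<in> S" if "x \<in> S" "y \<in> H (C x)" for x y
  proof -
    have eq: "cell_corner a s (\<tau> x) y = cell_corner a s (\<tau> x) x"
      using that(2) s by (simp add: H_def C_def mem_cell)
    have eq': "cell_corner a s N y = cell_corner a s N x" if "N \<le> \<tau> x" for N
      by (rule cell_corner_coarsen[OF s eq that])
    have "P (cell_corner a s (\<tau> x) y) (s / 2 ^ \<tau> x)" using P\<tau>[OF that(1)] eq by simp
    moreover have "\<not> P (cell_corner a s N y) (s / 2 ^ N)" if "N < \<tau> x" for N
      using \<tau>_least[OF that] eq'[of N] that by simp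
    ultimately have "\<tau> y = \<tau> x" unfolding \<tau>_def[of y]
      by (intro Least_equality) (auto simp: not_less[symmetric])
    then show "C y = C x" using eq by (simp add: C_def)
    have "y \<in> half_open_cube a s"
      using that cell_subset[OF s, of x a "\<tau> x"] by (auto simp: H_def C_def S_def)
    then show "y \<in> S"
      using \<open>P (cell_corner a s (\<tau> x) y) (s / 2 ^ \<tau> x)\<close> by (auto simp: S_def)
  qed
  show thesis
  proof (rule that[of "C ` S"])
    have "C ` S \<subseteq> range (\<lambda>(N, x). (cell_corner a s N x, s / 2 ^ N))"
      by (auto simp: C_def)
    then show "countable (C ` S)" using countable_cells countable_subset by blast
    show "disjoint_family_on (\<lambda>(c, l). half_open_cube c l) (C ` S)"
      unfolding disjoint_family_on_def H_def[symmetric]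
    proof (intro ballI impI)
      fix i j assume ij: "i \<in> C ` S" "j \<in> C ` S" "i \<noteq> j"
      have C: "C z = k" if "z \<in> H k" "k \<in> C ` S" for z k using that Ceq(1) by blast
      show "H i \<inter> H j = {}"
      proof (rule equals0I)
        fix z assume "z \<in> H i \<inter> H j"
        then show False using C[of z i] C[of z j] ij by simp
      qed
    qed
    have self: "x \<in> H (C x)" for x by (simp add: H_def C_def self_in_cell s)
    show "(\<Union>(c, l)\<in>C ` S. half_open_cube c l) = {x \<in> half_open_cube a s. \<exists>N. P (cell_corner a s N x) (s / 2 ^ N)}"
      unfolding S_def[symmetric] H_def[symmetric] using Ceq(2) self by auto
    show "0 < l \<and> P c l" if "(c, l) \<in> C ` S" for c l
      using that P\<tau> s by (auto simp: C_def)
    show "\<exists>x N. x \<in> half_open_cube a s \<and> c = cell_corner a s N x \<and> l = s / 2 ^ N" if "(c, l) \<in> C ` S" for c l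
      using that by (auto simp: C_def S_def)
    show "(c, l) = (a, s) \<or> (\<exists>c'. half_open_cube c l \<subseteq> half_open_cube c' (2 * l) \<and> \<not> P c' (2 * l))"
      if cl: "(c, l) \<in> C ` S" for c l
    proof -
      obtain x where x: "x \<in> S" "(c, l) = C x" using cl by auto
      show ?thesis
      proof (cases "\<tau> x")
        case 0
        then show ?thesis using x cell_0[OF s, of x a] by (simp add: C_def S_def)
      next
        case (Suc N)
        have l: "2 * l = s / 2 ^ N" using x(2) Suc by (simp add: C_def)
        have "half_open_cube c l \<subseteq> half_open_cube (cell_corner a s N x) (2 * l)"
          unfolding l using x(2) Suc cell_antimono[OF s, of N "Suc N" a x] by (simp add: C_def)
        moreover have "\<not> P (cell_corner a s N x) (2 * l)" unfolding l using \<tau>_least[of N x] Suc by simp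
        ultimately show ?thesis by blast
      qed
    qed
  qed
qed

text \<open>Countable additivity of the measure with density \<open>g\<close>.\<close>

lemma nn_integral_UN_disjoint:
  fixes A :: "'i \<Rightarrow> 'a set"
  assumes "countable I" "disjoint_family_on A I" "\<And>i. i \<in> I \<Longrightarrow> A i \<in> sets M"
    and [measurable]: "g \<in> borel_measurable M"
  shows "(\<integral>\<^sup>+x\<in>(\<Union>i\<in>I. A i). g x \<partial>M) = (\<integral>\<^sup>+i. (\<integral>\<^sup>+x\<in>A i. g x \<partial>M) \<partial>count_space I)"
proof -
  have "emeasure (density M g) (\<Union>i\<in>I. A i) = (\<integral>\<^sup>+i. emeasure (density M g) (A i) \<partial>count_space I)"
    using assms by (intro emeasure_UN_countable) auto
  moreover have "(\<Union>i\<in>I. A i) \<in> sets M" using assms by (intro sets.countable_UN') auto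
  ultimately show ?thesis
    using assms(3) by (simp add: emeasure_density cong: nn_integral_cong_simp)
qed

subsection \<open>The Calderon--Zygmund decomposition\<close>

text \<open>By comparison with the l1 norm, a cell of generation N has diameter at most n * s /
  2^N.\<close>

lemma cell_shrinks:
  fixes x :: "real^'a"
  assumes "0 < s" "open U" "x \<in> U"
  shows "\<exists>N. half_open_cube (cell_corner a s N x) (s / 2 ^ N) \<subseteq> U"
proof -
  obtain e where e: "0 < e" "ball x e \<subseteq> U" using assms(2,3) by (auto simp: open_contains_ball)
  obtain N where N: "CARD('a) * s / e < 2 ^ N" using real_arch_pow[of 2] by auto
  have "y \<in> ball x e" if y: "y \<in> half_open_cube (cell_corner a s N x) (s / 2 ^ N)" for y
  proof -
    have x: "x \<in> half_open_cube (cell_corner a s N x) (s / 2 ^ N)" by (rule self_in_cell[OF assms(1)])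
    have "\<bar>(x - y) $ i\<bar> \<le> s / 2 ^ N" for i
      using x y unfolding half_open_cube_def by (simp, smt (verit))
    then have "norm (x - y) \<le> (\<Sum>i\<in>(UNIV :: 'a set). s / 2 ^ N)"
      by (intro order_trans[OF norm_le_l1_cart sum_mono])
    also have "\<dots> < e" using N e assms(1) by (simp add: field_simps)
    finally show ?thesis by (simp add: dist_norm)
  qed
  then show ?thesis using e by blast
qed

text \<open>A one-sided form of Lebesgue's differentiation theorem: covering by grid cells inside an
  open superset of almost the same measure.\<close>

lemma AE_le_of_cell_means_le:
  fixes h :: "real^'n \<Rightarrow> ennreal"
  assumes s: "0 < s" and [measurable]: "h \<in> borel_measurable lebesgue" "G \<in> sets lebesgue"
    and G: "G \<subseteq> half_open_cube a s" and "L < top"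
    and le: "\<And>x N. x \<in> G \<Longrightarrow> (\<integral>\<^sup>+y\<in>half_open_cube (cell_corner a s N x) (s / 2 ^ N). h y \<partial>lebesgue)
        \<le> L * emeasure lebesgue (half_open_cube (cell_corner a s N x) (s / 2 ^ N))"
  shows "AE x in lebesgue. x \<in> G \<longrightarrow> h x \<le> L"
proof -
  \<comment> \<open>On this exceptional set h exceeds L everywhere; the covering will show that its
    integral over the set is nevertheless at most L times the measure, which forces the set to be
    null.\<close>
  define E where "E = {x \<in> G. L < h x}"
  have E: "E \<in> sets lebesgue" unfolding E_def by measurable
  have "emeasure lebesgue E \<le> emeasure lebesgue (cube a s)"
    using G half_open_cube_subset_cube[of a s] by (intro emeasure_mono) (auto simp: E_def)
  also have "\<dots> < top" using s emeasure_cube[of s a] by simp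
  finally have fin: "emeasure lebesgue E < top" .
  have "(\<integral>\<^sup>+x\<in>E. h x \<partial>lebesgue) \<le> L * emeasure lebesgue E"
  proof (rule ennreal_le_epsilon)
    fix e :: real assume e: "0 < e"
    obtain l where l: "L = ennreal l" "0 \<le> l" using \<open>L < top\<close> by (cases L) auto
    \<comment> \<open>The added 1 keeps the quotient meaningful for l = 0 and still gives l * \<eta>
      <= e.\<close>
    define \<eta> where "\<eta> = e / (l + 1)"
    have \<eta>: "0 < \<eta>" "l * \<eta> \<le> e" using e l by (auto simp: \<eta>_def field_simps)
    obtain U where U: "open U" "E \<subseteq> U" "(U - E) \<in> lmeasurable" "emeasure lebesgue (U - E) < ennreal \<eta>"
      using sets_lebesgue_outer_open[OF E \<eta>(1)] by auto
    have [measurable]: "U \<in> sets lebesgue" using U(1) by (simp add: borel_open)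
    \<comment> \<open>Requiring a cell to meet \<open>E\<close> provides a point of \<open>G\<close>
      in it, and then the cell is one of those whose mean the hypothesis \<open>le\<close>
      controls.\<close>
    obtain I where I: "countable I" "disjoint_family_on (\<lambda>(c, l). half_open_cube c l) I"
      "(\<Union>(c, l)\<in>I. half_open_cube c l) = {x \<in> half_open_cube a s. \<exists>N. half_open_cube (cell_corner a s N x) (s / 2 ^ N) \<subseteq> U
          \<and> half_open_cube (cell_corner a s N x) (s / 2 ^ N) \<inter> E \<noteq> {}}"
      "\<And>c l. (c, l) \<in> I \<Longrightarrow> 0 < l \<and> half_open_cube c l \<subseteq> U \<and> half_open_cube c l \<inter> E \<noteq> {}"
      "\<And>c l. (c, l) \<in> I \<Longrightarrow> \<exists>x N. x \<in> half_open_cube a s \<and> c = cell_corner a s N x \<and> l = s / 2 ^ N"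
      by (rule maximal_cells[OF s, of a "\<lambda>c l. half_open_cube c l \<subseteq> U \<and> half_open_cube c l \<inter> E \<noteq> {}"]) blast
    define H where "H = (\<lambda>(c, l). half_open_cube c l :: (real^'n) set)"
    have Hs: "H i \<in> sets lebesgue" for i by (auto simp: H_def split: prod.split)
    have HU: "(\<Union>i\<in>I. H i) \<in> sets lebesgue" using Hs I(1) by (intro sets.countable_UN') auto
    have sub: "(\<Union>i\<in>I. H i) \<subseteq> U" using I(4) by (auto simp: H_def)
    have EH: "E \<subseteq> (\<Union>i\<in>I. H i)"
    proof
      fix x assume x: "x \<in> E"
      then have "x \<in> half_open_cube a s" using G by (auto simp: E_def)
      moreover obtain N where "half_open_cube (cell_corner a s N x) (s / 2 ^ N) \<subseteq> U"
        using cell_shrinks[OF s U(1), of x a] U(2) x by auto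
      moreover have "x \<in> half_open_cube (cell_corner a s N x) (s / 2 ^ N)" by (rule self_in_cell[OF s])
      ultimately have "x \<in> (\<Union>(c, l)\<in>I. half_open_cube c l)" unfolding I(3) using x by blast
      then show "x \<in> (\<Union>i\<in>I. H i)" by (simp add: H_def)
    qed
    have cell: "(\<integral>\<^sup>+x\<in>H i. h x \<partial>lebesgue) \<le> L * emeasure lebesgue (H i)" if i: "i \<in> I" for i
    proof -
      obtain c l where cl: "i = (c, l)" by (cases i)
      obtain x N where x: "c = cell_corner a s N x" "l = s / 2 ^ N" using I(5) i cl by blast
      obtain y where y: "y \<in> half_open_cube c l" "y \<in> E" using I(4) i cl by blast
      have "cell_corner a s N y = c" using y(1) unfolding x by (simp add: mem_cell s)
      then show ?thesis using le[of y N] y(2) by (simp add: E_def H_def cl x(2))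
    qed
    have "(\<integral>\<^sup>+x\<in>E. h x \<partial>lebesgue) \<le> (\<integral>\<^sup>+x\<in>(\<Union>i\<in>I. H i). h x \<partial>lebesgue)"
      by (intro nn_integral_mono) (use EH in \<open>auto simp: indicator_def\<close>)
    also have "\<dots> = (\<integral>\<^sup>+i. (\<integral>\<^sup>+x\<in>H i. h x \<partial>lebesgue) \<partial>count_space I)"
      using I(2) Hs by (intro nn_integral_UN_disjoint I(1)) (auto simp: H_def)
    also have "\<dots> \<le> (\<integral>\<^sup>+i. L * emeasure lebesgue (H i) \<partial>count_space I)"
      by (intro nn_integral_mono) (use cell in auto)
    also have "\<dots> = L * (\<integral>\<^sup>+i. emeasure lebesgue (H i) \<partial>count_space I)"
      by (intro nn_integral_cmult) auto
    also have "(\<integral>\<^sup>+i. emeasure lebesgue (H i) \<partial>count_space I) = emeasure lebesgue (\<Union>i\<in>I. H i)"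
      using I(2) Hs by (intro emeasure_UN_countable[symmetric] I(1)) (auto simp: H_def)
    also have "\<dots> \<le> emeasure lebesgue U" by (intro emeasure_mono sub) measurable
    also have "emeasure lebesgue U = emeasure lebesgue E + emeasure lebesgue (U - E)"
      using E U(2) by (subst plus_emeasure) (auto simp: Un_absorb1)
    also have "\<dots> \<le> emeasure lebesgue E + ennreal \<eta>" using U(4) by (intro add_left_mono less_imp_le)
    finally have "(\<integral>\<^sup>+x\<in>E. h x \<partial>lebesgue) \<le> L * (emeasure lebesgue E + ennreal \<eta>)"
      by (auto simp: mult_left_mono)
    also have "\<dots> = L * emeasure lebesgue E + ennreal (l * \<eta>)"
      using l by (simp add: distrib_left ennreal_mult')
    also have "\<dots> \<le> L * emeasure lebesgue E + ennreal e" using \<eta> by (intro add_left_mono ennreal_leI)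
    finally show "(\<integral>\<^sup>+x\<in>E. h x \<partial>lebesgue) \<le> L * emeasure lebesgue E + ennreal e" .
  qed
  moreover have "(\<integral>\<^sup>+x\<in>E. h x \<partial>lebesgue) = (\<integral>\<^sup>+x\<in>E. (h x - L) \<partial>lebesgue) + L * emeasure lebesgue E"
  proof -
    have "(\<integral>\<^sup>+x\<in>E. h x \<partial>lebesgue) = (\<integral>\<^sup>+x. (h x - L) * indicator E x + L * indicator E x \<partial>lebesgue)"
      by (intro nn_integral_cong) (auto simp: E_def indicator_def diff_add_cancel_ennreal less_imp_le)
    also have "\<dots> = (\<integral>\<^sup>+x\<in>E. (h x - L) \<partial>lebesgue) + L * emeasure lebesgue E"
      using E by (subst nn_integral_add) (auto simp: nn_integral_cmult)
    finally show ?thesis .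
  qed
  \<comment> \<open>Finiteness allows L times the measure of \<open>E\<close> to be cancelled: the
    excess h - L has integral 0 over \<open>E\<close>, although it is positive there.\<close>
  moreover have "L * emeasure lebesgue E < top" using fin \<open>L < top\<close> by (simp add: ennreal_mult_less_top)
  ultimately have "(\<integral>\<^sup>+x\<in>E. (h x - L) \<partial>lebesgue) = 0"
    using ennreal_add_left_cancel_le[of "L * emeasure lebesgue E" "\<integral>\<^sup>+x\<in>E. (h x - L) \<partial>lebesgue" 0]
    by (auto simp: add.commute)
  then have "AE x in lebesgue. (h x - L) * indicator E x = 0"
    using E by (subst (asm) nn_integral_0_iff_AE) auto
  then show ?thesis
  proof eventually_elim
    case (elim x)
    have False if "x \<in> G" "L < h x"
      using elim that diff_gr0_ennreal[OF that(2)] by (simp add: E_def)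
    then show ?case by (meson not_le)
  qed
qed

lemma emeasure_cube_double:
  assumes "0 \<le> l"
  shows "emeasure lebesgue (cube c' (2 * l) :: (real^'n) set) = 2 ^ CARD('n) * emeasure lebesgue (cube (c :: real^'n) l)"
proof -
  have "0 \<le> 2 * l" using assms by simp
  show ?thesis unfolding emeasure_cube[OF assms] emeasure_cube[OF \<open>0 \<le> 2 * l\<close>]
    using assms by (simp add: power_mult_distrib ennreal_mult' ennreal_power[symmetric])
qed

text \<open>Selected are the maximal cells on which the mean exceeds L. By \<open>avg\<close> the
  base cube is not among them, so each selected cell has a parent with mean at most L, and the
  volume ratio 2^n gives the upper bound. The clause for arbitrary \<open>g\<close> records that the
  cubes lie in the base cube and are disjoint up to null sets, in the form in which the iterations
  use it.\<close>

lemma calderon_zygmund: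
  fixes h :: "real^'n \<Rightarrow> ennreal"
  assumes s: "0 < s" and [measurable]: "h \<in> borel_measurable lebesgue" and L: "L < top"
    and avg: "(\<integral>\<^sup>+x\<in>cube a s. h x \<partial>lebesgue) \<le> L * emeasure lebesgue (cube a s)"
  obtains I where "countable I"
    "\<And>c l. (c, l) \<in> I \<Longrightarrow> 0 < l \<and> cube c l \<subseteq> cube a s"
    "\<And>c l. (c, l) \<in> I \<Longrightarrow> L * emeasure lebesgue (cube c l) \<le> (\<integral>\<^sup>+x\<in>cube c l. h x \<partial>lebesgue)"
    "\<And>c l. (c, l) \<in> I \<Longrightarrow> (\<integral>\<^sup>+x\<in>cube c l. h x \<partial>lebesgue) \<le> 2 ^ CARD('n) * L * emeasure lebesgue (cube c l)"
    "\<And>g. g \<in> borel_measurable lebesgue \<Longrightarrow>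
       (\<integral>\<^sup>+i. (\<integral>\<^sup>+x\<in>cube (fst i) (snd i). g x \<partial>lebesgue) \<partial>count_space I) \<le> (\<integral>\<^sup>+x\<in>cube a s. g x \<partial>lebesgue)"
    "AE x in lebesgue. x \<in> cube a s \<longrightarrow> x \<notin> (\<Union>i\<in>I. cube (fst i) (snd i)) \<longrightarrow> h x \<le> L"
proof -
  define P where "P c l \<longleftrightarrow> L * emeasure lebesgue (half_open_cube c l) < (\<integral>\<^sup>+x\<in>half_open_cube c l. h x \<partial>lebesgue)" for c l
  obtain I where I: "countable I" "disjoint_family_on (\<lambda>(c, l). half_open_cube c l) I"
    "(\<Union>(c, l)\<in>I. half_open_cube c l) = {x \<in> half_open_cube a s. \<exists>N. P (cell_corner a s N x) (s / 2 ^ N)}"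
    "\<And>c l. (c, l) \<in> I \<Longrightarrow> 0 < l \<and> P c l"
    "\<And>c l. (c, l) \<in> I \<Longrightarrow> \<exists>x N. x \<in> half_open_cube a s \<and> c = cell_corner a s N x \<and> l = s / 2 ^ N"
    "\<And>c l. (c, l) \<in> I \<Longrightarrow> (c, l) = (a, s) \<or>
        (\<exists>c'. half_open_cube c l \<subseteq> half_open_cube c' (2 * l) \<and> \<not> P c' (2 * l))"
    by (rule maximal_cells[OF s, of a P], rule that) (assumption | blast)+
  have sub: "half_open_cube c l \<subseteq> half_open_cube a s" if "(c, l) \<in> I" for c l
    using that I(3) by blast
  define H where "H i = half_open_cube (fst i) (snd i :: real) " for i :: "(real^'n) \<times> real"
  have Hs: "H i \<in> sets lebesgue" for i by (simp add: H_def)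
  have UH: "(\<Union>i\<in>I. H i) = (\<Union>(c, l)\<in>I. half_open_cube c l)" by (auto simp: H_def split_beta)
  have dis: "disjoint_family_on H I" using I(2) by (simp add: H_def split_beta' disjoint_family_on_def)
  show thesis
  proof (rule that[of I])
    show "countable I" by fact
    show "0 < l \<and> cube c l \<subseteq> cube a s" if "(c, l) \<in> I" for c l
      using I(4)[OF that] cube_mono[OF sub[OF that]] by auto
    show "L * emeasure lebesgue (cube c l) \<le> (\<integral>\<^sup>+x\<in>cube c l. h x \<partial>lebesgue)" if "(c, l) \<in> I" for c l
      using I(4)[OF that] by (simp add: P_def nn_integral_half_open_cube emeasure_half_open_cube less_imp_le)
    show "(\<integral>\<^sup>+x\<in>cube c l. h x \<partial>lebesgue) \<le> 2 ^ CARD('n) * L * emeasure lebesgue (cube c l)" if cl: "(c, l) \<in> I" for c l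
    proof -
      have P: "0 < l" "P c l" using I(4)[OF cl] by auto
      have "(c, l) \<noteq> (a, s)" using P(2) avg by (auto simp: P_def nn_integral_half_open_cube emeasure_half_open_cube)
      then obtain c' where c': "half_open_cube c l \<subseteq> half_open_cube c' (2 * l)" "\<not> P c' (2 * l)"
        using I(6)[OF cl] by auto
      have "(\<integral>\<^sup>+x\<in>cube c l. h x \<partial>lebesgue) = (\<integral>\<^sup>+x\<in>half_open_cube c l. h x \<partial>lebesgue)"
        by (simp add: nn_integral_half_open_cube)
      also have "\<dots> \<le> (\<integral>\<^sup>+x\<in>half_open_cube c' (2 * l). h x \<partial>lebesgue)"
        using c'(1) by (intro nn_integral_mono) (auto simp: indicator_def)
      also have "\<dots> \<le> L * emeasure lebesgue (half_open_cube c' (2 * l))" using c'(2) by (simp add: P_def)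
      also have "\<dots> = 2 ^ CARD('n) * L * emeasure lebesgue (cube c l)"
        unfolding emeasure_half_open_cube emeasure_cube_double[OF less_imp_le[OF P(1)], of c' c] by (simp only: ac_simps)
      finally show ?thesis .
    qed
    show "(\<integral>\<^sup>+i. (\<integral>\<^sup>+x\<in>cube (fst i) (snd i). g x \<partial>lebesgue) \<partial>count_space I) \<le> (\<integral>\<^sup>+x\<in>cube a s. g x \<partial>lebesgue)"
      if [measurable]: "g \<in> borel_measurable lebesgue" for g
    proof -
      have "(\<integral>\<^sup>+i. (\<integral>\<^sup>+x\<in>cube (fst i) (snd i). g x \<partial>lebesgue) \<partial>count_space I) = (\<integral>\<^sup>+i. (\<integral>\<^sup>+x\<in>H i. g x \<partial>lebesgue) \<partial>count_space I)"
        by (simp add: nn_integral_half_open_cube H_def)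
      also have "\<dots> = (\<integral>\<^sup>+x\<in>(\<Union>i\<in>I. H i). g x \<partial>lebesgue)"
        using Hs by (intro nn_integral_UN_disjoint[symmetric] I(1) dis) auto
      also have "\<dots> \<le> (\<integral>\<^sup>+x\<in>half_open_cube a s. g x \<partial>lebesgue)"
        using sub unfolding UH by (intro nn_integral_mono) (auto simp: indicator_def)
      finally show ?thesis by (simp add: nn_integral_half_open_cube)
    qed
    define G where "G = half_open_cube a s - (\<Union>i\<in>I. H i)"
    have "AE x in lebesgue. x \<in> G \<longrightarrow> h x \<le> L"
    proof (rule AE_le_of_cell_means_le[OF s])
      show "G \<in> sets lebesgue" unfolding G_def using Hs I(1) by (intro sets.Diff sets.countable_UN') auto
      fix x N assume "x \<in> G"
      then have "\<not> P (cell_corner a s N x) (s / 2 ^ N)" unfolding G_def UH I(3) by blast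
      then show "(\<integral>\<^sup>+y\<in>half_open_cube (cell_corner a s N x) (s / 2 ^ N). h y \<partial>lebesgue)
        \<le> L * emeasure lebesgue (half_open_cube (cell_corner a s N x) (s / 2 ^ N))"
        by (simp add: P_def)
    qed (use L in \<open>auto simp: G_def\<close>)
    then show "AE x in lebesgue. x \<in> cube a s \<longrightarrow> x \<notin> (\<Union>i\<in>I. cube (fst i) (snd i)) \<longrightarrow> h x \<le> L"
      using AE_cube_iff_half_open_cube[of a s]
    proof eventually_elim
      case (elim x)
      then show ?case using half_open_cube_subset_cube unfolding G_def H_def by blast
    qed
  qed
qed

lemma nn_integral_UN_le:
  assumes "countable I" "\<And>i. i \<in> I \<Longrightarrow> A i \<in> sets M" and [measurable]: "g \<in> borel_measurable M"
  shows "(\<integral>\<^sup>+x\<in>(\<Union>i\<in>I. A i). g x \<partial>M) \<le> (\<integral>\<^sup>+i. (\<integral>\<^sup>+x\<in>A i. g x \<partial>M) \<partial>count_space I)"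
proof -
  have "(\<integral>\<^sup>+x\<in>(\<Union>i\<in>I. A i). g x \<partial>M) \<le> (\<integral>\<^sup>+x. (\<integral>\<^sup>+i. g x * indicator (A i) x \<partial>count_space I) \<partial>M)"
  proof (intro nn_integral_mono)
    fix x
    show "g x * indicator (\<Union>i\<in>I. A i) x \<le> (\<integral>\<^sup>+i. g x * indicator (A i) x \<partial>count_space I)"
    proof (cases "x \<in> (\<Union>i\<in>I. A i)")
      case True
      then obtain i where i: "i \<in> I" "x \<in> A i" by auto
      have "g x * indicator (A i) x = (\<integral>\<^sup>+j. g x * indicator (A j) x * indicator {i} j \<partial>count_space I)"
        using i by (subst nn_integral_indicator_singleton) auto
      also have "\<dots> \<le> (\<integral>\<^sup>+j. g x * indicator (A j) x \<partial>count_space I)"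
        by (intro nn_integral_mono) (auto simp: indicator_def)
      finally show ?thesis using i True by simp
    qed simp
  qed
  also have "\<dots> = (\<integral>\<^sup>+i. (\<integral>\<^sup>+x\<in>A i. g x \<partial>M) \<partial>count_space I)"
    using assms by (intro nn_integral_count_space_nn_integral) auto
  finally show ?thesis .
qed

section \<open>Averages over cubes and local integrability\<close>

lemma emeasure_cube_bounds:
  assumes "0 < s"
  shows "0 < emeasure lebesgue (cube a s)" "emeasure lebesgue (cube a s) < top"
  using assms by (subst emeasure_cube; simp)+

lemma emean_mult_emeasure:
  assumes "Q \<in> cubes"
  shows "emean Q g * emeasure lebesgue Q = (\<integral>\<^sup>+x\<in>Q. g x \<partial>lebesgue)"
proof -
  have "0 < emeasure lebesgue Q" "emeasure lebesgue Q < top"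
    using assms emeasure_cube_bounds by (auto simp: cubes_eq)
  then show ?thesis unfolding emean_def
    by (simp add: ennreal_divide_times)
qed

lemma sets_cubes: "Q \<in> cubes \<Longrightarrow> Q \<in> sets lebesgue"
  by (auto simp: cubes_eq)

lemma emean_mono_AE:
  "AE x in lebesgue. x \<in> Q \<longrightarrow> f x \<le> g x \<Longrightarrow> emean Q f \<le> emean Q g"
  unfolding emean_def
  by (intro divide_right_mono_ennreal nn_integral_mono_AE) (auto elim!: eventually_mono simp: indicator_def)

lemma emean_cmult:
  "g \<in> borel_measurable lebesgue \<Longrightarrow> Q \<in> sets lebesgue \<Longrightarrow> emean Q (\<lambda>x. c * g x) = c * emean Q g"
  unfolding emean_def by (simp add: mult.assoc nn_integral_cmult ennreal_times_divide)

lemma emean_const: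
  assumes "Q \<in> cubes" shows "emean Q (\<lambda>_. c) = c"
proof -
  have "0 < emeasure lebesgue Q" "emeasure lebesgue Q < top"
    using assms emeasure_cube_bounds by (auto simp: cubes_eq)
  then show ?thesis using sets_cubes[OF assms] unfolding emean_def
    by (subst nn_integral_cmult_indicator) (auto simp: mult_divide_eq_ennreal simp del: emeasure_completion)
qed

text \<open>Integrability is given only on compact sets; globally \<open>g\<close> is the pointwise
  limit of its restrictions to growing balls.\<close>

lemma locally_integrable_measurable:
  fixes g :: "real^'n \<Rightarrow> 'b::{banach,second_countable_topology}"
  assumes "locally_integrable g"
  shows "g \<in> borel_measurable lebesgue"
proof (rule borel_measurable_LIMSEQ_metric)
  show "(\<lambda>x. indicator (cball 0 (real i)) x *\<^sub>R g x) \<in> borel_measurable lebesgue" for i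
    using assms by (auto simp: locally_integrable_def set_integrable_def dest!: spec[of _ "cball 0 (real i)"])
  fix x :: "real^'n"
  obtain N where N: "norm x \<le> real N" using real_arch_simple by blast
  have "\<forall>\<^sub>F i in sequentially. indicator (cball 0 (real i)) x *\<^sub>R g x = g x"
    using eventually_ge_at_top[of N] by eventually_elim (use N in auto)
  then show "(\<lambda>i. indicator (cball 0 (real i)) x *\<^sub>R g x) \<longlonglongrightarrow> g x" by (rule tendsto_eventually)
qed

lemma locally_integrable_cube:
  assumes "locally_integrable g" "Q \<in> cubes"
  shows "set_integrable lebesgue Q g"
  using assms by (auto simp: locally_integrable_def cubes_eq cube_def)

lemma locally_integrable_nn_integral:
  assumes "locally_integrable g" "Q \<in> cubes"
  shows "(\<integral>\<^sup>+x\<in>Q. ennreal (norm (g x)) \<partial>lebesgue) < top"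
proof -
  have "integrable lebesgue (\<lambda>x. indicator Q x *\<^sub>R g x)"
    using locally_integrable_cube[OF assms] by (simp add: set_integrable_def)
  then have "(\<integral>\<^sup>+x. ennreal (norm (indicator Q x *\<^sub>R g x)) \<partial>lebesgue) < top"
    unfolding integrable_iff_bounded by simp
  also have "(\<integral>\<^sup>+x. ennreal (norm (indicator Q x *\<^sub>R g x)) \<partial>lebesgue) = (\<integral>\<^sup>+x\<in>Q. ennreal (norm (g x)) \<partial>lebesgue)"
    by (intro nn_integral_cong) (auto simp: indicator_def)
  finally show ?thesis .
qed

text \<open>The common engine of the John-Nirenberg and reverse Hoelder inequalities.
  \<open>B a s k\<close> is the part of a cube above level k. If one selection step multiplies the
  mass by at most \<open>\<theta>\<close>, and the part above level k + 1 is covered by the parts of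
  the selected subcubes above level k, the mass decays geometrically. The first use takes g = 1, the
  second the weight itself.\<close>

lemma cube_level_set_decay:
  fixes g :: "real^'n \<Rightarrow> ennreal" and B :: "real^'n \<Rightarrow> real \<Rightarrow> nat \<Rightarrow> (real^'n) set"
  assumes [measurable]: "g \<in> borel_measurable lebesgue" "\<And>a s k. B a s k \<in> sets lebesgue"
    and B: "\<And>a s k. B a s k \<subseteq> cube a s"
    and step: "\<And>a s. 0 < s \<Longrightarrow> \<exists>I. countable I \<and> (\<forall>(c, l)\<in>I. 0 < l) \<and>
        (\<integral>\<^sup>+i. (\<integral>\<^sup>+x\<in>cube (fst i) (snd i). g x \<partial>lebesgue) \<partial>count_space I) \<le> \<theta> * (\<integral>\<^sup>+x\<in>cube a s. g x \<partial>lebesgue) \<and>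
        (AE x in lebesgue. \<forall>k. x \<in> B a s (Suc k) \<longrightarrow> x \<in> (\<Union>i\<in>I. B (fst i) (snd i) k))"
    and "0 < s"
  shows "(\<integral>\<^sup>+x\<in>B a s k. g x \<partial>lebesgue) \<le> \<theta> ^ k * (\<integral>\<^sup>+x\<in>cube a s. g x \<partial>lebesgue)"
  using \<open>0 < s\<close>
proof (induction k arbitrary: a s)
  case 0
  show ?case using B[of a s 0] by (auto intro!: nn_integral_mono simp: indicator_def)
next
  case (Suc k)
  obtain I where I: "countable I" "\<forall>(c, l)\<in>I. 0 < l"
    "(\<integral>\<^sup>+i. (\<integral>\<^sup>+x\<in>cube (fst i) (snd i). g x \<partial>lebesgue) \<partial>count_space I) \<le> \<theta> * (\<integral>\<^sup>+x\<in>cube a s. g x \<partial>lebesgue)"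
    "AE x in lebesgue. \<forall>k. x \<in> B a s (Suc k) \<longrightarrow> x \<in> (\<Union>i\<in>I. B (fst i) (snd i) k)"
    using step[OF Suc.prems] by blast
  have "(\<integral>\<^sup>+x\<in>B a s (Suc k). g x \<partial>lebesgue) \<le> (\<integral>\<^sup>+x\<in>(\<Union>i\<in>I. B (fst i) (snd i) k). g x \<partial>lebesgue)"
    by (intro nn_integral_mono_AE, use I(4) in eventually_elim) (auto simp: indicator_def)
  also have "\<dots> \<le> (\<integral>\<^sup>+i. (\<integral>\<^sup>+x\<in>B (fst i) (snd i) k. g x \<partial>lebesgue) \<partial>count_space I)"
    by (intro nn_integral_UN_le I) auto
  also have "\<dots> \<le> (\<integral>\<^sup>+i. \<theta> ^ k * (\<integral>\<^sup>+x\<in>cube (fst i) (snd i). g x \<partial>lebesgue) \<partial>count_space I)"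
    using I(2) by (intro nn_integral_mono Suc.IH) auto
  also have "\<dots> = \<theta> ^ k * (\<integral>\<^sup>+i. (\<integral>\<^sup>+x\<in>cube (fst i) (snd i). g x \<partial>lebesgue) \<partial>count_space I)"
    by (intro nn_integral_cmult) auto
  also have "\<dots> \<le> \<theta> ^ k * (\<theta> * (\<integral>\<^sup>+x\<in>cube a s. g x \<partial>lebesgue))" by (intro mult_left_mono I) auto
  finally show ?case by (simp add: ac_simps)
qed

subsection \<open>The John--Nirenberg inequality\<close>

text \<open>The triangle inequality for the integral, cleared of denominators. With \<open>z\<close>
  the mean over a larger cube it compares means across one selection step.\<close>

lemma norm_mean_diff_le:
  assumes "locally_integrable b" "Q \<in> cubes"
  shows "ennreal (norm (mean Q b - z)) * emeasure lebesgue Q \<le> (\<integral>\<^sup>+x\<in>Q. ennreal (norm (b x - z)) \<partial>lebesgue)"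
proof -
  obtain a s where Q: "0 < s" "Q = cube a s" using assms(2) by (auto simp: cubes_eq)
  have Qs: "Q \<in> sets lebesgue" by (simp add: Q)
  have m: "emeasure lebesgue Q = ennreal (measure lebesgue Q)" "0 < measure lebesgue Q"
    unfolding Q using emeasure_cube[of s a] measure_cube[of s a] Q(1) by (simp_all del: emeasure_completion measure_completion)
  have i1: "integrable lebesgue (\<lambda>x. indicator Q x *\<^sub>R b x)"
    using locally_integrable_cube[OF assms] by (simp add: set_integrable_def)
  have i2: "integrable lebesgue (\<lambda>x. indicator Q x *\<^sub>R z)"
    by (rule integrable_indicator[OF Qs]) (simp add: m(1) del: emeasure_completion)
  have "(LINT x|lebesgue. indicator Q x *\<^sub>R (b x - z)) = (LINT x|lebesgue. indicator Q x *\<^sub>R b x) - (LINT x|lebesgue. indicator Q x *\<^sub>R z)"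
    unfolding scaleR_diff_right by (rule Bochner_Integration.integral_diff[OF i1 i2])
  also have "(LINT x|lebesgue. indicator Q x *\<^sub>R z) = measure lebesgue Q *\<^sub>R z"
    using Qs by (subst integral_scaleR_left) (simp_all add: m(1) integrable_indicator_iff del: emeasure_completion measure_completion)
  also have "(LINT x|lebesgue. indicator Q x *\<^sub>R b x) = measure lebesgue Q *\<^sub>R mean Q b"
    using m(2) by (simp add: mean_def set_lebesgue_integral_def del: measure_completion)
  finally have eq: "(LINT x|lebesgue. indicator Q x *\<^sub>R (b x - z)) = measure lebesgue Q *\<^sub>R (mean Q b - z)"
    by (simp add: scaleR_diff_right)
  have "integrable lebesgue (\<lambda>x. indicator Q x *\<^sub>R (b x - z))"
    unfolding scaleR_diff_right by (rule Bochner_Integration.integrable_diff[OF i1 i2])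
  from integral_norm_bound_ennreal[OF this]
  have "ennreal (measure lebesgue Q * norm (mean Q b - z)) \<le> (\<integral>\<^sup>+x. ennreal (norm (indicator Q x *\<^sub>R (b x - z))) \<partial>lebesgue)"
    unfolding eq using m(2) by (simp del: measure_completion)
  also have "\<dots> = (\<integral>\<^sup>+x\<in>Q. ennreal (norm (b x - z)) \<partial>lebesgue)"
    by (intro nn_integral_cong) (auto simp: indicator_def)
  finally show ?thesis unfolding m(1) by (simp add: ennreal_mult' mult.commute del: measure_completion)
qed

lemma bmo_norm_upper:
  "Q \<in> cubes \<Longrightarrow> emean Q (\<lambda>x. ennreal (norm (b x - mean Q b))) \<le> bmo_norm b"
  unfolding bmo_norm_def by (rule SUP_upper)

text \<open>Selection at height 2 B, twice the bound for the mean deviation, leaves cubes of at most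
  half the total measure. By the upper mean bound of the decomposition, the means of
  \<open>b\<close> over them differ from the old mean by at most 2^n * 2 B; this is the level width
  2^(n+1) B.\<close>

lemma john_nirenberg_decay:
  fixes b :: "real^'n \<Rightarrow> complex"
  assumes b: "locally_integrable b" and B: "0 < B" "bmo_norm b \<le> ennreal B" and s: "0 < s"
  shows "emeasure lebesgue {x \<in> cube a s. real k * (2 ^ (CARD('n) + 1) * B) < norm (b x - mean (cube a s) b)}
    \<le> ennreal ((1 / 2) ^ k) * emeasure lebesgue (cube a s)"
proof -
  note [simp del] = emeasure_completion measure_completion
  have [measurable]: "b \<in> borel_measurable lebesgue" by (rule locally_integrable_measurable[OF b])
  define c where "c = 2 ^ (CARD('n) + 1) * B"
  define T where "T a s k = {x \<in> cube a s. real k * c < norm (b x - mean (cube a s) b)}" for a :: "real^'n" and s k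
  have Ts: "T a s k \<in> sets lebesgue" for a s k unfolding T_def by measurable
  have avg: "(\<integral>\<^sup>+x\<in>cube a s. ennreal (norm (b x - mean (cube a s) b)) \<partial>lebesgue) \<le> ennreal B * emeasure lebesgue (cube a s)"
    if "0 < s" for a s
  proof -
    have "(\<integral>\<^sup>+x\<in>cube a s. ennreal (norm (b x - mean (cube a s) b)) \<partial>lebesgue)
        = emean (cube a s) (\<lambda>x. ennreal (norm (b x - mean (cube a s) b))) * emeasure lebesgue (cube a s)"
      by (rule emean_mult_emeasure[OF cube_in_cubes[OF that], symmetric])
    also have "\<dots> \<le> ennreal B * emeasure lebesgue (cube a s)"
      using bmo_norm_upper[of "cube a s" b, OF cube_in_cubes[OF that]] B(2) by (intro mult_right_mono) auto
    finally show ?thesis .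
  qed
  have "(\<integral>\<^sup>+x\<in>T a s k. 1 \<partial>lebesgue) \<le> ennreal (1/2) ^ k * (\<integral>\<^sup>+x\<in>cube a s. 1 \<partial>lebesgue)"
  proof (rule cube_level_set_decay[OF _ Ts _ _ s])
    show "T a s k \<subseteq> cube a s" for a s k by (auto simp: T_def)
    fix a :: "real^'n" and s :: real assume s: "0 < s"
    define h where "h x = ennreal (norm (b x - mean (cube a s) b))" for x
    have hm [measurable]: "h \<in> borel_measurable lebesgue" unfolding h_def by measurable
    have "ennreal B * emeasure lebesgue (cube a s) \<le> ennreal (2 * B) * emeasure lebesgue (cube a s)"
      using B by (intro mult_right_mono ennreal_leI) auto
    then have avg2: "(\<integral>\<^sup>+x\<in>cube a s. h x \<partial>lebesgue) \<le> ennreal (2 * B) * emeasure lebesgue (cube a s)"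
      using avg[OF s, of a] unfolding h_def by (rule order_trans[rotated])
    obtain I where I: "countable I"
      "\<And>c l. (c, l) \<in> I \<Longrightarrow> 0 < l \<and> cube c l \<subseteq> cube a s"
      "\<And>c l. (c, l) \<in> I \<Longrightarrow> ennreal (2 * B) * emeasure lebesgue (cube c l) \<le> (\<integral>\<^sup>+x\<in>cube c l. h x \<partial>lebesgue)"
      "\<And>c l. (c, l) \<in> I \<Longrightarrow> (\<integral>\<^sup>+x\<in>cube c l. h x \<partial>lebesgue) \<le> 2 ^ CARD('n) * ennreal (2 * B) * emeasure lebesgue (cube c l)"
      "\<And>g. g \<in> borel_measurable lebesgue \<Longrightarrow>
         (\<integral>\<^sup>+i. (\<integral>\<^sup>+x\<in>cube (fst i) (snd i). g x \<partial>lebesgue) \<partial>count_space I) \<le> (\<integral>\<^sup>+x\<in>cube a s. g x \<partial>lebesgue)"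
      "AE x in lebesgue. x \<in> cube a s \<longrightarrow> x \<notin> (\<Union>i\<in>I. cube (fst i) (snd i)) \<longrightarrow> h x \<le> ennreal (2 * B)"
      by (rule calderon_zygmund[OF s hm ennreal_less_top avg2], rule that) (assumption | blast)+
    have "ennreal (2 * B) * (\<integral>\<^sup>+i. emeasure lebesgue (cube (fst i) (snd i)) \<partial>count_space I)
        = (\<integral>\<^sup>+i. ennreal (2 * B) * emeasure lebesgue (cube (fst i) (snd i)) \<partial>count_space I)"
      by (intro nn_integral_cmult[symmetric]) auto
    also have "\<dots> \<le> (\<integral>\<^sup>+i. (\<integral>\<^sup>+x\<in>cube (fst i) (snd i). h x \<partial>lebesgue) \<partial>count_space I)"
      using I(3) by (intro nn_integral_mono) auto
    also have "\<dots> \<le> (\<integral>\<^sup>+x\<in>cube a s. h x \<partial>lebesgue)" by (rule I(5)) measurable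
    also have "\<dots> \<le> ennreal B * emeasure lebesgue (cube a s)" unfolding h_def by (rule avg[OF s])
    also have "\<dots> = ennreal (2 * B) * (ennreal (1 / 2) * emeasure lebesgue (cube a s))"
      using B(1) by (simp add: mult.assoc[symmetric] ennreal_mult[symmetric] del: ennreal_half)
    finally have I7: "(\<integral>\<^sup>+i. emeasure lebesgue (cube (fst i) (snd i)) \<partial>count_space I) \<le> ennreal (1 / 2) * emeasure lebesgue (cube a s)"
      using B(1) by (subst (asm) ennreal_mult_le_mult_iff) auto
    have near: "norm (mean (cube c' l) b - mean (cube a s) b) \<le> c" if i: "(c', l) \<in> I" for c' l
    proof -
      have l: "0 < l" using I(2)[OF i] by simp
      have "ennreal (norm (mean (cube c' l) b - mean (cube a s) b)) * emeasure lebesgue (cube c' l)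
        \<le> (\<integral>\<^sup>+x\<in>cube c' l. h x \<partial>lebesgue)"
        unfolding h_def using l by (intro norm_mean_diff_le b cube_in_cubes)
      also have "\<dots> \<le> ennreal c * emeasure lebesgue (cube c' l)"
        using I(4)[OF i] B(1) by (simp add: c_def ennreal_mult' ennreal_power[symmetric] ac_simps)
      finally have "emeasure lebesgue (cube c' l) * ennreal (norm (mean (cube c' l) b - mean (cube a s) b))
        \<le> emeasure lebesgue (cube c' l) * ennreal c" by (simp only: mult.commute)
      then have "ennreal (norm (mean (cube c' l) b - mean (cube a s) b)) \<le> ennreal c"
        using emeasure_cube_bounds[OF l, of c'] by (subst (asm) ennreal_mult_le_mult_iff) auto
      then show ?thesis using B(1) by (simp add: c_def)
    qed
    \<comment> \<open>Outside the selected cubes the deviation is at most 2 B <= c, so almost every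
      point above level k + 1 lies in a selected cube; there the mean has moved by at most c, and
      level k is still exceeded.\<close>
    have "2 * B \<le> c" using B(1) by (simp add: c_def)
    have "AE x in lebesgue. \<forall>k. x \<in> T a s (Suc k) \<longrightarrow> x \<in> (\<Union>i\<in>I. T (fst i) (snd i) k)"
      using I(6)
    proof eventually_elim
      case (elim x)
      show ?case
      proof (intro allI impI)
        fix k assume x: "x \<in> T a s (Suc k)"
        then have xQ: "x \<in> cube a s" and xk: "real (Suc k) * c < norm (b x - mean (cube a s) b)" by (auto simp: T_def)
        have "0 \<le> real k * c" using \<open>2 * B \<le> c\<close> B(1) by simp
        then have "c < norm (b x - mean (cube a s) b)" using xk by (simp add: distrib_right)
        then have "\<not> h x \<le> ennreal (2 * B)" using \<open>2 * B \<le> c\<close> B(1) by (simp add: h_def)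
        then obtain c' l where i: "(c', l) \<in> I" "x \<in> cube c' l" using elim xQ by force
        have "real k * c < norm (b x - mean (cube c' l) b)"
          using near[OF i(1)] xk norm_triangle_ineq[of "b x - mean (cube c' l) b" "mean (cube c' l) b - mean (cube a s) b"]
          by (simp add: algebra_simps)
        then show "x \<in> (\<Union>i\<in>I. T (fst i) (snd i) k)" using i by (intro UN_I[of "(c', l)"]) (auto simp: T_def)
      qed
    qed
    then show "\<exists>I. countable I \<and> (\<forall>(c, l)\<in>I. 0 < l) \<and>
        (\<integral>\<^sup>+i. (\<integral>\<^sup>+x\<in>cube (fst i) (snd i). 1 \<partial>lebesgue) \<partial>count_space I) \<le> ennreal (1/2) * (\<integral>\<^sup>+x\<in>cube a s. 1 \<partial>lebesgue) \<and>
        (AE x in lebesgue. \<forall>k. x \<in> T a s (Suc k) \<longrightarrow> x \<in> (\<Union>i\<in>I. T (fst i) (snd i) k))"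
      using I(1,2) I7 by (intro exI[of _ I]) (auto simp del: ennreal_half)
  qed simp
  then show ?thesis using Ts[of a s k] by (simp add: T_def c_def ennreal_power del: ennreal_half)
qed

text \<open>The single level k with k t < h <= (k + 1) t dominates. It is the ceiling of h / t minus
  1 and not the floor, because the level sets are strict and the floor would fail at multiples of
  t.\<close>

lemma powr_le_sum_levels:
  assumes "0 \<le> h" "0 < t" "0 < u"
  shows "ennreal (h powr u) \<le> (\<Sum>k. ennreal ((real (Suc k) * t) powr u) * indicator {x. real k * t < x} h)"
proof (cases "h = 0")
  case False
  define k where "k = nat (\<lceil>h / t\<rceil> - 1)"
  have "0 < h / t" using False assms by simp
  then have "1 \<le> \<lceil>h / t\<rceil>" by linarith
  then have k: "real k = of_int \<lceil>h / t\<rceil> - 1" by (simp add: k_def)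
  have "real k < h / t" "h / t \<le> real (Suc k)" using k by linarith+
  then have "real k * t < h" "h \<le> real (Suc k) * t" using assms(2) by (auto simp: field_simps)
  then have "ennreal (h powr u) \<le> ennreal ((real (Suc k) * t) powr u) * indicator {x. real k * t < x} h"
    using assms by (auto intro!: ennreal_leI powr_mono2)
  moreover have "f k \<le> suminf f" for f :: "nat \<Rightarrow> ennreal"
    using sum_le_suminf[of f "{k}"] by simp
  ultimately show ?thesis by (rule order_trans)
qed (use assms in simp)

text \<open>The measures of the level sets decay exponentially while the u-th powers of their
  heights grow only polynomially, so every moment of the oscillation is controlled by the first
  one.\<close>

lemma john_nirenberg:
  fixes u :: real
  assumes u: "0 < u"
  obtains C :: real where "0 < C"
    "\<And>(b :: real^'n \<Rightarrow> complex) Q. b \<in> BMO \<Longrightarrow> Q \<in> cubes \<Longrightarrow>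
      emean Q (\<lambda>x. epowr (ennreal (norm (b x - mean Q b))) u) \<le> ennreal C * epowr (bmo_norm b) u"
proof -
  define c :: real where "c = 2 ^ (CARD('n) + 1)"
  define C where "C = (\<Sum>k. (real (Suc k) * c) powr u * (1/2) ^ k)"
  have c: "0 < c" by (simp add: c_def)
  have summ: "summable (\<lambda>k. (real (Suc k) * c) powr u * (1/2) ^ k)"
  proof (rule summable_comparison_test_bigo)
    \<comment> \<open>The ratio 3/4, larger than 1/2 and smaller than 1, absorbs the polynomial
      factor.\<close>
    show "summable (\<lambda>k. norm ((3/4::real) ^ k))" by (simp add: summable_geometric)
    show "(\<lambda>k. (real (Suc k) * c) powr u * (1/2) ^ k) \<in> O(\<lambda>k. (3/4) ^ k)"
      using c u by real_asymp
  qed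
  have C0: "0 < C" unfolding C_def using c by (intro suminf_pos summ) auto
  show thesis
  proof (rule that[OF C0])
    fix b :: "real^'n \<Rightarrow> complex" and Q :: "(real^'n) set" assume b: "b \<in> BMO" and Q: "Q \<in> cubes"
    have lb: "locally_integrable b" and fin: "bmo_norm b < top" using b by (auto simp: BMO_def)
    have [measurable]: "b \<in> borel_measurable lebesgue" by (rule locally_integrable_measurable[OF lb])
    have [measurable]: "Q \<in> sets lebesgue" by (rule sets_cubes[OF Q])
    define H where "H x = norm (b x - mean Q b)" for x
    have [measurable]: "H \<in> borel_measurable lebesgue" unfolding H_def by measurable
    have avg: "emean Q (\<lambda>x. ennreal (H x)) \<le> bmo_norm b" unfolding H_def by (rule bmo_norm_upper[OF Q])
    show "emean Q (\<lambda>x. epowr (ennreal (norm (b x - mean Q b))) u) \<le> ennreal C * epowr (bmo_norm b) u"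
    \<comment> \<open>The decay estimate takes a positive bound as its unit of height. For norm 0
      the deviation vanishes almost everywhere on \<open>Q\<close>.\<close>
    proof (cases "bmo_norm b = 0")
      case True
      then have "(\<integral>\<^sup>+x\<in>Q. ennreal (H x) \<partial>lebesgue) = 0"
        using avg emean_mult_emeasure[OF Q, of "\<lambda>x. ennreal (H x)"] by simp
      then have "AE x in lebesgue. ennreal (H x) * indicator Q x = 0"
        by (subst (asm) nn_integral_0_iff_AE) auto
      then have "AE x in lebesgue. x \<in> Q \<longrightarrow> epowr (ennreal (H x)) u \<le> 0"
        by eventually_elim (use u in \<open>auto simp: indicator_def H_def\<close>)
      then have "emean Q (\<lambda>x. epowr (ennreal (H x)) u) \<le> emean Q (\<lambda>_. 0)" by (rule emean_mono_AE)
      also have "\<dots> = 0" by (simp add: emean_def)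
      finally show ?thesis by (simp add: H_def)
    next
      case False
      define B where "B = enn2real (bmo_norm b)"
      have B: "bmo_norm b = ennreal B" "0 < B" using False fin
        by (auto simp: B_def enn2real_positive_iff zero_less_iff_neq_zero)
      obtain a s where s: "0 < s" "Q = cube a s" using Q by (auto simp: cubes_eq)
      define E where "E k = {x \<in> Q. real k * (c * B) < H x}" for k
      have Es: "E k \<in> sets lebesgue" for k unfolding E_def by measurable
      have E: "emeasure lebesgue (E k) \<le> ennreal ((1 / 2) ^ k) * emeasure lebesgue Q" for k
        using john_nirenberg_decay[OF lb B(2) _ s(1), of a k] B(1)
        by (simp add: E_def H_def s(2) c_def del: emeasure_completion)
      have "(\<integral>\<^sup>+x\<in>Q. epowr (ennreal (H x)) u \<partial>lebesgue)
        \<le> (\<integral>\<^sup>+x. (\<Sum>k. ennreal ((real (Suc k) * (c * B)) powr u) * indicator (E k) x) \<partial>lebesgue)"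
      proof (intro nn_integral_mono)
        fix x
        have "0 \<le> H x" by (simp add: H_def)
        moreover have "indicator (E k) x = (indicator {y. real k * (c * B) < y} (H x) :: ennreal)" if "x \<in> Q" for k
          using that by (simp add: E_def indicator_def)
        ultimately show "epowr (ennreal (H x)) u * indicator Q x \<le> (\<Sum>k. ennreal ((real (Suc k) * (c * B)) powr u) * indicator (E k) x)"
          using powr_le_sum_levels[of "H x" "c * B" u] u B c
          by (cases "x \<in> Q") (simp_all add: epowr_ennreal del: of_nat_Suc)
      qed
      also have "\<dots> = (\<Sum>k. ennreal ((real (Suc k) * (c * B)) powr u) * emeasure lebesgue (E k))"
        using Es by (subst nn_integral_suminf) (simp_all add: nn_integral_cmult_indicator del: emeasure_completion of_nat_Suc)
      also have "\<dots> \<le> (\<Sum>k. ennreal ((real (Suc k) * (c * B)) powr u) * (ennreal ((1 / 2) ^ k) * emeasure lebesgue Q))"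
        by (intro suminf_le mult_left_mono E) auto
      also have "\<dots> = (\<Sum>k. ennreal ((real (Suc k) * c) powr u * (1 / 2) ^ k)) * ennreal (B powr u) * emeasure lebesgue Q"
        using B c by (simp add: ennreal_suminf_multc[symmetric] powr_mult ennreal_mult' ac_simps del: of_nat_Suc ennreal_suminf_multc emeasure_completion)
      also have "(\<Sum>k. ennreal ((real (Suc k) * c) powr u * (1 / 2) ^ k)) = ennreal C"
        unfolding C_def by (intro suminf_ennreal2 summ) auto
      also have "ennreal (B powr u) = epowr (bmo_norm b) u" using B u by (simp add: epowr_ennreal)
      finally have "(\<integral>\<^sup>+x\<in>Q. epowr (ennreal (H x)) u \<partial>lebesgue) \<le> ennreal C * epowr (bmo_norm b) u * emeasure lebesgue Q" .
      then have "emean Q (\<lambda>x. epowr (ennreal (H x)) u) \<le> ennreal C * epowr (bmo_norm b) u * emeasure lebesgue Q / emeasure lebesgue Q"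
        unfolding emean_def by (rule divide_right_mono_ennreal)
      also have "\<dots> = ennreal C * epowr (bmo_norm b) u"
        using emeasure_cube_bounds[OF s(1), of a] s(2) by (intro mult_divide_eq_ennreal) auto
      finally show ?thesis by (simp add: H_def)
    qed
  qed
qed

subsection \<open>The reverse Hoelder inequality\<close>

lemma emean_pos:
  fixes w :: "real^'n \<Rightarrow> real"
  assumes [measurable]: "w \<in> borel_measurable lebesgue" and "AE x in lebesgue. 0 < w x" "Q \<in> cubes"
  shows "0 < emean Q (\<lambda>x. ennreal (w x))"
proof (rule ccontr)
  have [measurable]: "Q \<in> sets lebesgue" by (rule sets_cubes[OF assms(3)])
  assume "\<not> 0 < emean Q (\<lambda>x. ennreal (w x))"
  then have "(\<integral>\<^sup>+x\<in>Q. ennreal (w x) \<partial>lebesgue) = 0"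
    using emean_mult_emeasure[OF assms(3), of "\<lambda>x. ennreal (w x)"] by simp
  then have "AE x in lebesgue. ennreal (w x) * indicator Q x = 0"
    by (subst (asm) nn_integral_0_iff_AE) auto
  then have "AE x in lebesgue. x \<notin> Q"
    using assms(2) by eventually_elim (auto simp: indicator_def ennreal_eq_0_iff split: if_splits)
  then have "emeasure lebesgue Q = 0"
    by (subst (asm) AE_iff_measurable[OF _ refl]) (auto simp del: emeasure_completion)
  moreover obtain a s where "0 < s" "Q = cube a s" using assms(3) by (auto simp: cubes_eq)
  ultimately show False using emeasure_cube_bounds(1)[of s a] by simp
qed

lemma emean_less_top:
  fixes w :: "real^'n \<Rightarrow> real"
  assumes "locally_integrable w" "\<And>x. 0 \<le> w x" "Q \<in> cubes"
  shows "emean Q (\<lambda>x. ennreal (w x)) < top"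
proof -
  obtain a s where "0 < s" "Q = cube a s" using assms(3) by (auto simp: cubes_eq)
  then have "emeasure lebesgue Q \<noteq> 0" using emeasure_cube_bounds(1)[of s a] by simp
  moreover have "(\<integral>\<^sup>+x\<in>Q. ennreal (w x) \<partial>lebesgue) \<noteq> top"
    using locally_integrable_nn_integral[OF assms(1,3)] assms(2) by simp
  ultimately have "emean Q (\<lambda>x. ennreal (w x)) \<noteq> top"
    by (auto simp: emean_def ennreal_divide_eq_top_iff simp del: emeasure_completion)
  then show ?thesis by (simp add: less_top)
qed

text \<open>The complement F of E carries at least half the measure of Q. Hoelder for 1 = w^(1/P) *
  w^(-1/P) on F, raised to the power P and multiplied by the mean of w, turns the A_P bound into
  w(Q) <= 2^P K w(F). So F holds a fixed fraction of the mass, and E at most the rest.\<close>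

lemma Muckenhoupt_A_decay:
  fixes w :: "real^'n \<Rightarrow> real"
  assumes P: "1 < P" and w: "w \<in> Muckenhoupt_A P"
  obtains \<theta> :: real where "0 < \<theta>" "\<theta> < 1"
    "\<And>Q E. Q \<in> cubes \<Longrightarrow> E \<in> sets lebesgue \<Longrightarrow> E \<subseteq> Q \<Longrightarrow> emeasure lebesgue E \<le> ennreal (1/2) * emeasure lebesgue Q \<Longrightarrow>
      (\<integral>\<^sup>+x\<in>E. ennreal (w x) \<partial>lebesgue) \<le> ennreal \<theta> * (\<integral>\<^sup>+x\<in>Q. ennreal (w x) \<partial>lebesgue)"
proof -
  note [simp del] = emeasure_completion measure_completion ennreal_half
  have lw: "locally_integrable w" and w0: "\<And>x. 0 \<le> w x" and wpos: "AE x in lebesgue. 0 < w x"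
    using w by (auto simp: Muckenhoupt_A_def)
  have [measurable]: "w \<in> borel_measurable lebesgue" by (rule locally_integrable_measurable[OF lw])
  define v where "v x = epowr (ennreal (w x)) (- 1 / (P - 1))" for x
  have [measurable]: "v \<in> borel_measurable lebesgue" unfolding v_def by measurable
  define K where "K = (SUP Q\<in>cubes. emean Q (\<lambda>x. ennreal (w x)) * epowr (emean Q v) (P - 1))"
  have Kfin: "K < top" using w by (auto simp: Muckenhoupt_A_def K_def v_def[abs_def])
  \<comment> \<open>The maximum with 2 keeps 1 - 1 / D strictly between 0 and 1.\<close>
  define D where "D = max 2 (2 powr P * enn2real K)"
  have D: "2 \<le> D" "ennreal (2 powr P) * K \<le> ennreal D"
    using Kfin by (auto simp: D_def ennreal_mult''[symmetric] intro: ennreal_leI)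
      (metis D_def ennreal_enn2real ennreal_leI ennreal_mult' max.cobounded2 powr_ge_zero)
  have key: "(\<integral>\<^sup>+x\<in>E. ennreal (w x) \<partial>lebesgue) \<le> ennreal (1 - 1 / D) * (\<integral>\<^sup>+x\<in>Q. ennreal (w x) \<partial>lebesgue)"
    if Q: "Q \<in> cubes" and E: "E \<in> sets lebesgue" "E \<subseteq> Q" and half: "emeasure lebesgue E \<le> ennreal (1/2) * emeasure lebesgue Q" for Q E
  proof -
    define F where "F = Q - E"
    note [measurable] = E(1) sets_cubes[OF Q]
    have [measurable]: "F \<in> sets lebesgue" unfolding F_def by measurable
    have Qb: "0 < emeasure lebesgue Q" "emeasure lebesgue Q < top"
      using Q emeasure_cube_bounds by (auto simp: cubes_eq)
    define e f where "e = emean Q (\<lambda>x. ennreal (w x) * indicator E x)" and "f = emean Q (\<lambda>x. ennreal (w x) * indicator F x)"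
    have ef: "emean Q (\<lambda>x. ennreal (w x)) = e + f"
    proof -
      have "(\<integral>\<^sup>+x\<in>Q. ennreal (w x) \<partial>lebesgue) = (\<integral>\<^sup>+x. ennreal (w x) * indicator E x * indicator Q x + ennreal (w x) * indicator F x * indicator Q x \<partial>lebesgue)"
        using E(2) by (intro nn_integral_cong) (auto simp: F_def indicator_def)
      also have "\<dots> = (\<integral>\<^sup>+x. ennreal (w x) * indicator E x * indicator Q x \<partial>lebesgue) + (\<integral>\<^sup>+x. ennreal (w x) * indicator F x * indicator Q x \<partial>lebesgue)"
        by (intro nn_integral_add) measurable
      finally show ?thesis by (simp add: emean_def e_def f_def add_divide_distrib_ennreal)
    qed
    have "emean Q (indicator E) + emean Q (indicator F) = 1"
    proof -
      have "(\<integral>\<^sup>+x. indicator E x * indicator Q x \<partial>lebesgue) + (\<integral>\<^sup>+x. indicator F x * indicator Q x \<partial>lebesgue) = (\<integral>\<^sup>+x. indicator E x * indicator Q x + indicator F x * indicator Q x \<partial>lebesgue)"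
        by (intro nn_integral_add[symmetric]) measurable
      also have "\<dots> = (\<integral>\<^sup>+x. indicator Q x \<partial>lebesgue)"
        using E(2) by (intro nn_integral_cong) (auto simp: F_def indicator_def)
      finally show ?thesis using Qb by (simp add: emean_def add_divide_distrib_ennreal[symmetric])
    qed
    moreover have "emean Q (indicator E) \<le> ennreal (1/2)"
    proof -
      have "(\<integral>\<^sup>+x. indicator E x * indicator Q x \<partial>lebesgue) = (\<integral>\<^sup>+x. indicator E x \<partial>lebesgue)"
        using E(2) by (intro nn_integral_cong) (auto simp: indicator_def)
      then have "emean Q (indicator E) = emeasure lebesgue E / emeasure lebesgue Q" by (simp add: emean_def)
      also have "\<dots> \<le> ennreal (1/2) * emeasure lebesgue Q / emeasure lebesgue Q" by (intro divide_right_mono_ennreal half)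
      also have "\<dots> = ennreal (1/2)" using Qb by (intro mult_divide_eq_ennreal) auto
      finally show ?thesis .
    qed
    ultimately have halfF: "ennreal (1/2) \<le> emean Q (indicator F)"
      by (cases "emean Q (indicator E)"; cases "emean Q (indicator F)") (auto simp flip: ennreal_plus)
    also have "emean Q (indicator F) \<le> emean Q (\<lambda>x. epowr (ennreal (w x) * indicator F x) (1 / P) * epowr (v x) ((P - 1) / P))"
    proof (rule emean_mono_AE, use wpos in eventually_elim)
      fix x assume wx: "0 < w x"
      have "w x powr (1 / P) * (w x powr (- 1 / (P - 1))) powr ((P - 1) / P) = 1"
        using P wx by (simp add: powr_powr powr_add[symmetric])
      then have "epowr (ennreal (w x)) (1 / P) * epowr (v x) ((P - 1) / P) = 1"
        using P wx unfolding v_def by (simp add: epowr_ennreal_pos ennreal_mult'[symmetric])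
      then show "x \<in> Q \<longrightarrow> indicator F x \<le> epowr (ennreal (w x) * indicator F x) (1 / P) * epowr (v x) ((P - 1) / P)"
        by (auto simp: indicator_def)
    qed
    also have "\<dots> \<le> epowr f (1 / P) * epowr (emean Q v) ((P - 1) / P)"
      unfolding f_def emean_uniform_measure[OF sets_cubes[OF Q]]
    proof (subst emean_uniform_measure[OF sets_cubes[OF Q]], measurable, subst emean_uniform_measure[OF sets_cubes[OF Q]], measurable, subst emean_uniform_measure[OF sets_cubes[OF Q]], measurable)
      show "(\<integral>\<^sup>+x. epowr (ennreal (w x) * indicator F x) (1 / P) * epowr (v x) ((P - 1) / P) \<partial>uniform_measure lebesgue Q)
        \<le> epowr (\<integral>\<^sup>+x. ennreal (w x) * indicator F x \<partial>uniform_measure lebesgue Q) (1 / P) * epowr (\<integral>\<^sup>+x. v x \<partial>uniform_measure lebesgue Q) ((P - 1) / P)"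
        using P by (intro nn_integral_holder2) (auto simp: field_simps)
    qed
    finally have "epowr (ennreal (1/2)) P \<le> epowr (epowr f (1 / P) * epowr (emean Q v) ((P - 1) / P)) P"
      using P by (intro epowr_mono) auto
    also have "\<dots> = f * epowr (emean Q v) (P - 1)"
      using P by (simp add: epowr_mult epowr_epowr)
    finally have "epowr (ennreal (1/2)) P * (e + f) \<le> f * epowr (emean Q v) (P - 1) * (e + f)"
      by (intro mult_right_mono) auto
    also have "\<dots> = f * (emean Q (\<lambda>x. ennreal (w x)) * epowr (emean Q v) (P - 1))" by (simp add: ef ac_simps)
    also have "\<dots> \<le> f * K" unfolding K_def by (intro mult_left_mono SUP_upper Q) auto
    finally have "ennreal (2 powr P) * (epowr (ennreal (1/2)) P * (e + f)) \<le> ennreal (2 powr P) * (f * K)"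
      by (intro mult_left_mono) auto
    also have "ennreal (2 powr P) * (epowr (ennreal (1/2)) P * (e + f)) = e + f"
      by (simp add: epowr_ennreal_pos mult.assoc[symmetric] ennreal_mult'[symmetric] powr_mult[symmetric])
    also have "ennreal (2 powr P) * (f * K) \<le> f * ennreal D" using D(2) by (metis mult.left_commute mult_left_mono zero_le)
    finally have efD: "e + f \<le> f * ennreal D" .
    have "e + f < top"
      unfolding ef[symmetric] by (rule emean_less_top[OF lw w0 Q])
    then obtain e' f' where r: "e = ennreal e'" "0 \<le> e'" "f = ennreal f'" "0 \<le> f'" by (cases e; cases f) auto
    have "e' + f' \<le> f' * D" using efD r D(1) by (simp add: ennreal_mult''[symmetric] flip: ennreal_plus)
    then have "e' \<le> (1 - 1 / D) * (e' + f')" using D(1) by (simp add: field_simps)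
    then have le: "e \<le> ennreal (1 - 1 / D) * (e + f)" using r D(1) by (simp add: ennreal_mult''[symmetric] ennreal_leI flip: ennreal_plus)
    have "(\<integral>\<^sup>+x\<in>E. ennreal (w x) \<partial>lebesgue) = (\<integral>\<^sup>+x\<in>Q. (ennreal (w x) * indicator E x) \<partial>lebesgue)"
      using E(2) by (intro nn_integral_cong) (auto simp: indicator_def)
    also have "\<dots> = e * emeasure lebesgue Q" unfolding e_def by (rule emean_mult_emeasure[OF Q, symmetric])
    also have "\<dots> \<le> ennreal (1 - 1 / D) * (e + f) * emeasure lebesgue Q" by (intro mult_right_mono le) auto
    also have "\<dots> = ennreal (1 - 1 / D) * (\<integral>\<^sup>+x\<in>Q. ennreal (w x) \<partial>lebesgue)"
      unfolding ef[symmetric] by (simp only: mult.assoc emean_mult_emeasure[OF Q])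
    finally show ?thesis .
  qed
  show thesis by (rule that[of "1 - 1 / D"]) (use D(1) key in \<open>auto simp: field_simps\<close>)
qed

text \<open>The multiplicative counterpart of the John-Nirenberg iteration, with mass measured by w.
  Selection at twice the mean leaves cubes of at most half the measure, hence by
  \<open>\<theta>\<close> a fixed fraction of the mass. Their means are at most 2^n * 2 times the
  old one, so one step costs a factor 2^(n+1) in height.\<close>

lemma reverse_holder_decay:
  fixes w :: "real^'n \<Rightarrow> real" and \<theta> :: real
  assumes lw: "locally_integrable w" and w0: "\<And>x. 0 \<le> w x" and wpos: "AE x in lebesgue. 0 < w x" and s: "0 < s"
    and \<theta>: "\<And>Q E. Q \<in> cubes \<Longrightarrow> E \<in> sets lebesgue \<Longrightarrow> E \<subseteq> Q \<Longrightarrow> emeasure lebesgue E \<le> ennreal (1/2) * emeasure lebesgue Q \<Longrightarrow>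
      (\<integral>\<^sup>+x\<in>E. ennreal (w x) \<partial>lebesgue) \<le> ennreal \<theta> * (\<integral>\<^sup>+x\<in>Q. ennreal (w x) \<partial>lebesgue)"
  shows "(\<integral>\<^sup>+x\<in>{x \<in> cube a s. ennreal ((2 ^ (CARD('n) + 1)) ^ k) * emean (cube a s) (\<lambda>x. ennreal (w x)) < ennreal (w x)}. ennreal (w x) \<partial>lebesgue)
    \<le> ennreal \<theta> ^ k * (\<integral>\<^sup>+x\<in>cube a s. ennreal (w x) \<partial>lebesgue)"
proof -
  note [simp del] = emeasure_completion measure_completion ennreal_half
  have [measurable]: "w \<in> borel_measurable lebesgue" by (rule locally_integrable_measurable[OF lw])
  define g where "g x = ennreal (w x)" for x
  have gm [measurable]: "g \<in> borel_measurable lebesgue" unfolding g_def by measurable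
  define T where "T a s k = {x \<in> cube a s. ennreal ((2 ^ (CARD('n) + 1)) ^ k) * emean (cube a s) g < g x}" for a :: "real^'n" and s k
  have Ts: "T a s k \<in> sets lebesgue" for a s k unfolding T_def by measurable
  have pos: "0 < emean Q g" if "Q \<in> cubes" for Q
    using emean_pos[OF _ wpos that] by (simp add: g_def[abs_def])
  have fin: "emean Q g < top" if "Q \<in> cubes" for Q
    using emean_less_top[OF lw w0 that] by (simp add: g_def[abs_def])
  have "(\<integral>\<^sup>+x\<in>T a s k. g x \<partial>lebesgue) \<le> ennreal \<theta> ^ k * (\<integral>\<^sup>+x\<in>cube a s. g x \<partial>lebesgue)"
  proof (rule cube_level_set_decay[OF gm Ts _ _ s])
    show "T a s k \<subseteq> cube a s" for a s k by (auto simp: T_def)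
    fix a :: "real^'n" and s :: real assume s: "0 < s"
    note Q = cube_in_cubes[OF s, of a]
    define L where "L = 2 * emean (cube a s) g"
    have L: "L < top" "0 < L" using fin[OF Q] pos[OF Q] by (auto simp: L_def ennreal_mult_less_top ennreal_zero_less_mult_iff)
    have avg: "(\<integral>\<^sup>+x\<in>cube a s. g x \<partial>lebesgue) \<le> L * emeasure lebesgue (cube a s)"
      unfolding L_def mult.assoc emean_mult_emeasure[OF Q] using mult_right_mono[of 1 2 "\<integral>\<^sup>+x\<in>cube a s. g x \<partial>lebesgue"] by simp
    obtain I where I: "countable I"
      "\<And>c l. (c, l) \<in> I \<Longrightarrow> 0 < l \<and> cube c l \<subseteq> cube a s"
      "\<And>c l. (c, l) \<in> I \<Longrightarrow> L * emeasure lebesgue (cube c l) \<le> (\<integral>\<^sup>+x\<in>cube c l. g x \<partial>lebesgue)"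
      "\<And>c l. (c, l) \<in> I \<Longrightarrow> (\<integral>\<^sup>+x\<in>cube c l. g x \<partial>lebesgue) \<le> 2 ^ CARD('n) * L * emeasure lebesgue (cube c l)"
      "\<And>g. g \<in> borel_measurable lebesgue \<Longrightarrow>
         (\<integral>\<^sup>+i. (\<integral>\<^sup>+x\<in>cube (fst i) (snd i). g x \<partial>lebesgue) \<partial>count_space I) \<le> (\<integral>\<^sup>+x\<in>cube a s. g x \<partial>lebesgue)"
      "AE x in lebesgue. x \<in> cube a s \<longrightarrow> x \<notin> (\<Union>i\<in>I. cube (fst i) (snd i)) \<longrightarrow> g x \<le> L"
      by (rule calderon_zygmund[OF s gm L(1) avg], rule that) (assumption | blast)+
    \<comment> \<open>The selected cubes overlap only in null sets. Testing the clause for arbitrary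
      functions with \<open>g\<close> times the indicator of \<open>U\<close> bounds the sum of
      their masses by the mass of \<open>U\<close>, to which \<open>\<theta>\<close>
      applies.\<close>
    define U where "U = (\<Union>i\<in>I. cube (fst i) (snd i))"
    have Us [measurable]: "U \<in> sets lebesgue" unfolding U_def using I(1) by (intro sets.countable_UN') auto
    have US: "U \<subseteq> cube a s" unfolding U_def using I(2) by force
    have "L * emeasure lebesgue U \<le> L * (\<integral>\<^sup>+i. emeasure lebesgue (cube (fst i) (snd i)) \<partial>count_space I)"
      using nn_integral_UN_le[OF I(1), of "\<lambda>i. cube (fst i) (snd i)" lebesgue "\<lambda>_. 1"] Us
      by (intro mult_left_mono) (auto simp: U_def)
    also have "\<dots> = (\<integral>\<^sup>+i. L * emeasure lebesgue (cube (fst i) (snd i)) \<partial>count_space I)"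
      by (intro nn_integral_cmult[symmetric]) auto
    also have "\<dots> \<le> (\<integral>\<^sup>+i. (\<integral>\<^sup>+x\<in>cube (fst i) (snd i). g x \<partial>lebesgue) \<partial>count_space I)"
      using I(3) by (intro nn_integral_mono) auto
    also have "\<dots> \<le> (\<integral>\<^sup>+x\<in>cube a s. g x \<partial>lebesgue)" by (rule I(5)) measurable
    also have "\<dots> = emean (cube a s) g * emeasure lebesgue (cube a s)" by (rule emean_mult_emeasure[OF Q, symmetric])
    also have "\<dots> = L * (ennreal (1 / 2) * emeasure lebesgue (cube a s))"
    proof -
      have "2 * ennreal (1/2) = 1" using numeral_mult_ennreal[of "1/2" "num.Bit0 num.One"] by simp
      have "L * (ennreal (1 / 2) * m) = (2 * ennreal (1/2)) * (emean (cube a s) g * m)" for m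
        unfolding L_def by (simp only: ac_simps)
      then show ?thesis using \<open>2 * ennreal (1/2) = 1\<close> by simp
    qed
    finally have half: "emeasure lebesgue U \<le> ennreal (1 / 2) * emeasure lebesgue (cube a s)"
      using L by (subst (asm) ennreal_mult_le_mult_iff) auto
    have "(\<integral>\<^sup>+i. (\<integral>\<^sup>+x\<in>cube (fst i) (snd i). g x \<partial>lebesgue) \<partial>count_space I)
        = (\<integral>\<^sup>+i. (\<integral>\<^sup>+x\<in>cube (fst i) (snd i). (g x * indicator U x) \<partial>lebesgue) \<partial>count_space I)"
      by (intro nn_integral_cong) (auto simp: U_def indicator_def)
    also have "\<dots> \<le> (\<integral>\<^sup>+x\<in>cube a s. (g x * indicator U x) \<partial>lebesgue)" by (rule I(5)) measurable
    also have "\<dots> = (\<integral>\<^sup>+x\<in>U. g x \<partial>lebesgue)" using US by (intro nn_integral_cong) (auto simp: indicator_def)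
    also have "\<dots> \<le> ennreal \<theta> * (\<integral>\<^sup>+x\<in>cube a s. g x \<partial>lebesgue)"
      unfolding g_def by (rule \<theta>[OF Q Us US half])
    finally have I7: "(\<integral>\<^sup>+i. (\<integral>\<^sup>+x\<in>cube (fst i) (snd i). g x \<partial>lebesgue) \<partial>count_space I) \<le> ennreal \<theta> * (\<integral>\<^sup>+x\<in>cube a s. g x \<partial>lebesgue)" .
    have near: "emean (cube c l) g \<le> 2 ^ (CARD('n) + 1) * emean (cube a s) g" if i: "(c, l) \<in> I" for c l
    proof -
      have l: "0 < l" using I(2)[OF i] by simp
      have "emean (cube c l) g * emeasure lebesgue (cube c l) = (\<integral>\<^sup>+x\<in>cube c l. g x \<partial>lebesgue)"
        using l by (intro emean_mult_emeasure cube_in_cubes)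
      also have "\<dots> \<le> 2 ^ (CARD('n) + 1) * emean (cube a s) g * emeasure lebesgue (cube c l)"
        using I(4)[OF i] by (simp add: L_def ac_simps)
      finally have "emeasure lebesgue (cube c l) * emean (cube c l) g
        \<le> emeasure lebesgue (cube c l) * (2 ^ (CARD('n) + 1) * emean (cube a s) g)" by (simp only: mult.commute)
      then show ?thesis
        using emeasure_cube_bounds[OF l, of c] by (subst (asm) ennreal_mult_le_mult_iff) auto
    qed
    have "AE x in lebesgue. \<forall>k. x \<in> T a s (Suc k) \<longrightarrow> x \<in> (\<Union>i\<in>I. T (fst i) (snd i) k)"
      using I(6)
    proof eventually_elim
      case (elim x)
      show ?case
      proof (intro allI impI)
        fix k assume x: "x \<in> T a s (Suc k)"
        define D :: ennreal where "D = 2 ^ (CARD('n) + 1)"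
        have D: "ennreal ((2 ^ (CARD('n) + 1)) ^ j) = D ^ j" for j
          unfolding D_def by (metis ennreal_numeral ennreal_power zero_le_numeral zero_le_power)
        have xQ: "x \<in> cube a s" and xk: "D ^ Suc k * emean (cube a s) g < g x" using x unfolding T_def D by auto
        have D1: "2 \<le> D" unfolding D_def by (simp add: power_Suc) (metis mult_left_mono mult.right_neutral one_le_numeral one_le_power zero_le)
        have "1 \<le> D" using D1 order_trans[of 1 2 D] by simp
        then have "D * 1 \<le> D * D ^ k" by (intro mult_left_mono one_le_power) auto
        then have "L \<le> D ^ Suc k * emean (cube a s) g" unfolding L_def using D1 by (intro mult_right_mono) auto
        then have "\<not> g x \<le> L" using xk by simp
        then obtain c l where i: "(c, l) \<in> I" "x \<in> cube c l" using elim xQ by force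
        have "D ^ k * emean (cube c l) g \<le> D ^ k * (D * emean (cube a s) g)"
          using near[OF i(1)] unfolding D_def by (intro mult_left_mono) auto
        also have "\<dots> < g x" using xk by (simp add: ac_simps)
        finally have "x \<in> T c l k" unfolding T_def D using i by simp
        then show "x \<in> (\<Union>i\<in>I. T (fst i) (snd i) k)" using i by (intro UN_I[of "(c, l)"]) auto
      qed
    qed
    then show "\<exists>I. countable I \<and> (\<forall>(c, l)\<in>I. 0 < l) \<and>
        (\<integral>\<^sup>+i. (\<integral>\<^sup>+x\<in>cube (fst i) (snd i). g x \<partial>lebesgue) \<partial>count_space I) \<le> ennreal \<theta> * (\<integral>\<^sup>+x\<in>cube a s. g x \<partial>lebesgue) \<and>
        (AE x in lebesgue. \<forall>k. x \<in> T a s (Suc k) \<longrightarrow> x \<in> (\<Union>i\<in>I. T (fst i) (snd i) k))"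
      using I(1,2) I7 by (intro exI[of _ I]) auto
  qed
  then show ?thesis by (simp add: T_def g_def[abs_def])
qed

text \<open>The level k with D^k < w / t <= D^(k+1) dominates by itself; the summand 1 covers w <=
  t.\<close>

lemma powr_le_sum_geometric_levels:
  fixes D :: real
  assumes "0 \<le> w" "0 < t" "0 < \<delta>" "1 < D"
  shows "ennreal ((w / t) powr \<delta>) \<le> 1 + (\<Sum>k. ennreal ((D ^ Suc k) powr \<delta>) * indicator {x. D ^ k * t < x} w)"
proof (cases "w \<le> t")
  case True
  then have "(w / t) powr \<delta> \<le> 1 powr \<delta>" using assms by (intro powr_mono2) auto
  then have "ennreal ((w / t) powr \<delta>) \<le> 1" by simp
  then show ?thesis by (rule order_trans) simp
next
  case False
  define m where "m = (LEAST m. w / t \<le> D ^ m)"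
  obtain m0 where "w / t < D ^ m0" using real_arch_pow[OF assms(4), of "w / t"] by auto
  then have m: "w / t \<le> D ^ m" unfolding m_def by (rule LeastI[of "\<lambda>m. w / t \<le> D ^ m" m0, OF less_imp_le])
  have "m \<noteq> 0" using m False assms(2) by (auto simp: field_simps intro!: Nat.gr0I)
  then obtain k where k: "m = Suc k" by (cases m) auto
  then have "\<not> w / t \<le> D ^ k" unfolding m_def using not_less_Least[of k "\<lambda>m. w / t \<le> D ^ m"] by simp
  then have "D ^ k * t < w" using assms(2) by (simp add: field_simps)
  then have "ennreal ((w / t) powr \<delta>) \<le> ennreal ((D ^ Suc k) powr \<delta>) * indicator {x. D ^ k * t < x} w"
    using assms m unfolding k by (auto intro!: ennreal_leI powr_mono2)
  moreover have "f k \<le> suminf f" for f :: "nat \<Rightarrow> ennreal"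
    using sum_le_suminf[of f "{k}"] by simp
  ultimately have "ennreal ((w / t) powr \<delta>) \<le> (\<Sum>k. ennreal ((D ^ Suc k) powr \<delta>) * indicator {x. D ^ k * t < x} w)"
    by (rule order_trans)
  then show ?thesis by (rule order_trans) simp
qed

lemma reverse_holder:
  fixes w :: "real^'n \<Rightarrow> real"
  assumes "w \<in> A_infinity"
  obtains \<delta> C :: real where "0 < \<delta>" "0 < C"
    "\<And>Q. Q \<in> cubes \<Longrightarrow> emean Q (\<lambda>x. epowr (ennreal (w x)) (1 + \<delta>)) \<le> ennreal C * epowr (emean Q (\<lambda>x. ennreal (w x))) (1 + \<delta>)"
proof -
  note [simp del] = emeasure_completion measure_completion ennreal_half
  obtain P where P: "1 < P" "w \<in> Muckenhoupt_A P" using assms by (auto simp: A_infinity_def)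
  have lw: "locally_integrable w" and w0: "\<And>x. 0 \<le> w x" and wpos: "AE x in lebesgue. 0 < w x"
    using P by (auto simp: Muckenhoupt_A_def)
  have [measurable]: "w \<in> borel_measurable lebesgue" by (rule locally_integrable_measurable[OF lw])
  obtain \<theta> :: real where \<theta>: "0 < \<theta>" "\<theta> < 1"
    "\<And>Q E. Q \<in> cubes \<Longrightarrow> E \<in> sets lebesgue \<Longrightarrow> E \<subseteq> Q \<Longrightarrow> emeasure lebesgue E \<le> ennreal (1/2) * emeasure lebesgue Q \<Longrightarrow>
      (\<integral>\<^sup>+x\<in>E. ennreal (w x) \<partial>lebesgue) \<le> ennreal \<theta> * (\<integral>\<^sup>+x\<in>Q. ennreal (w x) \<partial>lebesgue)"
    by (rule Muckenhoupt_A_decay[OF P], rule that) (assumption | blast)+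
  define D :: real where "D = 2 ^ (CARD('n) + 1)"
  have D1: "1 < D" unfolding D_def by (intro one_less_power) auto
  \<comment> \<open>This makes D^\<delta> = \<theta>^(-1/2), so the terms of the series over the
    levels have ratio D^\<delta> \<theta> = \<theta>^(1/2) < 1.\<close>
  define \<delta> where "\<delta> = - ln \<theta> / (2 * ln D)"
  have \<delta>: "0 < \<delta>" using \<theta> D1 by (simp add: \<delta>_def divide_neg_pos)
  have D\<delta>: "D powr \<delta> * \<theta> = exp (ln \<theta> / 2)"
  proof -
    have "D powr \<delta> = exp (- ln \<theta> / 2)" using D1 by (simp add: powr_def \<delta>_def)
    moreover have "\<theta> = exp (ln \<theta>)" using \<theta> by simp
    ultimately have "D powr \<delta> * \<theta> = exp (- ln \<theta> / 2) * exp (ln \<theta>)" by simp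
    also have "\<dots> = exp (ln \<theta> / 2)" by (simp add: exp_add[symmetric])
    finally show ?thesis .
  qed
  then have lt1: "D powr \<delta> * \<theta> < 1" using \<theta> by (simp add: exp_less_one_iff)
  have gt0: "0 < D powr \<delta> * \<theta>" by (simp add: D\<delta>)
  have term_eq: "(D ^ Suc k) powr \<delta> * \<theta> ^ k = D powr \<delta> * (D powr \<delta> * \<theta>) ^ k" for k
    using D1 by (simp add: powr_mult powr_power power_mult_distrib powr_realpow[symmetric] powr_powr mult.commute)
  have summ: "summable (\<lambda>k. (D ^ Suc k) powr \<delta> * \<theta> ^ k)"
    unfolding term_eq using lt1 gt0 by (intro summable_mult summable_geometric) auto
  define C where "C = 1 + (\<Sum>k. (D ^ Suc k) powr \<delta> * \<theta> ^ k)"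
  have "0 \<le> (\<Sum>k. (D ^ Suc k) powr \<delta> * \<theta> ^ k)" using \<theta> by (intro suminf_nonneg summ) auto
  then have C: "0 < C" by (simp add: C_def)
  show thesis
  proof (rule that[OF \<delta> C])
    fix Q :: "(real^'n) set" assume Q: "Q \<in> cubes"
    have [measurable]: "Q \<in> sets lebesgue" by (rule sets_cubes[OF Q])
    obtain a s where s: "0 < s" "Q = cube a s" using Q by (auto simp: cubes_eq)
    define W where "W = enn2real (emean Q (\<lambda>x. ennreal (w x)))"
    have W: "emean Q (\<lambda>x. ennreal (w x)) = ennreal W" "0 < W"
      using emean_less_top[OF lw w0 Q] emean_pos[OF _ wpos Q] by (auto simp: W_def enn2real_positive_iff)
    define E where "E k = {x \<in> Q. D ^ k * W < w x}" for k
    have Es [measurable]: "E k \<in> sets lebesgue" for k unfolding E_def by measurable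
    have E: "(\<integral>\<^sup>+x\<in>E k. ennreal (w x) \<partial>lebesgue) \<le> ennreal (\<theta> ^ k) * (\<integral>\<^sup>+x\<in>Q. ennreal (w x) \<partial>lebesgue)" for k
    proof -
      have lt: "ennreal (D ^ k) * ennreal W < ennreal y \<longleftrightarrow> D ^ k * W < y" for y
        using W(2) D1 by (subst ennreal_mult[symmetric]) (simp_all add: ennreal_less_iff)
      have "E k = {x \<in> cube a s. ennreal ((2 ^ (CARD('n) + 1)) ^ k) * emean (cube a s) (\<lambda>x. ennreal (w x)) < ennreal (w x)}"
        unfolding E_def s(2)[symmetric] W(1) D_def[symmetric] lt ..
      then show ?thesis
        unfolding ennreal_power[OF less_imp_le[OF \<theta>(1)], symmetric] s(2)
        by (simp only: reverse_holder_decay[OF lw w0 wpos s(1) \<theta>(3)])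
    qed
    have "(\<integral>\<^sup>+x\<in>Q. epowr (ennreal (w x)) (1 + \<delta>) \<partial>lebesgue)
      \<le> (\<integral>\<^sup>+x. ennreal (W powr \<delta>) * (ennreal (w x) * indicator Q x + (\<Sum>k. ennreal ((D ^ Suc k) powr \<delta>) * (ennreal (w x) * indicator (E k) x))) \<partial>lebesgue)"
    proof (intro nn_integral_mono)
      fix x
      show "epowr (ennreal (w x)) (1 + \<delta>) * indicator Q x \<le> ennreal (W powr \<delta>) * (ennreal (w x) * indicator Q x + (\<Sum>k. ennreal ((D ^ Suc k) powr \<delta>) * (ennreal (w x) * indicator (E k) x)))"
      proof (cases "x \<in> Q")
        case True
        have ind: "indicator (E k) x = (indicator {y. D ^ k * W < y} (w x) :: ennreal)" for k
          using True by (simp add: E_def indicator_def)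
        \<comment> \<open>Only the power \<delta> is expanded into levels. The remaining factor
          \<open>w x\<close> stays as the density whose mass on the level sets is known to
          decay.\<close>
        have "w x powr (1 + \<delta>) = W powr \<delta> * w x * (w x / W) powr \<delta>"
          using w0[of x] W(2) by (cases "w x = 0") (auto simp: powr_add powr_divide)
        then have "epowr (ennreal (w x)) (1 + \<delta>) = ennreal (W powr \<delta>) * ennreal (w x) * ennreal ((w x / W) powr \<delta>)"
          using w0[of x] \<delta> by (simp add: epowr_ennreal ennreal_mult')
        also have "\<dots> \<le> ennreal (W powr \<delta>) * ennreal (w x) * (1 + (\<Sum>k. ennreal ((D ^ Suc k) powr \<delta>) * indicator {y. D ^ k * W < y} (w x)))"
          by (intro mult_left_mono powr_le_sum_geometric_levels w0 W \<delta> D1) auto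
        also have "\<dots> = ennreal (W powr \<delta>) * (ennreal (w x) + (\<Sum>k. ennreal (w x) * (ennreal ((D ^ Suc k) powr \<delta>) * indicator (E k) x)))"
          by (simp only: ind mult.assoc distrib_left mult_1_right ennreal_suminf_cmult)
        finally show ?thesis using True by (simp add: ac_simps)
      qed simp
    qed
    also have "\<dots> = ennreal (W powr \<delta>) * ((\<integral>\<^sup>+x\<in>Q. ennreal (w x) \<partial>lebesgue) + (\<Sum>k. ennreal ((D ^ Suc k) powr \<delta>) * (\<integral>\<^sup>+x\<in>E k. ennreal (w x) \<partial>lebesgue)))"
      by (simp add: nn_integral_cmult nn_integral_add nn_integral_suminf)
    also have "\<dots> \<le> ennreal (W powr \<delta>) * ((\<integral>\<^sup>+x\<in>Q. ennreal (w x) \<partial>lebesgue) + (\<Sum>k. ennreal ((D ^ Suc k) powr \<delta>) * (ennreal (\<theta> ^ k) * (\<integral>\<^sup>+x\<in>Q. ennreal (w x) \<partial>lebesgue))))"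
      by (intro mult_left_mono add_left_mono suminf_le E) auto
    also have "(\<Sum>k. ennreal ((D ^ Suc k) powr \<delta>) * (ennreal (\<theta> ^ k) * (\<integral>\<^sup>+x\<in>Q. ennreal (w x) \<partial>lebesgue)))
        = (\<Sum>k. ennreal ((D ^ Suc k) powr \<delta> * \<theta> ^ k)) * (\<integral>\<^sup>+x\<in>Q. ennreal (w x) \<partial>lebesgue)"
      using \<theta>(1) by (simp only: ennreal_suminf_multc[symmetric] mult.assoc[symmetric] ennreal_mult'[symmetric] powr_ge_zero)
    also have "(\<Sum>k. ennreal ((D ^ Suc k) powr \<delta> * \<theta> ^ k)) = ennreal (\<Sum>k. (D ^ Suc k) powr \<delta> * \<theta> ^ k)"
      using \<theta>(1) by (intro suminf_ennreal2 summ) auto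
    also have "(\<integral>\<^sup>+x\<in>Q. ennreal (w x) \<partial>lebesgue) + ennreal (\<Sum>k. (D ^ Suc k) powr \<delta> * \<theta> ^ k) * (\<integral>\<^sup>+x\<in>Q. ennreal (w x) \<partial>lebesgue)
       = ennreal C * (\<integral>\<^sup>+x\<in>Q. ennreal (w x) \<partial>lebesgue)"
      unfolding C_def using \<open>0 \<le> (\<Sum>k. (D ^ Suc k) powr \<delta> * \<theta> ^ k)\<close> by (simp add: distrib_right)
    finally have "emean Q (\<lambda>x. epowr (ennreal (w x)) (1 + \<delta>)) \<le> ennreal (W powr \<delta>) * (ennreal C * (\<integral>\<^sup>+x\<in>Q. ennreal (w x) \<partial>lebesgue)) / emeasure lebesgue Q"
      unfolding emean_def by (rule divide_right_mono_ennreal)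
    also have "\<dots> = ennreal (W powr \<delta>) * (ennreal C * emean Q (\<lambda>x. ennreal (w x)))"
      unfolding emean_def by (simp add: ennreal_times_divide)
    also have "\<dots> = ennreal C * epowr (emean Q (\<lambda>x. ennreal (w x))) (1 + \<delta>)"
      using W C by (simp add: epowr_ennreal_pos powr_add ennreal_mult' ac_simps)
    finally show "emean Q (\<lambda>x. epowr (ennreal (w x)) (1 + \<delta>)) \<le> ennreal C * epowr (emean Q (\<lambda>x. ennreal (w x))) (1 + \<delta>)" .
  qed
qed

subsection \<open>Lebesgue measure on \<open>(\<real>\<^sup>n)\<^sup>m\<close>\<close>


lemma measurable_vec_lambda_PiM:
  "(\<lambda>f. \<chi> j. f j) \<in> (\<Pi>\<^sub>M j\<in>UNIV. lborel :: 'a::euclidean_space measure) \<rightarrow>\<^sub>M (borel :: ('a^'m) measure)"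
proof (rule borel_measurable_euclidean_space[THEN iffD2], intro ballI)
  fix b :: "'a^'m" assume "b \<in> Basis"
  then obtain j v where b: "b = axis j v" by (auto simp: Basis_vec_def)
  have "(\<lambda>f. (\<chi> j. f j) \<bullet> b) = (\<lambda>f :: 'm \<Rightarrow> 'a. f j \<bullet> v)" by (simp add: b inner_axis)
  then show "(\<lambda>f. (\<chi> j. f j) \<bullet> b) \<in> borel_measurable (\<Pi>\<^sub>M j\<in>UNIV. lborel :: 'a measure)" by simp
qed

text \<open>It suffices to compare boxes. The basis of the iterated vector space consists of the
  vectors \<open>axis j v\<close>, so the product of the side lengths factors over \<open>j\<close>
  and \<open>v\<close>.\<close>

lemma lborel_vec_eq:
  "(lborel :: ('a::euclidean_space^'m) measure) = distr (\<Pi>\<^sub>M j\<in>UNIV. lborel) borel (\<lambda>f. \<chi> j. f j)"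
proof (rule lborel_eqI)
  interpret product_sigma_finite "\<lambda>_ :: 'm. lborel :: 'a measure" by standard
  note meas [measurable] = measurable_vec_lambda_PiM
  fix l u :: "'a^'m" assume le: "\<And>b. b \<in> Basis \<Longrightarrow> l \<bullet> b \<le> u \<bullet> b"
  have lej: "l $ j \<bullet> v \<le> u $ j \<bullet> v" if "v \<in> Basis" for j v
    using le[of "axis j v"] that by (auto simp: inner_axis Basis_vec_def)
  have "emeasure (distr (\<Pi>\<^sub>M j\<in>UNIV. lborel) borel (\<lambda>f. \<chi> j. f j)) (box l u)
      = emeasure (\<Pi>\<^sub>M j\<in>UNIV. lborel) ((\<lambda>f. \<chi> j. f j) -` box l u \<inter> space (\<Pi>\<^sub>M j\<in>UNIV. lborel))"
    by (intro emeasure_distr meas) auto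
  also have "(\<lambda>f. \<chi> j. f j) -` box l u \<inter> space (\<Pi>\<^sub>M j\<in>UNIV. lborel) = (\<Pi>\<^sub>E j\<in>UNIV. box (l $ j) (u $ j))"
    by (auto simp: space_PiM mem_box Basis_vec_def inner_axis PiE_def Pi_iff)
  also have "emeasure (\<Pi>\<^sub>M j\<in>UNIV. lborel) (\<Pi>\<^sub>E j\<in>UNIV. box (l $ j) (u $ j)) = (\<Prod>j\<in>UNIV. emeasure lborel (box (l $ j) (u $ j)))"
    by (intro emeasure_PiM) auto
  also have "\<dots> = (\<Prod>j\<in>UNIV. ennreal (\<Prod>v\<in>Basis. (u $ j - l $ j) \<bullet> v))"
    using lej by (intro prod.cong) (auto simp: emeasure_lborel_box)
  also have "\<dots> = ennreal (\<Prod>j\<in>UNIV. \<Prod>v\<in>Basis. (u $ j - l $ j) \<bullet> v)"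
    using lej by (intro prod_ennreal prod_nonneg) (auto simp: inner_diff_left)
  also have "(\<Prod>j\<in>UNIV. \<Prod>v\<in>Basis. (u $ j - l $ j) \<bullet> v) = (\<Prod>b\<in>Basis. (u - l) \<bullet> b)"
  proof -
    have "bij_betw (\<lambda>(j, v). axis j v) (UNIV \<times> Basis) (Basis :: ('a^'m) set)"
      by (auto simp: bij_betw_def inj_on_def Basis_vec_def axis_eq_axis)
    from prod.reindex_bij_betw[OF this, of "\<lambda>b. (u - l) \<bullet> b"]
    show ?thesis by (simp add: prod.cartesian_product split_beta' inner_axis)
  qed
  finally show "emeasure (distr (\<Pi>\<^sub>M j\<in>UNIV. lborel) borel (\<lambda>f. \<chi> j. f j)) (box l u) = (\<Prod>b\<in>Basis. (u - l) \<bullet> b)" .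
qed simp

lemma nn_integral_lborel_vec_prod:
  fixes h :: "'m::finite \<Rightarrow> 'a::euclidean_space \<Rightarrow> ennreal"
  assumes [measurable]: "\<And>j. h j \<in> borel_measurable borel"
  shows "(\<integral>\<^sup>+y. (\<Prod>j\<in>UNIV. h j (y $ j)) \<partial>lborel) = (\<Prod>j\<in>UNIV. \<integral>\<^sup>+x. h j x \<partial>lborel)"
proof -
  interpret product_sigma_finite "\<lambda>_ :: 'm. lborel :: 'a measure" by standard
  note meas [measurable] = measurable_vec_lambda_PiM
  have "(\<lambda>y :: 'a^'m. y $ j) \<in> borel_measurable borel" for j
    by (intro borel_measurable_continuous_onI continuous_intros)
  note [measurable] = this
  have "(\<lambda>y :: 'a^'m. \<Prod>j\<in>UNIV. h j (y $ j)) \<in> borel_measurable borel" by measurable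
  then have "(\<integral>\<^sup>+y. (\<Prod>j\<in>UNIV. h j (y $ j)) \<partial>(lborel :: ('a^'m) measure)) = (\<integral>\<^sup>+f. (\<Prod>j\<in>UNIV. h j (f j)) \<partial>(\<Pi>\<^sub>M j\<in>UNIV. lborel))"
    unfolding lborel_vec_eq by (subst nn_integral_distr[OF meas]) simp_all
  also have "\<dots> = (\<Prod>j\<in>UNIV. \<integral>\<^sup>+x. h j x \<partial>lborel)" by (intro product_nn_integral_prod) auto
  finally show ?thesis .
qed

text \<open>Written as a product integral, the measure of the cylinder has one factor 0, while any
  other factors are infinite; 0 * top = 0 decides.\<close>

lemma null_sets_vec_nth:
  assumes "N \<in> null_sets (lborel :: 'a::euclidean_space measure)"
  shows "{y :: 'a^'m. y $ j \<in> N} \<in> null_sets lborel"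
proof -
  have [measurable]: "N \<in> sets borel" using assms by auto
  have [measurable]: "(\<lambda>y :: 'a^'m. y $ i) \<in> borel_measurable borel" for i
    by (intro borel_measurable_continuous_onI continuous_intros)
  have s: "{y :: 'a^'m. y $ j \<in> N} \<in> sets borel" by measurable
  have "emeasure lborel {y :: 'a^'m. y $ j \<in> N} = (\<integral>\<^sup>+y. (\<Prod>i\<in>UNIV. if i = j then indicator N (y $ i) else 1) \<partial>(lborel :: ('a^'m) measure))"
    unfolding nn_integral_indicator[of _ lborel, OF s[folded sets_lborel], symmetric]
    by (intro nn_integral_cong) (simp add: prod.delta indicator_def del: of_bool_eq)
  also have "\<dots> = (\<Prod>i\<in>UNIV. \<integral>\<^sup>+x. (if i = j then indicator N x else 1) \<partial>(lborel :: 'a measure))"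
    by (rule nn_integral_lborel_vec_prod) auto
  also have "\<dots> = 0" using assms by (auto intro!: exI[of _ j] bexI[of _ j])
  finally show ?thesis using s by (auto simp: null_sets_def)
qed

lemma AE_vec_nth:
  assumes "AE x in lebesgue. P (x :: 'a::euclidean_space)"
  shows "AE y in lebesgue. P ((y :: 'a^'m) $ j)"
proof -
  obtain N where N: "N \<in> null_sets lborel" "{x. \<not> P x} \<subseteq> N"
    using assms[THEN AE_completion_iff[THEN iffD1]] unfolding eventually_ae_filter by auto
  then have "{y :: 'a^'m. \<not> P (y $ j)} \<subseteq> {y. y $ j \<in> N}" by auto
  then have "AE y in lborel. P ((y :: 'a^'m) $ j)"
    using null_sets_vec_nth[OF N(1), of j] by (intro AE_I'[of "{y. y $ j \<in> N}"]) auto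
  then show ?thesis by (rule AE_completion)
qed

text \<open>For completed measures Borel measurability is not enough: preimages of null sets must be
  null, which is the cylinder statement above.\<close>

lemma measurable_vec_nth_lebesgue [measurable]:
  "(\<lambda>y :: 'a::euclidean_space^'m. y $ j) \<in> lebesgue \<rightarrow>\<^sub>M lebesgue"
proof (rule completion.measurable_completion2)
  have [measurable]: "(\<lambda>y :: 'a^'m. y $ j) \<in> borel_measurable borel"
    by (intro borel_measurable_continuous_onI continuous_intros)
  show m: "(\<lambda>y :: 'a^'m. y $ j) \<in> lebesgue \<rightarrow>\<^sub>M lborel" by (simp add: measurable_completion)
  show "null_sets lborel \<subseteq> null_sets (distr lebesgue lborel (\<lambda>y :: 'a^'m. y $ j))"
  proof
    fix N :: "'a set" assume N: "N \<in> null_sets lborel"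
    have "{y :: 'a^'m. y $ j \<in> N} \<in> null_sets lebesgue"
      by (intro null_sets_completionI null_sets_vec_nth N)
    then show "N \<in> null_sets (distr lebesgue lborel (\<lambda>y :: 'a^'m. y $ j))"
      using N m by (auto simp: null_sets_def emeasure_distr vimage_def simp del: emeasure_completion)
  qed
qed

text \<open>Each function is replaced by a Borel representative. Equality almost everywhere in one
  coordinate lifts to the product, so the Borel case applies.\<close>

lemma nn_integral_lebesgue_vec_prod:
  fixes h :: "'m::finite \<Rightarrow> 'a::euclidean_space \<Rightarrow> ennreal"
  assumes "\<And>j. h j \<in> borel_measurable lebesgue"
  shows "(\<integral>\<^sup>+y. (\<Prod>j\<in>UNIV. h j (y $ j)) \<partial>lebesgue) = (\<Prod>j\<in>UNIV. \<integral>\<^sup>+x. h j x \<partial>lebesgue)"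
proof -
  have "\<exists>g\<in>borel_measurable lborel. AE x in lborel. h j x = g x" for j
    using completion_ex_borel_measurable[OF assms[of j]] .
  then obtain g where g: "\<And>j. g j \<in> borel_measurable lborel" "\<And>j. AE x in lborel. h j x = g j x" by metis
  have AE: "AE x in lebesgue. h j x = g j x" for j using g(2) by (rule AE_completion)
  have "AE y in lebesgue. \<forall>j\<in>UNIV. h j ((y :: 'a^'m) $ j) = g j (y $ j)"
    by (intro AE_finite_allI AE_vec_nth AE) auto
  then have "(\<integral>\<^sup>+y. (\<Prod>j\<in>UNIV. h j ((y :: 'a^'m) $ j)) \<partial>lebesgue) = (\<integral>\<^sup>+y. (\<Prod>j\<in>UNIV. g j (y $ j)) \<partial>lebesgue)"
    by (intro nn_integral_cong_AE) (auto elim!: eventually_mono)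
  also have "\<dots> = (\<Prod>j\<in>UNIV. \<integral>\<^sup>+x. g j x \<partial>lborel)"
    unfolding nn_integral_completion using g by (intro nn_integral_lborel_vec_prod) auto
  also have "\<dots> = (\<Prod>j\<in>UNIV. \<integral>\<^sup>+x. g j x \<partial>lebesgue)" by (simp only: nn_integral_completion)
  also have "\<dots> = (\<Prod>j\<in>UNIV. \<integral>\<^sup>+x. h j x \<partial>lebesgue)"
  proof (intro prod.cong refl nn_integral_cong_AE)
    show "AE x in lebesgue. g j x = h j x" for j using AE[of j] by eventually_elim simp
  qed
  finally show ?thesis .
qed

subsection \<open>Geometric sums over the integers\<close>

lemma geometric_sum_below:
  assumes a: "0 < a" and X: "0 < (X :: real)"
  shows "(\<integral>\<^sup>+k. ennreal (2 powr (a * real_of_int k)) * indicator {k. 2 powr real_of_int k \<le> X} k \<partial>count_space UNIV)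
    \<le> ennreal (X powr a / (1 - 2 powr (- a)))"
proof -
  \<comment> \<open>The largest scale in the sum; counting down from it turns the sum over integers
    into a geometric series over naturals.\<close>
  define K where "K = \<lfloor>log 2 X\<rfloor>"
  have iff: "2 powr real_of_int k \<le> X \<longleftrightarrow> k \<le> K" for k
    using X by (simp add: K_def le_floor_iff le_log_iff)
  have r: "2 powr (- a) < 1" "0 < 2 powr (-a)" using a by (auto simp: powr_less_one)
  have "(\<integral>\<^sup>+k. ennreal (2 powr (a * real_of_int k)) * indicator {k. 2 powr real_of_int k \<le> X} k \<partial>count_space UNIV)
      = (\<integral>\<^sup>+k. ennreal (2 powr (a * real_of_int k)) \<partial>count_space {..K})"
    by (simp add: nn_integral_count_space_indicator iff indicator_def)
  also have "\<dots> = (\<integral>\<^sup>+j. ennreal (2 powr (a * real_of_int (K - int j))) \<partial>count_space UNIV)"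
    by (rule nn_integral_bij_count_space[symmetric, of "\<lambda>j. K - int j"])
      (rule bij_betwI[where g = "\<lambda>k. nat (K - k)"], auto)
  also have "\<dots> = (\<Sum>j. ennreal (2 powr (a * K) * (2 powr (- a)) ^ j))"
    unfolding nn_integral_count_space_nat
    by (intro suminf_cong arg_cong[where f = ennreal]) (simp add: powr_realpow[symmetric] powr_powr powr_add[symmetric] algebra_simps)
  also have "\<dots> = ennreal (2 powr (a * K) * (1 / (1 - 2 powr (- a))))"
    using r by (intro suminf_ennreal_eq sums_mult geometric_sums) auto
  also have "2 powr (a * K) \<le> X powr a"
  proof -
    have "2 powr (a * K) = (2 powr real_of_int K) powr a" by (simp add: powr_powr mult.commute)
    also have "\<dots> \<le> X powr a" using a iff[of K] by (intro powr_mono2) auto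
    finally show ?thesis .
  qed
  then have "ennreal (2 powr (a * K) * (1 / (1 - 2 powr (- a)))) \<le> ennreal (X powr a / (1 - 2 powr (- a)))"
    using r by (intro ennreal_leI) (simp add: divide_right_mono)
  finally show ?thesis .
qed

lemma geometric_sum_above:
  assumes a: "0 < a" and X: "0 < (X :: real)"
  shows "(\<integral>\<^sup>+k. ennreal (2 powr (- a * real_of_int k)) * indicator {k. X \<le> 2 powr real_of_int k} k \<partial>count_space UNIV)
    \<le> ennreal (X powr (- a) / (1 - 2 powr (- a)))"
proof -
  have "(\<integral>\<^sup>+k. ennreal (2 powr (- a * real_of_int k)) * indicator {k. X \<le> 2 powr real_of_int k} k \<partial>count_space UNIV)
    = (\<integral>\<^sup>+k. ennreal (2 powr (- a * real_of_int (- k))) * indicator {k. X \<le> 2 powr real_of_int k} (- k) \<partial>count_space UNIV)"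
    by (rule nn_integral_bij_count_space[symmetric, of uminus]) (rule bij_betwI[where g = uminus], auto)
  also have "\<dots> = (\<integral>\<^sup>+k. ennreal (2 powr (a * real_of_int k)) * indicator {k. 2 powr real_of_int k \<le> 1 / X} k \<partial>count_space UNIV)"
    using X by (intro nn_integral_cong) (simp add: indicator_def powr_minus field_simps)
  also have "\<dots> \<le> ennreal ((1 / X) powr a / (1 - 2 powr (- a)))"
    using X by (intro geometric_sum_below a) simp
  also have "(1 / X) powr a = X powr (- a)" using X by (simp add: powr_divide powr_minus field_simps)
  finally show ?thesis .
qed

text \<open>Hedberg's trick: the sum is split at the scale where the two bounds agree.\<close>

lemma sum_le_geometric_mean:
  assumes a: "0 < a"
    and A: "\<And>k :: int. u k \<le> A * ennreal (2 powr (- a * real_of_int k))"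
    and B: "\<And>k :: int. u k \<le> B * ennreal (2 powr (a * real_of_int k))"
  shows "(\<integral>\<^sup>+k. u k \<partial>count_space UNIV) \<le> ennreal (2 / (1 - 2 powr (- a))) * epowr (A * B) (1 / 2)"
proof -
  have r: "2 powr (- a) < 1" using a by (auto simp: powr_less_one)
  \<comment> \<open>The order of the cases matters: if one bound is 0 all terms vanish, even when
    the other bound is infinite. Once both are nonzero, an infinite one makes \<open>A * B\<close>
    infinite.\<close>
  consider "A = 0 \<or> B = 0" | "A \<noteq> 0" "B \<noteq> 0" "A = top \<or> B = top" | "A \<noteq> 0" "B \<noteq> 0" "A \<noteq> top" "B \<noteq> top" by blast
  then show ?thesis
  proof cases
    case 1
    then have "u k = 0" for k using A[of k] B[of k] by auto
    then show ?thesis by simp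
  next
    case 2
    then have "A * B = top" by (auto simp: ennreal_mult_top ennreal_top_mult)
    then show ?thesis using r a by (simp add: ennreal_mult_top)
  next
    case 3
    obtain A' where A': "A = ennreal A'" "0 < A'" using 3 by (cases A) (auto simp: less_le)
    obtain B' where B': "B = ennreal B'" "0 < B'" using 3 by (cases B) (auto simp: less_le)
    define X where "X = (A' / B') powr (1 / (2 * a))"
    have X: "0 < X" using A' B' by (simp add: X_def)
    have Xa: "X powr a = sqrt (A' / B')" "X powr (- a) = sqrt (B' / A')"
      using a A' B' by (simp_all add: X_def powr_powr powr_half_sqrt powr_minus real_sqrt_divide)
    have "(\<integral>\<^sup>+k. u k \<partial>count_space UNIV) \<le> (\<integral>\<^sup>+k. B * (ennreal (2 powr (a * real_of_int k)) * indicator {k. 2 powr real_of_int k \<le> X} k)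
       + A * (ennreal (2 powr (- a * real_of_int k)) * indicator {k. X \<le> 2 powr real_of_int k} k) \<partial>count_space UNIV)"
    proof (intro nn_integral_mono)
      fix k :: int
      show "u k \<le> B * (ennreal (2 powr (a * real_of_int k)) * indicator {k. 2 powr real_of_int k \<le> X} k)
       + A * (ennreal (2 powr (- a * real_of_int k)) * indicator {k. X \<le> 2 powr real_of_int k} k)"
      proof (cases "2 powr real_of_int k \<le> X")
        case True
        then show ?thesis using B[of k] by (simp add: add_increasing2)
      next
        case False
        then show ?thesis using A[of k] by (simp add: add_increasing)
      qed
    qed
    also have "\<dots> = B * (\<integral>\<^sup>+k. ennreal (2 powr (a * real_of_int k)) * indicator {k. 2 powr real_of_int k \<le> X} k \<partial>count_space UNIV)
       + A * (\<integral>\<^sup>+k. ennreal (2 powr (- a * real_of_int k)) * indicator {k. X \<le> 2 powr real_of_int k} k \<partial>count_space UNIV)"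
      by (simp add: nn_integral_add nn_integral_cmult)
    also have "\<dots> \<le> B * ennreal (X powr a / (1 - 2 powr (- a))) + A * ennreal (X powr (- a) / (1 - 2 powr (- a)))"
      by (intro add_mono mult_left_mono geometric_sum_below geometric_sum_above a X) auto
    also have "\<dots> = ennreal (B' * (X powr a / (1 - 2 powr (- a))) + A' * (X powr (- a) / (1 - 2 powr (- a))))"
      using A' B' r by (simp add: ennreal_mult' del: times_divide_eq_right)
    also have "B' * (X powr a / (1 - 2 powr (- a))) + A' * (X powr (- a) / (1 - 2 powr (- a))) = 2 / (1 - 2 powr (- a)) * sqrt (A' * B')"
    proof -
      have "B' * sqrt (A' / B') = sqrt (A' * B')" "A' * sqrt (B' / A') = sqrt (A' * B')"
        using A' B' by (simp_all add: real_sqrt_divide real_sqrt_mult field_simps)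
      then show ?thesis unfolding Xa by (simp add: field_simps add_divide_distrib[symmetric])
    qed
    also have "ennreal (2 / (1 - 2 powr (- a)) * sqrt (A' * B')) = ennreal (2 / (1 - 2 powr (- a))) * epowr (A * B) (1 / 2)"
    proof -
      have "A * B = ennreal (A' * B')" using A' B' by (simp add: ennreal_mult)
      then have "epowr (A * B) (1 / 2) = ennreal (sqrt (A' * B'))"
        using A' B' epowr_ennreal[of "1/2" "A' * B'"] powr_half_sqrt[of "A' * B'"] by simp
      then show ?thesis using r by (simp only: ennreal_mult' divide_nonneg_pos diff_gt_0_iff_gt)
    qed
    finally show ?thesis .
  qed
qed

subsection \<open>Sums over a grid of cubes\<close>

text \<open>The dyadic cube of index \<open>z\<close> and side 2^k together with its neighbours. It
  contains every point that differs by at most 2^k in each coordinate from a point of the central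
  cube, so one cube per scale suffices at each \<open>x\<close>.\<close>

definition grid_cube :: "int \<Rightarrow> ('n \<Rightarrow> int) \<Rightarrow> (real^'n) set" where
  "grid_cube k z = cube (\<chi> i. 2 powr real_of_int k * (of_int (z i) - 1)) (3 * 2 powr real_of_int k)"

lemma grid_cube_in_cubes [simp]: "grid_cube k z \<in> cubes"
  by (simp add: grid_cube_def cube_in_cubes)

lemma sets_grid_cube [measurable, simp]: "grid_cube k z \<in> sets lebesgue"
  by (rule sets_cubes) simp

lemma emeasure_grid_cube:
  "emeasure lebesgue (grid_cube k z :: (real^'n) set) = ennreal (3 ^ CARD('n) * 2 powr (real CARD('n) * real_of_int k))"
proof -
  have "(3 * 2 powr real_of_int k) ^ CARD('n) = 3 ^ CARD('n) * 2 powr (real CARD('n) * real_of_int k)"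
    by (simp add: power_mult_distrib powr_powr powr_realpow[symmetric] mult.commute)
  then show ?thesis unfolding grid_cube_def by (subst emeasure_cube) simp_all
qed

lemma mem_grid_cube:
  "x \<in> grid_cube k z \<longleftrightarrow> (\<forall>i. x $ i / 2 powr real_of_int k - 2 \<le> of_int (z i) \<and> of_int (z i) \<le> x $ i / 2 powr real_of_int k + 1)"
proof -
  have "2 powr real_of_int k * (c - 1) \<le> t \<and> t \<le> 2 powr real_of_int k * (c - 1) + 3 * 2 powr real_of_int k
    \<longleftrightarrow> t / 2 powr real_of_int k - 2 \<le> c \<and> c \<le> t / 2 powr real_of_int k + 1" for t c :: real
  proof -
    have "0 < 2 powr real_of_int k" by simp
    then show ?thesis by (auto simp: field_simps)
  qed
  then show ?thesis by (simp add: grid_cube_def mem_cube)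
qed

text \<open>In each coordinate \<open>z i\<close> is confined to a closed interval of length 3,
  which holds at most 4 integers.\<close>

lemma grid_cube_overlap:
  "(\<integral>\<^sup>+z. indicator (grid_cube k z) x \<partial>count_space UNIV) \<le> (4 ^ CARD('n) :: ennreal)" for x :: "real^'n"
proof -
  define A where "A i = {\<lceil>x $ i / 2 powr real_of_int k\<rceil> - 2..\<lfloor>x $ i / 2 powr real_of_int k\<rfloor> + 1}" for i
  have A: "finite (A i)" "card (A i) \<le> 4" for i
    unfolding A_def by (simp, simp) linarith
  have sub: "{z. x \<in> grid_cube k z} \<subseteq> (\<Pi>\<^sub>E i\<in>UNIV. A i)"
  proof
    fix z assume "z \<in> {z. x \<in> grid_cube k z}"
    then have "x $ i / 2 powr real_of_int k - 2 \<le> of_int (z i)" "of_int (z i) \<le> x $ i / 2 powr real_of_int k + 1" for i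
      by (auto simp: mem_grid_cube)
    then have "x $ i / 2 powr real_of_int k \<le> of_int (z i + 2)" "of_int (z i - 1) \<le> x $ i / 2 powr real_of_int k" for i
      by (auto simp: algebra_simps)
    then have "\<lceil>x $ i / 2 powr real_of_int k\<rceil> \<le> z i + 2" "z i - 1 \<le> \<lfloor>x $ i / 2 powr real_of_int k\<rfloor>" for i
      unfolding ceiling_le_iff le_floor_iff by auto
    then have "z i \<in> A i" for i unfolding A_def atLeastAtMost_iff by (metis add.commute diff_le_eq le_diff_eq)
    then show "z \<in> (\<Pi>\<^sub>E i\<in>UNIV. A i)" by auto
  qed
  have fin: "finite (\<Pi>\<^sub>E i\<in>(UNIV :: 'n set). A i)" by (intro finite_PiE A) auto
  have f: "finite {z. x \<in> grid_cube k z}" by (rule finite_subset[OF sub fin])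
  have "card {z. x \<in> grid_cube k z} \<le> card (\<Pi>\<^sub>E i\<in>(UNIV :: 'n set). A i)"
    by (rule card_mono[OF fin sub])
  also have "card (\<Pi>\<^sub>E i\<in>(UNIV :: 'n set). A i) = (\<Prod>i\<in>UNIV. card (A i))" by (simp add: card_PiE)
  also have "\<dots> \<le> (\<Prod>i\<in>(UNIV :: 'n set). 4)" using A by (intro prod_mono) auto
  finally have card: "card {z. x \<in> grid_cube k z} \<le> 4 ^ CARD('n)" by simp
  have "(\<integral>\<^sup>+z. indicator (grid_cube k z) x \<partial>count_space UNIV) = (\<integral>\<^sup>+z. indicator {z. x \<in> grid_cube k z} z \<partial>count_space UNIV)"
    by (intro nn_integral_cong) (simp add: indicator_def)
  also have "\<dots> = emeasure (count_space UNIV) {z. x \<in> grid_cube k z}" by simp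
  also have "\<dots> = of_nat (card {z. x \<in> grid_cube k z})" using f by simp
  also have "\<dots> \<le> of_nat (4 ^ CARD('n))" using card by (rule of_nat_mono)
  finally show ?thesis by simp
qed

lemma grid_cube_overlap_integral:
  fixes g :: "real^'n \<Rightarrow> ennreal"
  assumes [measurable]: "g \<in> borel_measurable lebesgue"
  shows "(\<integral>\<^sup>+z. (\<integral>\<^sup>+x\<in>grid_cube k z. g x \<partial>lebesgue) \<partial>count_space UNIV) \<le> 4 ^ CARD('n) * (\<integral>\<^sup>+x. g x \<partial>lebesgue)"
proof -
  have "(\<integral>\<^sup>+z. (\<integral>\<^sup>+x\<in>grid_cube k z. g x \<partial>lebesgue) \<partial>count_space UNIV)
      = (\<integral>\<^sup>+x. (\<integral>\<^sup>+z. g x * indicator (grid_cube k z) x \<partial>count_space UNIV) \<partial>lebesgue)"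
    by (intro nn_integral_count_space_nn_integral[symmetric]) auto
  also have "\<dots> = (\<integral>\<^sup>+x. g x * (\<integral>\<^sup>+z. indicator (grid_cube k z) x \<partial>count_space UNIV) \<partial>lebesgue)"
    by (intro nn_integral_cong nn_integral_cmult) auto
  also have "\<dots> \<le> (\<integral>\<^sup>+x. g x * 4 ^ CARD('n) \<partial>lebesgue)"
    by (intro nn_integral_mono mult_left_mono grid_cube_overlap) auto
  also have "\<dots> = 4 ^ CARD('n) * (\<integral>\<^sup>+x. g x \<partial>lebesgue)"
    by (subst nn_integral_multc) (auto simp: mult.commute)
  finally show ?thesis .
qed

section \<open>Hoelder and Jensen for averages, and the sum over all grid cubes\<close>

lemma emean_add:
  assumes [measurable]: "f \<in> borel_measurable lebesgue" "g \<in> borel_measurable lebesgue" "Q \<in> sets lebesgue"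
  shows "emean Q (\<lambda>x. f x + g x) = emean Q f + emean Q g"
  unfolding emean_def by (simp add: distrib_right nn_integral_add add_divide_distrib_ennreal)

lemma emean_holder2':
  assumes "0 < u" "0 < v" "1/u + 1/v = 1" and Q: "Q \<in> cubes"
    and [measurable]: "f \<in> borel_measurable lebesgue" "g \<in> borel_measurable lebesgue"
  shows "emean Q (\<lambda>x. f x * g x) \<le> epowr (emean Q (\<lambda>x. epowr (f x) u)) (1/u) * epowr (emean Q (\<lambda>x. epowr (g x) v)) (1/v)"
proof -
  note [measurable] = sets_cubes[OF Q]
  have "(\<integral>\<^sup>+x. f x * g x \<partial>uniform_measure lebesgue Q)
    \<le> epowr (\<integral>\<^sup>+x. epowr (f x) u \<partial>uniform_measure lebesgue Q) (1/u) * epowr (\<integral>\<^sup>+x. epowr (g x) v \<partial>uniform_measure lebesgue Q) (1/v)"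
    by (rule nn_integral_holder2'[OF assms(1-3)]) simp_all
  then show ?thesis by (simp add: emean_uniform_measure[symmetric])
qed

lemma emean_jensen:
  assumes u: "1 \<le> u" and Q: "Q \<in> cubes" and [measurable]: "f \<in> borel_measurable lebesgue"
  shows "epowr (emean Q f) u \<le> emean Q (\<lambda>x. epowr (f x) u)"
proof (cases "u = 1")
  case False
  define v where "v = u / (u - 1)"
  have v: "0 < v" "1/u + 1/v = 1" using u False by (auto simp: v_def field_simps)
  have "emean Q (\<lambda>x. f x * 1) \<le> epowr (emean Q (\<lambda>x. epowr (f x) u)) (1/u) * epowr (emean Q (\<lambda>x. epowr 1 v)) (1/v)"
    using u by (intro emean_holder2' v Q) auto
  then have "emean Q f \<le> epowr (emean Q (\<lambda>x. epowr (f x) u)) (1/u)" by (simp add: emean_const[OF Q])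
  then show ?thesis using u by (subst epowr_le_swap) auto
qed simp

text \<open>Comparison with the maximum treats exponents below and above 1 alike.\<close>

lemma epowr_add_le:
  assumes "0 \<le> a" shows "epowr (x + y) a \<le> ennreal (2 powr a) * (epowr x a + epowr y a)"
proof -
  have "x + y \<le> 2 * max x y" by (metis add_mono max.cobounded1 max.cobounded2 mult_2)
  then have "epowr (x + y) a \<le> epowr 2 a * epowr (max x y) a"
    using epowr_mono[OF assms] by (simp add: epowr_mult[OF assms, symmetric])
  also have "epowr 2 a = ennreal (2 powr a)" using epowr_ennreal_pos[of 2 a] by simp
  also have "epowr (max x y) a \<le> epowr x a + epowr y a" by (simp add: max_def add_increasing add_increasing2)
  finally show ?thesis by (simp add: mult_left_mono)
qed

text \<open>Here \<open>x\<close> stands for the value of a function at one point. It exceeds the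
  height 2^(-n k / P) only at scales 2^k >= x^(-P/n); the smallest of them dominates the geometric
  sum and contributes x * x^(P - 1).\<close>

lemma level_sum_above:
  assumes n: "0 < n" and P: "1 < P"
  shows "(\<integral>\<^sup>+k. ennreal (2 powr (- (n * (1 - 1 / P)) * real_of_int k)) * (x * indicator {k. ennreal (2 powr (- (n / P) * real_of_int k)) < x} k) \<partial>count_space UNIV)
    \<le> ennreal (1 / (1 - 2 powr (- (n * (1 - 1 / P))))) * epowr x P"
proof -
  define a where "a = n * (1 - 1 / P)"
  have a: "0 < a" using n P by (simp add: a_def)
  have r: "2 powr (- a) < 1" using a by (simp add: powr_less_one)
  have pos: "0 < 1 / (1 - 2 powr (- a))" using r by simp
  consider "x = 0" | "x = top" | x' where "x = ennreal x'" "0 < x'" by (cases x) (auto simp: less_le)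
  then show ?thesis
  proof cases
    case 1 then show ?thesis by simp
  next
    case 2 then show ?thesis using P pos by (simp add: a_def[symmetric] ennreal_mult_top ennreal_eq_0_iff not_le)
  next
    case 3
    define X where "X = x' powr (- (P / n))"
    have X: "0 < X" using 3 by (simp add: X_def)
    have iff: "2 powr (- (n / P) * real_of_int k) < x' \<Longrightarrow> X \<le> 2 powr real_of_int k" for k
    proof -
      assume *: "2 powr (- (n / P) * real_of_int k) < x'"
      have "X \<le> (2 powr (- (n / P) * real_of_int k)) powr (- (P / n))"
        unfolding X_def using * n P by (intro powr_mono2') auto
      also have "\<dots> = 2 powr real_of_int k" using n P by (simp add: powr_powr field_simps)
      finally show ?thesis .
    qed
    have "(\<integral>\<^sup>+k. ennreal (2 powr (- a * real_of_int k)) * (x * indicator {k. ennreal (2 powr (- (n / P) * real_of_int k)) < x} k) \<partial>count_space UNIV)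
      \<le> (\<integral>\<^sup>+k. x * (ennreal (2 powr (- a * real_of_int k)) * indicator {k. X \<le> 2 powr real_of_int k} k) \<partial>count_space UNIV)"
      using iff 3 by (intro nn_integral_mono) (auto simp: indicator_def ac_simps ennreal_less_iff)
    also have "\<dots> = x * (\<integral>\<^sup>+k. (ennreal (2 powr (- a * real_of_int k)) * indicator {k. X \<le> 2 powr real_of_int k} k) \<partial>count_space UNIV)"
      by (intro nn_integral_cmult) auto
    also have "\<dots> \<le> x * ennreal (X powr (- a) / (1 - 2 powr (- a)))"
      by (intro mult_left_mono geometric_sum_above a X) auto
    also have "X powr (- a) = x' powr (P - 1)"
    proof -
      have "P / n * a = P - 1" using n P by (simp add: a_def field_simps)
      then show ?thesis by (simp add: X_def powr_powr)
    qed
    also have "x * ennreal (x' powr (P - 1) / (1 - 2 powr (- a))) = ennreal (x' * (x' powr (P - 1) / (1 - 2 powr (- a))))"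
      using 3 by (simp add: ennreal_mult' del: times_divide_eq_right)
    also have "x' * (x' powr (P - 1) / (1 - 2 powr (- a))) = 1 / (1 - 2 powr (- a)) * x' powr P"
      using 3 by (simp add: powr_diff)
    also have "ennreal \<dots> = ennreal (1 / (1 - 2 powr (- a))) * epowr x P"
      using 3 pos by (simp add: ennreal_mult' epowr_ennreal_pos del: times_divide_eq_left)
    finally show ?thesis by (simp add: a_def)
  qed
qed

text \<open>At the scales 2^k <= x^(-P/n) the largest one dominates, leaving x^R * x^(P - R). The
  condition P < R makes the growth exponent positive.\<close>

lemma level_sum_below:
  assumes n: "0 < n" and P: "0 < P" "P < R"
  shows "(\<integral>\<^sup>+k. ennreal (2 powr (n * (R / P - 1) * real_of_int k)) * epowr (x * indicator {k. x \<le> ennreal (2 powr (- (n / P) * real_of_int k))} k) R \<partial>count_space UNIV)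
    \<le> ennreal (1 / (1 - 2 powr (- (n * (R / P - 1))))) * epowr x P"
proof -
  define b where "b = n * (R / P - 1)"
  have b: "0 < b" using n P by (simp add: b_def)
  have r: "2 powr (- b) < 1" using b by (simp add: powr_less_one)
  have pos: "0 < 1 / (1 - 2 powr (- b))" using r by simp
  have R: "0 < R" using P by simp
  consider "x = 0" | "x = top" | x' where "x = ennreal x'" "0 < x'" by (cases x) (auto simp: less_le)
  then show ?thesis
  proof cases
    case 1 then show ?thesis using R by simp
  next
    case 2 then show ?thesis using P pos by (simp add: b_def[symmetric] ennreal_mult_top ennreal_eq_0_iff not_le)
  next
    case 3
    define X where "X = x' powr (- (P / n))"
    have X: "0 < X" using 3 by (simp add: X_def)
    have iff: "x' \<le> 2 powr (- (n / P) * real_of_int k) \<Longrightarrow> 2 powr real_of_int k \<le> X" for k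
    proof -
      assume *: "x' \<le> 2 powr (- (n / P) * real_of_int k)"
      have "(2 powr (- (n / P) * real_of_int k)) powr (- (P / n)) \<le> X"
        unfolding X_def using * n P 3 by (intro powr_mono2') auto
      moreover have "(2 powr (- (n / P) * real_of_int k)) powr (- (P / n)) = 2 powr real_of_int k" using n P by (simp add: powr_powr field_simps)
      ultimately show ?thesis by simp
    qed
    have "(\<integral>\<^sup>+k. ennreal (2 powr (b * real_of_int k)) * epowr (x * indicator {k. x \<le> ennreal (2 powr (- (n / P) * real_of_int k))} k) R \<partial>count_space UNIV)
      \<le> (\<integral>\<^sup>+k. epowr x R * (ennreal (2 powr (b * real_of_int k)) * indicator {k. 2 powr real_of_int k \<le> X} k) \<partial>count_space UNIV)"
      using iff 3 R by (intro nn_integral_mono) (auto simp: indicator_def ac_simps)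
    also have "\<dots> = epowr x R * (\<integral>\<^sup>+k. (ennreal (2 powr (b * real_of_int k)) * indicator {k. 2 powr real_of_int k \<le> X} k) \<partial>count_space UNIV)"
      by (intro nn_integral_cmult) auto
    also have "\<dots> \<le> epowr x R * ennreal (X powr b / (1 - 2 powr (- b)))"
      by (intro mult_left_mono geometric_sum_below b X) auto
    also have "X powr b = x' powr (P - R)"
    proof -
      have "P / n * b = R - P" using n P by (simp add: b_def field_simps)
      then show ?thesis by (simp add: X_def powr_powr)
    qed
    also have "epowr x R * ennreal (x' powr (P - R) / (1 - 2 powr (- b))) = ennreal (x' powr R * (x' powr (P - R) / (1 - 2 powr (- b))))"
      using 3 by (simp add: ennreal_mult' epowr_ennreal_pos del: times_divide_eq_right)
    also have "x' powr R * (x' powr (P - R) / (1 - 2 powr (- b))) = 1 / (1 - 2 powr (- b)) * x' powr P"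
      using 3 by (simp add: powr_diff)
    also have "ennreal \<dots> = ennreal (1 / (1 - 2 powr (- b))) * epowr x P"
      using 3 pos by (simp add: ennreal_mult' epowr_ennreal_pos del: times_divide_eq_left)
    finally show ?thesis by (simp add: b_def)
  qed
qed

text \<open>For the part of \<open>h\<close> above the cut, Jensen and the normalization bound the
  scaled average by 1; for the part below, Jensen is applied with exponent R. In both cases an
  integral over the cube remains, so bounded overlap removes the sum over \<open>z\<close>, and the
  sum over \<open>k\<close> is carried out at each point. P > 1 and R > P make the geometric rates
  \<open>a\<close> and \<open>b\<close> positive.\<close>

lemma grid_sum_normalized:
  fixes P R :: real
  assumes P: "1 < P" "P < R"
  obtains C :: real where "0 < C"
    "\<And>h. h \<in> borel_measurable lebesgue \<Longrightarrow> (\<integral>\<^sup>+x. epowr (h x) P \<partial>lebesgue) \<le> 1 \<Longrightarrow>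
      (\<integral>\<^sup>+k. \<integral>\<^sup>+z. epowr (epowr (emeasure lebesgue (grid_cube k z :: (real^'n) set)) (1 / P) * emean (grid_cube k z) h) R \<partial>count_space UNIV \<partial>count_space UNIV) \<le> ennreal C"
proof -
  note [simp del] = emeasure_completion measure_completion
  define n where "n = real CARD('n)"
  have n: "0 < n" by (simp add: n_def)
  define a where "a = n * (1 - 1 / P)"
  define b where "b = n * (R / P - 1)"
  have a: "0 < a" and b: "0 < b" using n P by (auto simp: a_def b_def)
  have r: "2 powr (- a) < 1" "2 powr (- b) < 1" using a b by (auto simp: powr_less_one)
  \<comment> \<open>The volume of a grid cube carries a factor 3^n. For the low part it is raised to
    R / P - 1 > 0 and kept here; for the high part the exponent 1 / P - 1 is negative and the factor
    is at most 1.\<close>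
  define c3 :: real where "c3 = (3 ^ CARD('n)) powr (R / P - 1)"
  define C where "C = 2 powr R * (4 ^ CARD('n) * (1 / (1 - 2 powr (- a))) + c3 * (4 ^ CARD('n) * (1 / (1 - 2 powr (- b)))))"
  have C: "0 < C" using r by (auto simp: C_def c3_def intro!: mult_pos_pos add_pos_pos)
  show thesis
  proof (rule that[OF C])
    fix h :: "real^'n \<Rightarrow> ennreal"
    assume [measurable]: "h \<in> borel_measurable lebesgue" and norm: "(\<integral>\<^sup>+x. epowr (h x) P \<partial>lebesgue) \<le> 1"
    define t where "t k = ennreal (2 powr (- (n / P) * real_of_int k))" for k :: int
    define h1 where "h1 k x = h x * indicator {k. t k < h x} k" for k x
    define h2 where "h2 k x = h x * indicator {k. h x \<le> t k} k" for k x
    have h1m [measurable]: "h1 k \<in> borel_measurable lebesgue" for k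
      unfolding h1_def indicator_def of_bool_def mem_Collect_eq by measurable
    have h2m [measurable]: "h2 k \<in> borel_measurable lebesgue" for k
      unfolding h2_def indicator_def of_bool_def mem_Collect_eq by measurable
    have h12: "h x = h1 k x + h2 k x" for k x by (auto simp: h1_def h2_def indicator_def)
    define V :: "int \<Rightarrow> real" where "V k = 3 ^ CARD('n) * 2 powr (n * real_of_int k)" for k
    have V: "0 < V k" "emeasure lebesgue (grid_cube k z :: (real^'n) set) = ennreal (V k)" for k z
      by (auto simp: V_def emeasure_grid_cube n_def)
    have emean_eq: "emean (grid_cube k z) g = ennreal (1 / V k) * (\<integral>\<^sup>+x\<in>grid_cube k z. g x \<partial>lebesgue)" for k z and g :: "real^'n \<Rightarrow> ennreal"
      unfolding emean_def V(2) using V(1)[of k] by (simp add: divide_ennreal_def inverse_ennreal mult.commute inverse_eq_divide)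
    have term_le: "epowr (epowr (ennreal (V k)) (1 / P) * emean (grid_cube k z) h) R
      \<le> ennreal (2 powr R) * (ennreal (2 powr (- a * real_of_int k)) * (\<integral>\<^sup>+x\<in>grid_cube k z. h1 k x \<partial>lebesgue)
        + ennreal c3 * (ennreal (2 powr (b * real_of_int k)) * (\<integral>\<^sup>+x\<in>grid_cube k z. epowr (h2 k x) R \<partial>lebesgue)))" for k z
    proof -
      let ?Q = "grid_cube k z :: (real^'n) set"
      define y1 where "y1 = epowr (ennreal (V k)) (1 / P) * emean ?Q (h1 k)"
      define y2 where "y2 = epowr (ennreal (V k)) (1 / P) * emean ?Q (h2 k)"
      have "epowr (emean ?Q (h1 k)) P \<le> emean ?Q (\<lambda>x. epowr (h1 k x) P)" using P by (intro emean_jensen) auto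
      also have "\<dots> \<le> emean ?Q (\<lambda>x. epowr (h x) P)"
        using P by (intro emean_mono_AE) (auto simp: h1_def indicator_def)
      also have "\<dots> = ennreal (1 / V k) * (\<integral>\<^sup>+x\<in>?Q. epowr (h x) P \<partial>lebesgue)" by (rule emean_eq)
      also have "(\<integral>\<^sup>+x\<in>?Q. epowr (h x) P \<partial>lebesgue) \<le> (\<integral>\<^sup>+x. epowr (h x) P \<partial>lebesgue)"
        by (intro nn_integral_mono) (auto simp: indicator_def)
      also have "\<dots> \<le> 1" by (rule norm)
      finally have le: "epowr (emean ?Q (h1 k)) P \<le> ennreal (1 / V k)" by (simp add: mult_left_mono)
      have "epowr y1 P = ennreal (V k) * epowr (emean ?Q (h1 k)) P"
        using P V by (simp add: y1_def epowr_mult epowr_epowr)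
      also have "\<dots> \<le> ennreal (V k) * ennreal (1 / V k)" by (intro mult_left_mono le) auto
      also have "\<dots> = 1" using V(1)[of k] by (simp add: ennreal_mult'[symmetric])
      finally have "y1 \<le> 1" using P epowr_le_swap[of P y1 1] by simp
      \<comment> \<open>As \<open>y1\<close> is at most 1 and R >= 1, its R-th power is at most
        \<open>y1\<close>; the high part thus enters linearly.\<close>
      then have "epowr y1 (1 + (R - 1)) \<le> y1 * 1"
        using P mult_left_mono[of "epowr y1 (R - 1)" 1 y1] epowr_mono[of "R - 1" y1 1] by (subst epowr_add) auto
      then have "epowr y1 R \<le> y1" by simp
      also have "y1 = epowr (ennreal (V k)) (1 / P) * (ennreal (1 / V k) * (\<integral>\<^sup>+x\<in>?Q. h1 k x \<partial>lebesgue))"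
        unfolding y1_def emean_eq ..
      also have "\<dots> = ennreal (V k powr (1 / P - 1)) * (\<integral>\<^sup>+x\<in>?Q. h1 k x \<partial>lebesgue)"
        using V(1)[of k] by (simp add: epowr_ennreal_pos mult.assoc[symmetric] ennreal_mult'[symmetric] powr_diff)
      also have "V k powr (1 / P - 1) \<le> 2 powr (- a * real_of_int k)"
      proof -
        have "V k powr (1 / P - 1) = (3 ^ CARD('n)) powr (1 / P - 1) * 2 powr (n * real_of_int k * (1 / P - 1))"
          by (simp add: V_def powr_mult powr_powr)
        also have "\<dots> \<le> 1 * 2 powr (n * real_of_int k * (1 / P - 1))"
        proof (intro mult_right_mono)
          have "(3 ^ CARD('n)) powr (1 / P - 1) \<le> (1::real) powr (1 / P - 1)"
            using P by (intro powr_mono2') (auto simp: field_simps)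
          then show "(3 ^ CARD('n)) powr (1 / P - 1) \<le> (1::real)" by simp
        qed simp
        also have "n * real_of_int k * (1 / P - 1) = - a * real_of_int k" by (simp add: a_def algebra_simps)
        finally show ?thesis by simp
      qed
      finally have y1: "epowr y1 R \<le> ennreal (2 powr (- a * real_of_int k)) * (\<integral>\<^sup>+x\<in>?Q. h1 k x \<partial>lebesgue)"
        by (auto simp: mult_right_mono ennreal_leI)
      have "epowr y2 R = epowr (ennreal (V k)) (R / P) * epowr (emean ?Q (h2 k)) R"
        using P V by (simp add: y2_def epowr_mult epowr_epowr)
      also have "\<dots> \<le> epowr (ennreal (V k)) (R / P) * emean ?Q (\<lambda>x. epowr (h2 k x) R)"
        using P by (intro mult_left_mono emean_jensen) auto
      also have "\<dots> = ennreal (V k powr (R / P - 1)) * (\<integral>\<^sup>+x\<in>?Q. epowr (h2 k x) R \<partial>lebesgue)"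
        unfolding emean_eq using V(1)[of k] by (simp add: epowr_ennreal_pos mult.assoc[symmetric] ennreal_mult'[symmetric] powr_diff)
      also have "V k powr (R / P - 1) = c3 * 2 powr (b * real_of_int k)"
        by (simp add: V_def powr_mult powr_powr c3_def b_def ac_simps)
      finally have y2: "epowr y2 R \<le> ennreal c3 * (ennreal (2 powr (b * real_of_int k)) * (\<integral>\<^sup>+x\<in>?Q. epowr (h2 k x) R \<partial>lebesgue))"
        by (simp add: ennreal_mult' c3_def mult.assoc)
      have "emean ?Q h = emean ?Q (h1 k) + emean ?Q (h2 k)"
        using emean_add[of "h1 k" "h2 k" ?Q] by (simp add: h12[of _ k, symmetric])
      then have "epowr (ennreal (V k)) (1 / P) * emean ?Q h = y1 + y2" by (simp add: y1_def y2_def distrib_left)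
      then have "epowr (epowr (ennreal (V k)) (1 / P) * emean ?Q h) R \<le> ennreal (2 powr R) * (epowr y1 R + epowr y2 R)"
        using P by (simp add: epowr_add_le)
      also have "\<dots> \<le> ennreal (2 powr R) * (ennreal (2 powr (- a * real_of_int k)) * (\<integral>\<^sup>+x\<in>?Q. h1 k x \<partial>lebesgue)
        + ennreal c3 * (ennreal (2 powr (b * real_of_int k)) * (\<integral>\<^sup>+x\<in>?Q. epowr (h2 k x) R \<partial>lebesgue)))"
        by (intro mult_left_mono add_mono y1 y2) auto
      finally show ?thesis .
    qed
    have sum1: "(\<integral>\<^sup>+k. \<integral>\<^sup>+z. ennreal (2 powr (- a * real_of_int k)) * (\<integral>\<^sup>+x\<in>grid_cube k z. h1 k x \<partial>lebesgue) \<partial>count_space UNIV \<partial>count_space UNIV)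
      \<le> 4 ^ CARD('n) * ennreal (1 / (1 - 2 powr (- a)))"
    proof -
      have "(\<integral>\<^sup>+k. \<integral>\<^sup>+z. ennreal (2 powr (- a * real_of_int k)) * (\<integral>\<^sup>+x\<in>grid_cube k z. h1 k x \<partial>lebesgue) \<partial>count_space UNIV \<partial>count_space UNIV)
        = (\<integral>\<^sup>+k. ennreal (2 powr (- a * real_of_int k)) * (\<integral>\<^sup>+z. (\<integral>\<^sup>+x\<in>grid_cube k z. h1 k x \<partial>lebesgue) \<partial>count_space UNIV) \<partial>count_space UNIV)"
        by (intro nn_integral_cong nn_integral_cmult) auto
      also have "\<dots> \<le> (\<integral>\<^sup>+k. ennreal (2 powr (- a * real_of_int k)) * (4 ^ CARD('n) * (\<integral>\<^sup>+x. h1 k x \<partial>lebesgue)) \<partial>count_space UNIV)"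
        by (intro nn_integral_mono mult_left_mono grid_cube_overlap_integral) auto
      also have "\<dots> = (\<integral>\<^sup>+k. 4 ^ CARD('n) * (\<integral>\<^sup>+x. ennreal (2 powr (- a * real_of_int k)) * h1 k x \<partial>lebesgue) \<partial>count_space UNIV)"
        by (simp only: nn_integral_cmult[OF h1m] mult.left_commute)
      also have "\<dots> = 4 ^ CARD('n) * (\<integral>\<^sup>+k. \<integral>\<^sup>+x. ennreal (2 powr (- a * real_of_int k)) * h1 k x \<partial>lebesgue \<partial>count_space UNIV)"
        by (intro nn_integral_cmult) auto
      also have "(\<integral>\<^sup>+k. \<integral>\<^sup>+x. ennreal (2 powr (- a * real_of_int k)) * h1 k x \<partial>lebesgue \<partial>count_space UNIV)
        = (\<integral>\<^sup>+x. \<integral>\<^sup>+k. ennreal (2 powr (- a * real_of_int k)) * h1 k x \<partial>count_space UNIV \<partial>lebesgue)"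
        by (intro nn_integral_count_space_nn_integral[symmetric]) auto
      also have "\<dots> \<le> (\<integral>\<^sup>+x. ennreal (1 / (1 - 2 powr (- a))) * epowr (h x) P \<partial>lebesgue)"
        unfolding h1_def t_def a_def using n P by (intro nn_integral_mono level_sum_above)
      also have "\<dots> = ennreal (1 / (1 - 2 powr (- a))) * (\<integral>\<^sup>+x. epowr (h x) P \<partial>lebesgue)" by (intro nn_integral_cmult) auto
      also have "\<dots> \<le> ennreal (1 / (1 - 2 powr (- a)))" using mult_left_mono[OF norm] by simp
      finally show ?thesis by (simp add: mult_left_mono)
    qed
    have sum2: "(\<integral>\<^sup>+k. \<integral>\<^sup>+z. ennreal (2 powr (b * real_of_int k)) * (\<integral>\<^sup>+x\<in>grid_cube k z. epowr (h2 k x) R \<partial>lebesgue) \<partial>count_space UNIV \<partial>count_space UNIV)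
      \<le> 4 ^ CARD('n) * ennreal (1 / (1 - 2 powr (- b)))"
    proof -
      have "(\<integral>\<^sup>+k. \<integral>\<^sup>+z. ennreal (2 powr (b * real_of_int k)) * (\<integral>\<^sup>+x\<in>grid_cube k z. epowr (h2 k x) R \<partial>lebesgue) \<partial>count_space UNIV \<partial>count_space UNIV)
        = (\<integral>\<^sup>+k. ennreal (2 powr (b * real_of_int k)) * (\<integral>\<^sup>+z. (\<integral>\<^sup>+x\<in>grid_cube k z. epowr (h2 k x) R \<partial>lebesgue) \<partial>count_space UNIV) \<partial>count_space UNIV)"
        by (intro nn_integral_cong nn_integral_cmult) auto
      also have "\<dots> \<le> (\<integral>\<^sup>+k. ennreal (2 powr (b * real_of_int k)) * (4 ^ CARD('n) * (\<integral>\<^sup>+x. epowr (h2 k x) R \<partial>lebesgue)) \<partial>count_space UNIV)"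
        by (intro nn_integral_mono mult_left_mono grid_cube_overlap_integral) auto
      also have "\<dots> = (\<integral>\<^sup>+k. 4 ^ CARD('n) * (\<integral>\<^sup>+x. ennreal (2 powr (b * real_of_int k)) * epowr (h2 k x) R \<partial>lebesgue) \<partial>count_space UNIV)"
        by (simp only: nn_integral_cmult[OF measurable_epowr[OF h2m]] mult.left_commute)
      also have "\<dots> = 4 ^ CARD('n) * (\<integral>\<^sup>+k. \<integral>\<^sup>+x. ennreal (2 powr (b * real_of_int k)) * epowr (h2 k x) R \<partial>lebesgue \<partial>count_space UNIV)"
        by (intro nn_integral_cmult) auto
      also have "(\<integral>\<^sup>+k. \<integral>\<^sup>+x. ennreal (2 powr (b * real_of_int k)) * epowr (h2 k x) R \<partial>lebesgue \<partial>count_space UNIV)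
        = (\<integral>\<^sup>+x. \<integral>\<^sup>+k. ennreal (2 powr (b * real_of_int k)) * epowr (h2 k x) R \<partial>count_space UNIV \<partial>lebesgue)"
        by (intro nn_integral_count_space_nn_integral[symmetric]) auto
      also have "\<dots> \<le> (\<integral>\<^sup>+x. ennreal (1 / (1 - 2 powr (- b))) * epowr (h x) P \<partial>lebesgue)"
        unfolding h2_def t_def b_def using n P by (intro nn_integral_mono level_sum_below) auto
      also have "\<dots> = ennreal (1 / (1 - 2 powr (- b))) * (\<integral>\<^sup>+x. epowr (h x) P \<partial>lebesgue)" by (intro nn_integral_cmult) auto
      also have "\<dots> \<le> ennreal (1 / (1 - 2 powr (- b)))" using mult_left_mono[OF norm] by simp
      finally show ?thesis by (simp add: mult_left_mono)
    qed
    have "(\<integral>\<^sup>+k. \<integral>\<^sup>+z. epowr (epowr (emeasure lebesgue (grid_cube k z :: (real^'n) set)) (1 / P) * emean (grid_cube k z) h) R \<partial>count_space UNIV \<partial>count_space UNIV)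
      \<le> (\<integral>\<^sup>+k. \<integral>\<^sup>+z. ennreal (2 powr R) * (ennreal (2 powr (- a * real_of_int k)) * (\<integral>\<^sup>+x\<in>grid_cube k z. h1 k x \<partial>lebesgue)
        + ennreal c3 * (ennreal (2 powr (b * real_of_int k)) * (\<integral>\<^sup>+x\<in>grid_cube k z. epowr (h2 k x) R \<partial>lebesgue))) \<partial>count_space UNIV \<partial>count_space UNIV)"
      unfolding V(2) by (intro nn_integral_mono term_le)
    also have "\<dots> = ennreal (2 powr R) * ((\<integral>\<^sup>+k. \<integral>\<^sup>+z. ennreal (2 powr (- a * real_of_int k)) * (\<integral>\<^sup>+x\<in>grid_cube k z. h1 k x \<partial>lebesgue) \<partial>count_space UNIV \<partial>count_space UNIV)
       + ennreal c3 * (\<integral>\<^sup>+k. \<integral>\<^sup>+z. ennreal (2 powr (b * real_of_int k)) * (\<integral>\<^sup>+x\<in>grid_cube k z. epowr (h2 k x) R \<partial>lebesgue) \<partial>count_space UNIV \<partial>count_space UNIV))"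
      by (simp add: nn_integral_cmult nn_integral_add)
    also have "\<dots> \<le> ennreal (2 powr R) * (4 ^ CARD('n) * ennreal (1 / (1 - 2 powr (- a))) + ennreal c3 * (4 ^ CARD('n) * ennreal (1 / (1 - 2 powr (- b)))))"
      by (intro mult_left_mono add_mono sum1 sum2) auto
    also have "\<dots> = ennreal C"
    proof -
      have "(4 ^ CARD('n) :: ennreal) = ennreal (4 ^ CARD('n))" by (simp add: ennreal_power[symmetric])
      moreover have "0 \<le> c3" by (simp add: c3_def)
      ultimately show ?thesis unfolding C_def using r
        by (simp add: ennreal_mult' ennreal_plus del: times_divide_eq_right times_divide_eq_left)
    qed
    finally show "(\<integral>\<^sup>+k. \<integral>\<^sup>+z. epowr (epowr (emeasure lebesgue (grid_cube k z :: (real^'n) set)) (1 / P) * emean (grid_cube k z) h) R \<partial>count_space UNIV \<partial>count_space UNIV) \<le> ennreal C" .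
  qed
qed

text \<open>Homogeneity: both sides scale with the R-th power of a scalar, so \<open>h\<close> is
  divided by its L^P norm. Norm 0, where \<open>h\<close> vanishes almost everywhere, and norm top
  stand apart.\<close>

lemma grid_sum:
  fixes P R :: real
  assumes P: "1 < P" "P < R"
  obtains C :: real where "0 < C"
    "\<And>h. h \<in> borel_measurable lebesgue \<Longrightarrow>
      (\<integral>\<^sup>+k. \<integral>\<^sup>+z. epowr (epowr (emeasure lebesgue (grid_cube k z :: (real^'n) set)) (1 / P) * emean (grid_cube k z) h) R \<partial>count_space UNIV \<partial>count_space UNIV)
      \<le> ennreal C * epowr (\<integral>\<^sup>+x. epowr (h x) P \<partial>lebesgue) (R / P)"
proof -
  note [simp del] = emeasure_completion measure_completion
  obtain C where C: "0 < C"
    "\<And>h. h \<in> borel_measurable lebesgue \<Longrightarrow> (\<integral>\<^sup>+x. epowr (h x) P \<partial>lebesgue) \<le> 1 \<Longrightarrow>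
      (\<integral>\<^sup>+k. \<integral>\<^sup>+z. epowr (epowr (emeasure lebesgue (grid_cube k z :: (real^'n) set)) (1 / P) * emean (grid_cube k z) h) R \<partial>count_space UNIV \<partial>count_space UNIV) \<le> ennreal C"
    by (rule grid_sum_normalized[OF P], rule that) (assumption | blast)+
  show thesis
  proof (rule that[OF C(1)])
    fix h :: "real^'n \<Rightarrow> ennreal" assume [measurable]: "h \<in> borel_measurable lebesgue"
    define N where "N = (\<integral>\<^sup>+x. epowr (h x) P \<partial>lebesgue)"
    consider "N = 0" | "N = top" | "N \<noteq> 0" "N < top" by (cases "N = top") (auto simp: less_top)
    then show "(\<integral>\<^sup>+k. \<integral>\<^sup>+z. epowr (epowr (emeasure lebesgue (grid_cube k z :: (real^'n) set)) (1 / P) * emean (grid_cube k z) h) R \<partial>count_space UNIV \<partial>count_space UNIV)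
      \<le> ennreal C * epowr (\<integral>\<^sup>+x. epowr (h x) P \<partial>lebesgue) (R / P)"
    proof cases
      case 1
      then have "AE x in lebesgue. epowr (h x) P = 0" unfolding N_def by (subst (asm) nn_integral_0_iff_AE) auto
      then have "AE x in lebesgue. h x = 0" by eventually_elim (use P in \<open>simp add: epowr_eq_0_iff\<close>)
      then have "(\<integral>\<^sup>+x\<in>Q. h x \<partial>lebesgue) = 0" for Q
        by (subst nn_integral_cong_AE[where v = "\<lambda>_. 0"]) (auto elim!: eventually_mono)
      then have "emean Q h = 0" for Q by (simp add: emean_def)
      then show ?thesis using P by simp
    next
      case 2
      then have "ennreal C * epowr N (R / P) = top" using C(1) P by (simp add: ennreal_mult_top)
      then show ?thesis by (simp add: N_def)
    next
      case 3
      define c where "c = epowr N (1 / P)"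
      have c: "c \<noteq> 0" "c < top" "epowr c P = N" "epowr c R = epowr N (R / P)"
        using 3 P by (auto simp: c_def epowr_eq_0_iff epowr_less_top epowr_epowr)
      define g where "g x = h x / c" for x
      have [measurable]: "g \<in> borel_measurable lebesgue" unfolding g_def by measurable
      have h: "h x = c * g x" for x using c unfolding g_def
        by (simp add: ennreal_times_divide mult.commute[of c] mult_divide_eq_ennreal)
      have "(\<integral>\<^sup>+x. epowr (g x) P \<partial>lebesgue) = (\<integral>\<^sup>+x. epowr (h x) P / N \<partial>lebesgue)"
        using P unfolding g_def c(3)[symmetric] by (simp add: epowr_divide)
      also have "\<dots> = N / N" by (subst nn_integral_divide) (auto simp: N_def)
      also have "\<dots> = 1" using 3 by simp
      finally have g: "(\<integral>\<^sup>+x. epowr (g x) P \<partial>lebesgue) \<le> 1" by simp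
      have "emean (grid_cube k z) h = c * emean (grid_cube k z) g" for k z
        unfolding h by (intro emean_cmult) auto
      then have "(\<integral>\<^sup>+k. \<integral>\<^sup>+z. epowr (epowr (emeasure lebesgue (grid_cube k z :: (real^'n) set)) (1 / P) * emean (grid_cube k z) h) R \<partial>count_space UNIV \<partial>count_space UNIV)
        = (\<integral>\<^sup>+k. \<integral>\<^sup>+z. epowr c R * epowr (epowr (emeasure lebesgue (grid_cube k z :: (real^'n) set)) (1 / P) * emean (grid_cube k z) g) R \<partial>count_space UNIV \<partial>count_space UNIV)"
        using P by (simp add: epowr_mult ac_simps)
      also have "\<dots> = epowr c R * (\<integral>\<^sup>+k. \<integral>\<^sup>+z. epowr (epowr (emeasure lebesgue (grid_cube k z :: (real^'n) set)) (1 / P) * emean (grid_cube k z) g) R \<partial>count_space UNIV \<partial>count_space UNIV)"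
        by (simp add: nn_integral_cmult)
      also have "\<dots> \<le> epowr c R * ennreal C" by (intro mult_left_mono C(2) g) auto
      finally show ?thesis unfolding c(4) N_def by (simp add: mult.commute)
    qed
  qed
qed

subsection \<open>Averages of functions against weights and oscillations\<close>

text \<open>The supremum in \<open>ess_inf_on\<close> runs over possibly uncountably many bounds
  valid almost everywhere. It is already the supremum of a sequence of them, and countably many null
  sets may be united.\<close>

lemma AE_ess_inf_on_le:
  "AE x in lebesgue. x \<in> Q \<longrightarrow> ess_inf_on Q g \<le> g x"
proof -
  define S where "S = {c. AE x in lebesgue. x \<in> Q \<longrightarrow> c \<le> g x}"
  have "0 \<in> S" by (simp add: S_def)
  then obtain c :: "nat \<Rightarrow> ennreal" where c: "range c \<subseteq> S" "Sup S = (SUP i. c i)"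
    using ennreal_Sup_countable_SUP[of S] by auto
  have "AE x in lebesgue. \<forall>i. x \<in> Q \<longrightarrow> c i \<le> g x"
    using c(1) by (subst AE_all_countable) (auto simp: S_def)
  then show ?thesis
    unfolding ess_inf_on_def S_def[symmetric] c(2) by eventually_elim (auto intro: SUP_least)
qed

text \<open>For p > 1 write F^s = (F \<omega>)^s * \<omega>^(-s) and apply Hoelder with u = t / s
  and v = r p' / s: then (\<omega>^(-s))^v = (\<omega>^r)^(-p') is the integrand of the dual factor,
  and the relation for 1 / t says that 1 / u + 1 / v = 1. For p = 1 the relation gives t = s, and
  the essential infimum is taken out of the average.\<close>

lemma dual_factor_holder:
  fixes \<omega> :: "real^'n \<Rightarrow> real" and F :: "real^'n \<Rightarrow> ennreal"
  assumes [measurable]: "\<omega> \<in> borel_measurable lebesgue" "F \<in> borel_measurable lebesgue"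
    and pos: "AE x in lebesgue. 0 < \<omega> x" and Q: "Q \<in> cubes"
    and p: "1 \<le> p" and r: "0 < r" and s: "0 < s" and t: "0 < t" "1 / t = 1 / s - 1 / r + 1 / (r * p)"
  shows "epowr (emean Q (\<lambda>x. epowr (F x) s)) (1 / s)
    \<le> epowr (dual_factor p (\<lambda>x. \<omega> x powr r) Q) (1 / r) * epowr (emean Q (\<lambda>x. epowr (F x * ennreal (\<omega> x)) t)) (1 / t)"
proof (cases "p = 1")
  case True
  note [measurable] = sets_cubes[OF Q]
  have "t = s" using t s True by simp
  define E where "E = ess_inf_on Q (\<lambda>x. ennreal (\<omega> x powr r))"
  define c where "c = epowr (inverse E) (1 / r)"
  have "AE x in lebesgue. x \<in> Q \<longrightarrow> epowr (F x) s \<le> epowr c s * epowr (F x * ennreal (\<omega> x)) s"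
    using AE_ess_inf_on_le[of Q "\<lambda>x. ennreal (\<omega> x powr r)"] pos
  proof eventually_elim
    case (elim x)
    \<comment> \<open>If the essential infimum \<open>E\<close> is 0, then \<open>c\<close> is top
      and the bound survives because \<omega> x is positive; a zero of \<open>F x\<close> is
      absorbed by 0 * top = 0.\<close>
    have "F x \<le> c * (F x * ennreal (\<omega> x))" if "x \<in> Q"
    proof (cases "E = 0")
      case True
      then have "c = top" using r by (simp add: c_def)
      then show ?thesis using elim(2) by (cases "F x = 0") (auto simp: ennreal_top_mult ennreal_eq_0_iff)
    next
      case False
      have "E \<le> ennreal (\<omega> x powr r)" using elim(1) that by (simp add: E_def)
      then obtain e where e: "E = ennreal e" "0 < e" "e \<le> \<omega> x powr r"
        using False by (cases E) (auto simp: top_unique less_le)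
      have "e powr (1 / r) \<le> (\<omega> x powr r) powr (1 / r)" using e r by (intro powr_mono2) auto
      then have "e powr (1 / r) \<le> \<omega> x" using elim(2) r by (simp add: powr_powr)
      then have "1 \<le> e powr (- (1 / r)) * \<omega> x" using e(2) by (simp add: powr_minus field_simps)
      then have "1 \<le> c * ennreal (\<omega> x)"
        using e(2) by (simp add: c_def e(1) inverse_ennreal epowr_ennreal_pos ennreal_mult'[symmetric] powr_minus inverse_powr)
      then have "F x * 1 \<le> F x * (c * ennreal (\<omega> x))" by (intro mult_left_mono) auto
      then show ?thesis by (simp add: ac_simps)
    qed
    then show ?case using s by (auto simp: epowr_mult[symmetric] intro: epowr_mono)
  qed
  then have "emean Q (\<lambda>x. epowr (F x) s) \<le> emean Q (\<lambda>x. epowr c s * epowr (F x * ennreal (\<omega> x)) s)"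
    by (rule emean_mono_AE)
  also have "\<dots> = epowr c s * emean Q (\<lambda>x. epowr (F x * ennreal (\<omega> x)) s)"
    by (intro emean_cmult) measurable
  finally have "epowr (emean Q (\<lambda>x. epowr (F x) s)) (1 / s) \<le> epowr (epowr c s * emean Q (\<lambda>x. epowr (F x * ennreal (\<omega> x)) s)) (1 / s)"
    using s by (intro epowr_mono) auto
  also have "\<dots> = c * epowr (emean Q (\<lambda>x. epowr (F x * ennreal (\<omega> x)) s)) (1 / s)"
    using s by (simp add: epowr_mult epowr_epowr)
  finally show ?thesis by (simp add: c_def E_def dual_factor_def True \<open>t = s\<close>)
next
  case False
  define p' where "p' = conj_exponent p"
  have p': "0 < p'" "1 / p' = 1 - 1 / p" using p False by (auto simp: p'_def conj_exponent_def field_simps)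
  define u v where "u = t / s" and "v = r * p' / s"
  have uv: "0 < u" "0 < v" using t s r p' by (auto simp: u_def v_def)
  have "1 / u + 1 / v = s * (1 / t + (1 / r) * (1 / p'))" using t s r p' by (simp add: u_def v_def field_simps)
  also have "\<dots> = s * (1 / s - 1 / r + 1 / (r * p) + (1 / r) * (1 - 1 / p))" unfolding t(2) p'(2) ..
  also have "\<dots> = 1" using s by (simp add: algebra_simps)
  finally have uv1: "1 / u + 1 / v = 1" .
  define g where "g x = epowr (ennreal (\<omega> x)) (- s)" for x
  have [measurable]: "g \<in> borel_measurable lebesgue" unfolding g_def by measurable
  have gv: "emean Q (\<lambda>x. epowr (g x) v) \<le> emean Q (\<lambda>x. epowr (ennreal (\<omega> x powr r)) (- p'))"
  proof (rule emean_mono_AE, use pos in eventually_elim)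
    fix x assume x: "0 < \<omega> x"
    then show "x \<in> Q \<longrightarrow> epowr (g x) v \<le> epowr (ennreal (\<omega> x powr r)) (- p')"
      using s by (simp add: g_def epowr_ennreal_pos powr_powr v_def)
  qed
  have "emean Q (\<lambda>x. epowr (F x) s) \<le> emean Q (\<lambda>x. epowr (F x * ennreal (\<omega> x)) s * g x)"
  proof (rule emean_mono_AE, use pos in eventually_elim)
    fix x assume x: "0 < \<omega> x"
    have "epowr (ennreal (\<omega> x)) s * g x = 1"
      using x by (simp add: g_def epowr_ennreal_pos ennreal_mult'[symmetric] powr_add[symmetric])
    then have "epowr (F x * ennreal (\<omega> x)) s * g x = epowr (F x) s" using s by (simp add: epowr_mult mult.assoc)
    then show "x \<in> Q \<longrightarrow> epowr (F x) s \<le> epowr (F x * ennreal (\<omega> x)) s * g x" by simp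
  qed
  also have "\<dots> \<le> epowr (emean Q (\<lambda>x. epowr (epowr (F x * ennreal (\<omega> x)) s) u)) (1 / u) * epowr (emean Q (\<lambda>x. epowr (g x) v)) (1 / v)"
    by (rule emean_holder2'[OF uv uv1 Q]) measurable
  also have "\<dots> = epowr (emean Q (\<lambda>x. epowr (F x * ennreal (\<omega> x)) t)) (1 / u) * epowr (emean Q (\<lambda>x. epowr (g x) v)) (1 / v)"
    using s by (simp add: epowr_epowr u_def)
  also have "\<dots> \<le> epowr (emean Q (\<lambda>x. epowr (F x * ennreal (\<omega> x)) t)) (1 / u) * epowr (emean Q (\<lambda>x. epowr (ennreal (\<omega> x powr r)) (- p'))) (1 / v)"
    using uv by (intro mult_left_mono epowr_mono gv) auto
  finally have "epowr (emean Q (\<lambda>x. epowr (F x) s)) (1 / s)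
    \<le> epowr (epowr (emean Q (\<lambda>x. epowr (F x * ennreal (\<omega> x)) t)) (1 / u) * epowr (emean Q (\<lambda>x. epowr (ennreal (\<omega> x powr r)) (- p'))) (1 / v)) (1 / s)"
    using s by (intro epowr_mono) auto
  also have "\<dots> = epowr (emean Q (\<lambda>x. epowr (F x * ennreal (\<omega> x)) t)) (1 / t) * epowr (emean Q (\<lambda>x. epowr (ennreal (\<omega> x powr r)) (- p'))) (1 / (r * p'))"
    using s t(1) r p'(1) by (simp add: epowr_mult epowr_epowr u_def v_def)
  also have "epowr (emean Q (\<lambda>x. epowr (ennreal (\<omega> x powr r)) (- p'))) (1 / (r * p')) = epowr (dual_factor p (\<lambda>x. \<omega> x powr r) Q) (1 / r)"
    using False p'(1) by (simp add: dual_factor_def p'_def[symmetric] epowr_epowr mult.commute)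
  finally show ?thesis by (simp add: mult.commute)
qed

text \<open>Later \<open>c\<close> is b_j(x) and \<open>F\<close> is the modulus of f_j. The
  deviation of \<open>c\<close> from the mean leaves the average, while that of \<open>b y\<close>
  is split off by Hoelder with s and its conjugate exponent and bounded by John-Nirenberg. This is
  where the average of \<open>F\<close> is raised from exponent 1 to s.\<close>

lemma emean_bmo_mult:
  assumes s: "1 < s"
  obtains C :: ennreal where "C < top"
    "\<And>(b :: real^'n \<Rightarrow> complex) Q F c. b \<in> BMO \<Longrightarrow> Q \<in> cubes \<Longrightarrow> F \<in> borel_measurable lebesgue \<Longrightarrow>
      emean Q (\<lambda>y. ennreal (norm (c - b y)) * F y)
      \<le> (ennreal (norm (c - mean Q b)) + C * bmo_norm b) * epowr (emean Q (\<lambda>y. epowr (F y) s)) (1 / s)"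
proof -
  define s' where "s' = s / (s - 1)"
  have s': "0 < s'" "1 / s' + 1 / s = 1" using s by (auto simp: s'_def field_simps)
  obtain K :: real where K: "0 < K" "\<And>(b :: real^'n \<Rightarrow> complex) Q. b \<in> BMO \<Longrightarrow> Q \<in> cubes \<Longrightarrow>
      emean Q (\<lambda>x. epowr (ennreal (norm (b x - mean Q b))) s') \<le> ennreal K * epowr (bmo_norm b) s'"
    by (rule john_nirenberg[OF s'(1)], rule that) (assumption | blast)+
  define C where "C = epowr (ennreal K) (1 / s')"
  have "C < top" using s' by (simp add: C_def epowr_less_top)
  then show thesis
  proof (rule that)
    fix b :: "real^'n \<Rightarrow> complex" and Q :: "(real^'n) set" and F :: "real^'n \<Rightarrow> ennreal" and c
    assume b: "b \<in> BMO" and Q: "Q \<in> cubes" and Fm [measurable]: "F \<in> borel_measurable lebesgue"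
    have [measurable]: "b \<in> borel_measurable lebesgue" using b by (intro locally_integrable_measurable) (simp add: BMO_def)
    note [measurable] = sets_cubes[OF Q]
    let ?M = "epowr (emean Q (\<lambda>y. epowr (F y) s)) (1 / s)"
    have "emean Q (\<lambda>y. ennreal (norm (c - b y)) * F y)
      \<le> emean Q (\<lambda>y. ennreal (norm (c - mean Q b)) * F y + ennreal (norm (b y - mean Q b)) * F y)"
    proof (rule emean_mono_AE, intro AE_I2 impI)
      fix y
      have "norm (c - b y) \<le> norm (c - mean Q b) + norm (b y - mean Q b)"
        using norm_triangle_ineq4[of "c - mean Q b" "b y - mean Q b"] by simp
      then have "ennreal (norm (c - b y)) \<le> ennreal (norm (c - mean Q b)) + ennreal (norm (b y - mean Q b))"
        by (simp add: ennreal_leI flip: ennreal_plus)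
      then show "ennreal (norm (c - b y)) * F y \<le> ennreal (norm (c - mean Q b)) * F y + ennreal (norm (b y - mean Q b)) * F y"
        unfolding distrib_right[symmetric] by (intro mult_right_mono) auto
    qed
    also have "\<dots> = ennreal (norm (c - mean Q b)) * emean Q F + emean Q (\<lambda>y. ennreal (norm (b y - mean Q b)) * F y)"
      by (subst emean_add, measurable, subst emean_cmult, measurable)
    also have "emean Q (\<lambda>y. ennreal (norm (b y - mean Q b)) * F y)
      \<le> epowr (emean Q (\<lambda>y. epowr (ennreal (norm (b y - mean Q b))) s')) (1 / s') * ?M"
      using s by (intro emean_holder2' s' Q) auto
    also have "epowr (emean Q (\<lambda>y. epowr (ennreal (norm (b y - mean Q b))) s')) (1 / s') \<le> epowr (ennreal K * epowr (bmo_norm b) s') (1 / s')"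
      using s' by (intro epowr_mono K b Q) auto
    also have "\<dots> = C * bmo_norm b" using s' by (simp add: C_def epowr_mult epowr_epowr)
    also have "emean Q F \<le> ?M" using s by (subst epowr_le_swap[symmetric]) (auto intro!: emean_jensen Q)
    finally show "emean Q (\<lambda>y. ennreal (norm (c - b y)) * F y) \<le> (ennreal (norm (c - mean Q b)) + C * bmo_norm b) * ?M"
      by (auto simp: distrib_right mult_left_mono mult_right_mono add_mono)
  qed
qed

lemma emean_holder:
  fixes f :: "'i \<Rightarrow> real^'n \<Rightarrow> ennreal"
  assumes "finite I" "\<And>i. i \<in> I \<Longrightarrow> 0 < \<theta> i" "(\<Sum>i\<in>I. \<theta> i) = 1" and Q: "Q \<in> cubes"
    and [measurable]: "\<And>i. i \<in> I \<Longrightarrow> f i \<in> borel_measurable lebesgue"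
  shows "emean Q (\<lambda>x. \<Prod>i\<in>I. epowr (f i x) (\<theta> i)) \<le> (\<Prod>i\<in>I. epowr (emean Q (f i)) (\<theta> i))"
proof -
  note [measurable] = sets_cubes[OF Q]
  have "(\<integral>\<^sup>+x. (\<Prod>i\<in>I. epowr (f i x) (\<theta> i)) \<partial>uniform_measure lebesgue Q)
    \<le> (\<Prod>i\<in>I. epowr (\<integral>\<^sup>+x. f i x \<partial>uniform_measure lebesgue Q) (\<theta> i))"
    by (rule nn_integral_holder[OF assms(1-3)]) simp_all
  then show ?thesis by (simp add: emean_uniform_measure[symmetric] cong: prod.cong)
qed

text \<open>Hoelder with equal exponents 1 / m reduces to single oscillations at the power \<kappa>
  m, where John-Nirenberg applies as at any positive power. The summand with \<open>D\<close> only
  enlarges the constant.\<close>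

lemma emean_bmo_prod:
  assumes \<kappa>: "0 < \<kappa>" and D: "D < top"
  obtains C :: ennreal where "C < top"
    "\<And>(b :: 'm::finite \<Rightarrow> real^'n \<Rightarrow> complex) Q. (\<And>j. b j \<in> BMO) \<Longrightarrow> Q \<in> cubes \<Longrightarrow>
      emean Q (\<lambda>x. epowr (\<Prod>j\<in>UNIV. ennreal (norm (b j x - mean Q (b j))) + D * bmo_norm (b j)) \<kappa>)
      \<le> C * epowr (\<Prod>j\<in>UNIV. bmo_norm (b j)) \<kappa>"
proof -
  define m where "m = real CARD('m)"
  have m: "0 < m" by (simp add: m_def)
  obtain K :: real where K: "0 < K" "\<And>(b :: real^'n \<Rightarrow> complex) Q. b \<in> BMO \<Longrightarrow> Q \<in> cubes \<Longrightarrow>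
      emean Q (\<lambda>x. epowr (ennreal (norm (b x - mean Q b))) (\<kappa> * m)) \<le> ennreal K * epowr (bmo_norm b) (\<kappa> * m)"
    by (rule john_nirenberg[of "\<kappa> * m"], use \<kappa> m in simp, rule that) (assumption | blast)+
  define c where "c = ennreal (2 powr (\<kappa> * m)) * (ennreal K + epowr D (\<kappa> * m))"
  define C where "C = (\<Prod>j\<in>(UNIV :: 'm set). epowr c (1 / m))"
  have "c < top" using \<kappa> m D by (simp add: c_def ennreal_mult_less_top epowr_less_top)
  then have "C < top" unfolding C_def using m by (simp add: power_less_top_ennreal epowr_less_top)
  then show thesis
  proof (rule that)
    fix b :: "'m \<Rightarrow> real^'n \<Rightarrow> complex" and Q :: "(real^'n) set"
    assume b: "\<And>j. b j \<in> BMO" and Q: "Q \<in> cubes"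
    have [measurable]: "b j \<in> borel_measurable lebesgue" for j using b[of j] by (intro locally_integrable_measurable) (simp add: BMO_def)
    note [measurable] = sets_cubes[OF Q]
    define g where "g j x = ennreal (norm (b j x - mean Q (b j))) + D * bmo_norm (b j)" for j x
    have [measurable]: "g j \<in> borel_measurable lebesgue" for j unfolding g_def by measurable
    have gj: "emean Q (\<lambda>x. epowr (g j x) (\<kappa> * m)) \<le> c * epowr (bmo_norm (b j)) (\<kappa> * m)" for j
    proof -
      have "emean Q (\<lambda>x. epowr (g j x) (\<kappa> * m))
        \<le> emean Q (\<lambda>x. ennreal (2 powr (\<kappa> * m)) * (epowr (ennreal (norm (b j x - mean Q (b j)))) (\<kappa> * m) + epowr (D * bmo_norm (b j)) (\<kappa> * m)))"
        using \<kappa> m unfolding g_def by (intro emean_mono_AE AE_I2 impI epowr_add_le) auto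
      also have "\<dots> = ennreal (2 powr (\<kappa> * m)) * (emean Q (\<lambda>x. epowr (ennreal (norm (b j x - mean Q (b j)))) (\<kappa> * m)) + epowr (D * bmo_norm (b j)) (\<kappa> * m))"
        by (subst emean_cmult, measurable, subst emean_add, measurable) (simp add: emean_const[OF Q])
      also have "\<dots> \<le> ennreal (2 powr (\<kappa> * m)) * (ennreal K * epowr (bmo_norm (b j)) (\<kappa> * m) + epowr (D * bmo_norm (b j)) (\<kappa> * m))"
        by (intro mult_left_mono add_right_mono K b Q) auto
      also have "\<dots> = c * epowr (bmo_norm (b j)) (\<kappa> * m)"
        using \<kappa> m by (simp add: c_def epowr_mult distrib_right mult.assoc)
      finally show ?thesis .
    qed
    have "emean Q (\<lambda>x. epowr (\<Prod>j\<in>UNIV. g j x) \<kappa>) = emean Q (\<lambda>x. \<Prod>j\<in>UNIV. epowr (epowr (g j x) (\<kappa> * m)) (1 / m))"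
      using \<kappa> m by (simp add: epowr_prod epowr_epowr)
    also have "\<dots> \<le> (\<Prod>j\<in>UNIV. epowr (emean Q (\<lambda>x. epowr (g j x) (\<kappa> * m))) (1 / m))"
      using m by (intro emean_holder Q) (auto simp: m_def)
    also have "\<dots> \<le> (\<Prod>j\<in>UNIV. epowr (c * epowr (bmo_norm (b j)) (\<kappa> * m)) (1 / m))"
      using m by (intro prod_mono_ennreal epowr_mono gj) auto
    also have "\<dots> = C * epowr (\<Prod>j\<in>UNIV. bmo_norm (b j)) \<kappa>"
      using m \<kappa> by (simp add: epowr_mult epowr_epowr C_def epowr_prod prod.distrib)
    finally show "emean Q (\<lambda>x. epowr (\<Prod>j\<in>UNIV. ennreal (norm (b j x - mean Q (b j))) + D * bmo_norm (b j)) \<kappa>)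
      \<le> C * epowr (\<Prod>j\<in>UNIV. bmo_norm (b j)) \<kappa>" by (simp add: g_def)
  qed
qed

text \<open>Hoelder with u = (1 + \<delta>) / \<tau> puts exactly the power 1 + \<delta> on the
  weight, so \<open>rh\<close> returns the plain average to the power \<tau>. The oscillations
  tolerate the conjugate exponent, since all their moments are controlled.\<close>

lemma emean_bmo_prod_weighted:
  fixes w :: "real^'n \<Rightarrow> real"
  assumes [measurable]: "w \<in> borel_measurable lebesgue"
    and rh: "\<And>Q. Q \<in> cubes \<Longrightarrow> emean Q (\<lambda>x. epowr (ennreal (w x)) (1 + \<delta>)) \<le> A * epowr (emean Q (\<lambda>x. ennreal (w x))) (1 + \<delta>)"
    and A: "A < top" and \<rho>: "0 < \<rho>" and \<tau>: "0 < \<tau>" "\<tau> < 1 + \<delta>" and D: "D < top"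
  obtains C :: ennreal where "C < top"
    "\<And>(b :: 'm::finite \<Rightarrow> real^'n \<Rightarrow> complex) Q. (\<And>j. b j \<in> BMO) \<Longrightarrow> Q \<in> cubes \<Longrightarrow>
      emean Q (\<lambda>x. epowr (\<Prod>j\<in>UNIV. ennreal (norm (b j x - mean Q (b j))) + D * bmo_norm (b j)) \<rho> * epowr (ennreal (w x)) \<tau>)
      \<le> C * epowr (\<Prod>j\<in>UNIV. bmo_norm (b j)) \<rho> * epowr (emean Q (\<lambda>x. ennreal (w x))) \<tau>"
proof -
  define u where "u = (1 + \<delta>) / \<tau>"
  have u: "1 < u" using \<tau> by (simp add: u_def)
  define v where "v = u / (u - 1)"
  have v: "0 < v" "1 / v + 1 / u = 1" using u by (auto simp: v_def field_simps)
  obtain K where K: "K < top" "\<And>(b :: 'm::finite \<Rightarrow> real^'n \<Rightarrow> complex) Q. (\<And>j. b j \<in> BMO) \<Longrightarrow> Q \<in> cubes \<Longrightarrow>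
      emean Q (\<lambda>x. epowr (\<Prod>j\<in>UNIV. ennreal (norm (b j x - mean Q (b j))) + D * bmo_norm (b j)) (\<rho> * v))
      \<le> K * epowr (\<Prod>j\<in>UNIV. bmo_norm (b j)) (\<rho> * v)"
    by (rule emean_bmo_prod[of "\<rho> * v" D], use \<rho> v in simp, rule D, rule that) (assumption | blast)+
  define C where "C = epowr K (1 / v) * epowr A (1 / u)"
  have "C < top" using K(1) A u v by (simp add: C_def ennreal_mult_less_top epowr_less_top)
  then show thesis
  proof (rule that)
    fix b :: "'m \<Rightarrow> real^'n \<Rightarrow> complex" and Q :: "(real^'n) set"
    assume b: "\<And>j. b j \<in> BMO" and Q: "Q \<in> cubes"
    have [measurable]: "b j \<in> borel_measurable lebesgue" for j using b[of j] by (intro locally_integrable_measurable) (simp add: BMO_def)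
    define \<phi> where "\<phi> x = (\<Prod>j\<in>UNIV. ennreal (norm (b j x - mean Q (b j))) + D * bmo_norm (b j))" for x
    have [measurable]: "\<phi> \<in> borel_measurable lebesgue" unfolding \<phi>_def by measurable
    have "emean Q (\<lambda>x. epowr (\<phi> x) \<rho> * epowr (ennreal (w x)) \<tau>)
      \<le> epowr (emean Q (\<lambda>x. epowr (epowr (\<phi> x) \<rho>) v)) (1 / v) * epowr (emean Q (\<lambda>x. epowr (epowr (ennreal (w x)) \<tau>) u)) (1 / u)"
      using u by (intro emean_holder2' v Q) auto
    also have "\<dots> = epowr (emean Q (\<lambda>x. epowr (\<phi> x) (\<rho> * v))) (1 / v) * epowr (emean Q (\<lambda>x. epowr (ennreal (w x)) (1 + \<delta>))) (1 / u)"
      using \<rho> \<tau> by (simp add: epowr_epowr u_def)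
    also have "\<dots> \<le> epowr (K * epowr (\<Prod>j\<in>UNIV. bmo_norm (b j)) (\<rho> * v)) (1 / v) * epowr (A * epowr (emean Q (\<lambda>x. ennreal (w x))) (1 + \<delta>)) (1 / u)"
      unfolding \<phi>_def using u v by (intro mult_mono epowr_mono K rh b Q) auto
    also have "\<dots> = C * epowr (\<Prod>j\<in>UNIV. bmo_norm (b j)) \<rho> * epowr (emean Q (\<lambda>x. ennreal (w x))) \<tau>"
      using u v \<rho> \<tau> by (simp add: C_def epowr_mult epowr_epowr u_def ac_simps)
    finally show "emean Q (\<lambda>x. epowr (\<Prod>j\<in>UNIV. ennreal (norm (b j x - mean Q (b j))) + D * bmo_norm (b j)) \<rho> * epowr (ennreal (w x)) \<tau>)
      \<le> C * epowr (\<Prod>j\<in>UNIV. bmo_norm (b j)) \<rho> * epowr (emean Q (\<lambda>x. ennreal (w x))) \<tau>"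
      by (simp add: \<phi>_def)
  qed
qed

subsection \<open>The grid operator\<close>

lemma borel_measurable_nn_integral_count_space:
  fixes f :: "'k::countable \<Rightarrow> 'a \<Rightarrow> ennreal"
  assumes "\<And>k. f k \<in> borel_measurable M"
  shows "(\<lambda>x. \<integral>\<^sup>+k. f k x \<partial>count_space UNIV) \<in> borel_measurable M"
proof -
  interpret sigma_finite_measure "count_space (UNIV :: 'k set)" by (rule sigma_finite_measure_count_space)
  have "(\<lambda>(x, k). f k x) \<in> borel_measurable (M \<Otimes>\<^sub>M count_space UNIV)"
    by (subst measurable_pair_swap_iff, rule measurable_pair_measure_countable1) (use assms in auto)
  then show ?thesis by (intro borel_measurable_nn_integral) simp
qed

lemma epowr_sum:
  assumes "\<And>i. i \<in> I \<Longrightarrow> 0 \<le> a i"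
  shows "epowr x (\<Sum>i\<in>I. a i) = (\<Prod>i\<in>I. epowr x (a i))"
  using assms by (induction I rule: infinite_finite_induct) (auto simp: epowr_add sum_nonneg)

text \<open>Since 1 + \<beta> \<rho> / n = \<rho> / p, the volume times 2^(\<beta> \<rho> k) is at
  most the volume to the power \<rho> / p. Hoelder over all pairs (k, z) with exponents \<theta>_j =
  p / p_j then separates the functions, and each factor is a \<open>grid_sum\<close> with P_j = p_j
  / t_j and R_j = \<rho> p_j / (p t_j). Here P_j > 1 because t_j < p_j, and R_j / P_j = \<rho> / p >
  1 because \<beta> > 0.\<close>

lemma grid_multilinear_sum:
  fixes ps t :: "'m::finite \<Rightarrow> real" and p \<beta> \<rho> :: real
  assumes t: "\<And>j. 0 < t j" "\<And>j. t j < ps j" and p: "0 < p" "1 / p = (\<Sum>j\<in>UNIV. 1 / ps j)"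
    and \<beta>: "0 < \<beta>" and \<rho>: "0 < \<rho>" "1 / \<rho> = 1 / p - \<beta> / real CARD('n)"
  obtains C :: ennreal where "C < top"
    "\<And>G :: 'm \<Rightarrow> real^'n \<Rightarrow> ennreal. (\<And>j. G j \<in> borel_measurable lebesgue) \<Longrightarrow>
      (\<integral>\<^sup>+k. \<integral>\<^sup>+z. emeasure lebesgue (grid_cube k z :: (real^'n) set) * (ennreal (2 powr (\<beta> * \<rho> * real_of_int k))
         * epowr (\<Prod>j\<in>UNIV. epowr (emean (grid_cube k z) (\<lambda>x. epowr (G j x) (t j))) (1 / t j)) \<rho>) \<partial>count_space UNIV \<partial>count_space UNIV)
      \<le> C * epowr (\<Prod>j\<in>UNIV. epowr (\<integral>\<^sup>+x. epowr (G j x) (ps j) \<partial>lebesgue) (1 / ps j)) \<rho>"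
proof -
  note [simp del] = emeasure_completion measure_completion
  define n where "n = real CARD('n)"
  have n: "0 < n" by (simp add: n_def)
  have ps: "0 < ps j" for j using t(1)[of j] t(2)[of j] by simp
  have "1 / \<rho> < 1 / p" using \<rho>(2) \<beta> n by (simp add: n_def)
  then have "p < \<rho>" using inverse_less_imp_less[of \<rho> p] p(1) \<rho>(1) by (simp add: inverse_eq_divide)
  have np: "n * \<rho> / p = n + \<beta> * \<rho>" using \<rho> n p unfolding n_def[symmetric] by (simp add: field_simps)
  define \<theta> where "\<theta> j = p / ps j" for j
  have \<theta>: "0 < \<theta> j" for j using p ps by (simp add: \<theta>_def)
  have \<theta>1: "(\<Sum>j\<in>UNIV. \<theta> j) = 1"
  proof -
    have "(\<Sum>j\<in>UNIV. \<theta> j) = p * (\<Sum>j\<in>UNIV. 1 / ps j)" by (simp add: \<theta>_def sum_distrib_left)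
    then show ?thesis using p(1) unfolding p(2)[symmetric] by simp
  qed
  define P where "P j = ps j / t j" for j
  define R where "R j = \<rho> * ps j / (p * t j)" for j
  have P: "1 < P j" "P j < R j" for j
    using t(1)[of j] t(2)[of j] ps[of j] p \<open>p < \<rho>\<close> by (auto simp: P_def R_def field_simps)
  have R\<theta>: "R j * \<theta> j = \<rho> / t j" "R j / P j * \<theta> j = \<rho> / ps j" "0 < R j" "0 < P j" for j
    using t(1)[of j] ps[of j] p \<rho>(1) by (auto simp: P_def R_def \<theta>_def field_simps)
  have sum\<rho>: "(\<Sum>j\<in>UNIV. \<rho> / ps j) = \<rho> / p"
  proof -
    have "(\<Sum>j\<in>UNIV. \<rho> / ps j) = \<rho> * (\<Sum>j\<in>UNIV. 1 / ps j)" by (simp add: sum_distrib_left)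
    then show ?thesis unfolding p(2)[symmetric] by simp
  qed
  define T where "T j h k z = epowr (epowr (emeasure lebesgue (grid_cube k z :: (real^'n) set)) (1 / P j) * emean (grid_cube k z) h) (R j)"
    for j h k z
  have "\<exists>C>0. \<forall>h. h \<in> borel_measurable lebesgue \<longrightarrow> (\<integral>\<^sup>+k. \<integral>\<^sup>+z. T j h k z \<partial>count_space UNIV \<partial>count_space UNIV)
      \<le> ennreal C * epowr (\<integral>\<^sup>+x. epowr (h x) (P j) \<partial>lebesgue) (R j / P j)" for j
    unfolding T_def by (rule grid_sum[OF P]) (assumption | blast)+
  then obtain K where K: "\<And>j. 0 < K j" "\<And>j h. h \<in> borel_measurable lebesgue \<Longrightarrow> (\<integral>\<^sup>+k. \<integral>\<^sup>+z. T j h k z \<partial>count_space UNIV \<partial>count_space UNIV)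
      \<le> ennreal (K j) * epowr (\<integral>\<^sup>+x. epowr (h x) (P j) \<partial>lebesgue) (R j / P j)" by metis
  define C where "C = (\<Prod>j\<in>UNIV. epowr (ennreal (K j)) (\<theta> j))"
  have "C < top" unfolding C_def less_top[symmetric] using \<theta> by (auto simp: ennreal_prod_eq_top epowr_eq_top_iff)
  then show thesis
  proof (rule that)
    fix G :: "'m \<Rightarrow> real^'n \<Rightarrow> ennreal" assume [measurable]: "\<And>j. G j \<in> borel_measurable lebesgue"
    define h where "h j x = epowr (G j x) (t j)" for j x
    have [measurable]: "h j \<in> borel_measurable lebesgue" for j unfolding h_def by measurable
    have term_le: "emeasure lebesgue (grid_cube k z :: (real^'n) set) * (ennreal (2 powr (\<beta> * \<rho> * real_of_int k))
         * epowr (\<Prod>j\<in>UNIV. epowr (emean (grid_cube k z) (h j)) (1 / t j)) \<rho>)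
      \<le> (\<Prod>j\<in>UNIV. epowr (T j (h j) k z) (\<theta> j))" for k z
    proof -
      let ?V = "emeasure lebesgue (grid_cube k z :: (real^'n) set)"
      \<comment> \<open>The factor 3^n of the volume is at least 1 and \<rho> / p > 1, so raising it
        to \<rho> / p only increases it.\<close>
      have "?V * ennreal (2 powr (\<beta> * \<rho> * real_of_int k)) = ennreal (3 ^ CARD('n) * 2 powr (n * \<rho> / p * real_of_int k))"
        unfolding emeasure_grid_cube np n_def[symmetric]
        by (simp add: ennreal_mult'[symmetric] powr_add[symmetric] algebra_simps)
      also have "\<dots> \<le> ennreal ((3 ^ CARD('n)) powr (\<rho> / p) * 2 powr (n * \<rho> / p * real_of_int k))"
      proof (intro ennreal_leI mult_right_mono)
        have "(3 ^ CARD('n)) powr 1 \<le> ((3 ^ CARD('n)) powr (\<rho> / p) :: real)"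
          using \<open>p < \<rho>\<close> p by (intro powr_mono) auto
        then show "3 ^ CARD('n) \<le> ((3 ^ CARD('n)) powr (\<rho> / p) :: real)" by simp
      qed simp
      also have "\<dots> = epowr ?V (\<rho> / p)"
        unfolding emeasure_grid_cube n_def[symmetric] by (simp add: epowr_ennreal_pos powr_mult powr_powr ac_simps)
      finally have V: "?V * ennreal (2 powr (\<beta> * \<rho> * real_of_int k)) \<le> epowr ?V (\<rho> / p)" .
      have "?V * (ennreal (2 powr (\<beta> * \<rho> * real_of_int k))
         * epowr (\<Prod>j\<in>UNIV. epowr (emean (grid_cube k z) (h j)) (1 / t j)) \<rho>)
        \<le> epowr ?V (\<rho> / p) * epowr (\<Prod>j\<in>UNIV. epowr (emean (grid_cube k z) (h j)) (1 / t j)) \<rho>"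
        unfolding mult.assoc[symmetric] by (intro mult_right_mono V) auto
      also have "\<dots> = (\<Prod>j\<in>UNIV. epowr ?V (\<rho> / ps j) * epowr (emean (grid_cube k z) (h j)) (\<rho> / t j))"
        using \<rho> t ps unfolding sum\<rho>[symmetric]
        by (subst epowr_sum) (auto simp: epowr_prod epowr_epowr prod.distrib less_imp_le)
      also have "\<dots> = (\<Prod>j\<in>UNIV. epowr (T j (h j) k z) (\<theta> j))"
      proof (intro prod.cong refl)
        fix j
        have "epowr (T j (h j) k z) (\<theta> j) = epowr ?V (1 / P j * (R j * \<theta> j)) * epowr (emean (grid_cube k z) (h j)) (R j * \<theta> j)"
          using R\<theta>(3)[of j] R\<theta>(4)[of j] \<theta>[of j] by (simp add: T_def epowr_mult epowr_epowr)
        also have "1 / P j * (R j * \<theta> j) = \<rho> / ps j" using R\<theta>(2)[of j] by simp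
        finally show "epowr ?V (\<rho> / ps j) * epowr (emean (grid_cube k z) (h j)) (\<rho> / t j) = epowr (T j (h j) k z) (\<theta> j)"
          unfolding R\<theta>(1) ..
      qed
      finally show ?thesis .
    qed
    have "(\<integral>\<^sup>+k. \<integral>\<^sup>+z. emeasure lebesgue (grid_cube k z :: (real^'n) set) * (ennreal (2 powr (\<beta> * \<rho> * real_of_int k))
         * epowr (\<Prod>j\<in>UNIV. epowr (emean (grid_cube k z) (h j)) (1 / t j)) \<rho>) \<partial>count_space UNIV \<partial>count_space UNIV)
      \<le> (\<integral>\<^sup>+k. \<integral>\<^sup>+z. (\<Prod>j\<in>UNIV. epowr (T j (h j) k z) (\<theta> j)) \<partial>count_space UNIV \<partial>count_space UNIV)"
      by (intro nn_integral_mono term_le)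
    also have "\<dots> = (\<integral>\<^sup>+i. (\<Prod>j\<in>UNIV. epowr (T j (h j) (fst i) (snd i)) (\<theta> j)) \<partial>count_space UNIV)"
      by (subst nn_integral_fst_count_space[symmetric]) simp
    also have "\<dots> \<le> (\<Prod>j\<in>UNIV. epowr (\<integral>\<^sup>+i. T j (h j) (fst i) (snd i) \<partial>count_space UNIV) (\<theta> j))"
      by (intro nn_integral_holder \<theta> \<theta>1) auto
    also have "\<dots> = (\<Prod>j\<in>UNIV. epowr (\<integral>\<^sup>+k. \<integral>\<^sup>+z. T j (h j) k z \<partial>count_space UNIV \<partial>count_space UNIV) (\<theta> j))"
      by (subst nn_integral_fst_count_space[symmetric]) simp
    also have "\<dots> \<le> (\<Prod>j\<in>UNIV. epowr (ennreal (K j) * epowr (\<integral>\<^sup>+x. epowr (h j x) (P j) \<partial>lebesgue) (R j / P j)) (\<theta> j))"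
      using \<theta> by (intro prod_mono_ennreal epowr_mono K) (auto simp: less_imp_le)
    also have "\<dots> = C * (\<Prod>j\<in>UNIV. epowr (\<integral>\<^sup>+x. epowr (h j x) (P j) \<partial>lebesgue) (\<rho> / ps j))"
    proof -
      have "0 < R j / P j" for j using R\<theta>(3)[of j] R\<theta>(4)[of j] by simp
      then show ?thesis using \<theta> by (simp add: epowr_mult epowr_epowr less_imp_le C_def prod.distrib R\<theta>(2) del: times_divide_eq_left)
    qed
    also have "(\<Prod>j\<in>UNIV. epowr (\<integral>\<^sup>+x. epowr (h j x) (P j) \<partial>lebesgue) (\<rho> / ps j))
       = epowr (\<Prod>j\<in>UNIV. epowr (\<integral>\<^sup>+x. epowr (G j x) (ps j) \<partial>lebesgue) (1 / ps j)) \<rho>"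
      using \<rho> ps t(1) by (simp add: epowr_prod epowr_epowr h_def P_def less_imp_neq[THEN not_sym])
    finally show "(\<integral>\<^sup>+k. \<integral>\<^sup>+z. emeasure lebesgue (grid_cube k z :: (real^'n) set) * (ennreal (2 powr (\<beta> * \<rho> * real_of_int k))
         * epowr (\<Prod>j\<in>UNIV. epowr (emean (grid_cube k z) (\<lambda>x. epowr (G j x) (t j))) (1 / t j)) \<rho>) \<partial>count_space UNIV \<partial>count_space UNIV)
      \<le> C * epowr (\<Prod>j\<in>UNIV. epowr (\<integral>\<^sup>+x. epowr (G j x) (ps j) \<partial>lebesgue) (1 / ps j)) \<rho>"
      by (simp add: h_def[abs_def])
  qed
qed

text \<open>With w = \<nu>^q the factor w^(\<rho> / q) is \<nu>^\<rho>, so this is the \<rho>-th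
  power of a norm-like quantity, without the root: an additive sum over cubes for every
  \<rho>.\<close>

definition weighted_grid_norm ::
  "(real^'n \<Rightarrow> ennreal) \<Rightarrow> real \<Rightarrow> real \<Rightarrow> real \<Rightarrow> (int \<Rightarrow> ('n \<Rightarrow> int) \<Rightarrow> real^'n \<Rightarrow> ennreal) \<Rightarrow> ennreal" where
  "weighted_grid_norm w q \<epsilon> \<rho> u =
    (\<integral>\<^sup>+k. \<integral>\<^sup>+z. (\<integral>\<^sup>+x\<in>grid_cube k z. (epowr (ennreal (2 powr (\<epsilon> * real_of_int k)) * u k z x) \<rho> * epowr (w x) (\<rho> / q)) \<partial>lebesgue)
      \<partial>count_space UNIV \<partial>count_space UNIV)"

text \<open>The two twisted bounds feed the geometric mean estimate at each point, and Hoelder with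
  exponents q / (2 q1) and q / (2 q2), which add up to 1 by \<open>avg\<close>, integrates the
  result. The measurable majorant \<open>H\<close> is exposed because measurability in x of the
  choice \<open>\<zeta>\<close> is not assumed.\<close>

lemma grid_operator_bound:
  fixes w :: "real^'n \<Rightarrow> ennreal" and u :: "int \<Rightarrow> ('n \<Rightarrow> int) \<Rightarrow> real^'n \<Rightarrow> ennreal"
  assumes \<epsilon>: "0 < \<epsilon>" and q: "0 < q" "0 < q1" "0 < q2" and avg: "1 / q = (1 / q1 + 1 / q2) / 2"
    and [measurable]: "w \<in> borel_measurable lebesgue" "\<And>k z. u k z \<in> borel_measurable lebesgue"
    and \<zeta>: "\<And>k x. x \<in> grid_cube k (\<zeta> k x)"
  obtains H where "H \<in> borel_measurable lebesgue" "\<And>x. (\<integral>\<^sup>+k. u k (\<zeta> k x) x \<partial>count_space UNIV) \<le> H x"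
    "(\<integral>\<^sup>+x. epowr (H x) q * w x \<partial>lebesgue)
    \<le> epowr (ennreal (2 / (1 - 2 powr (- \<epsilon>)))) q
       * (epowr (weighted_grid_norm w q \<epsilon> q1 u) (q / (2 * q1)) * epowr (weighted_grid_norm w q (- \<epsilon>) q2 u) (q / (2 * q2)))"
proof -
  define g where "g \<epsilon> \<rho> k z x = epowr (ennreal (2 powr (\<epsilon> * real_of_int k)) * u k z x) \<rho> * indicator (grid_cube k z) x" for \<epsilon> \<rho> k z x
  have gm [measurable]: "g \<epsilon> \<rho> k z \<in> borel_measurable lebesgue" for \<epsilon> \<rho> k z unfolding g_def by measurable
  define V where "V \<epsilon> \<rho> x = (\<integral>\<^sup>+k. \<integral>\<^sup>+z. g \<epsilon> \<rho> k z x \<partial>count_space UNIV \<partial>count_space UNIV)" for \<epsilon> \<rho> x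
  have Vm [measurable]: "V \<epsilon> \<rho> \<in> borel_measurable lebesgue" for \<epsilon> \<rho>
    unfolding V_def by (intro borel_measurable_nn_integral_count_space gm)
  \<comment> \<open>One cube is bounded by the sum over all cubes containing the point, so the root
    of \<open>V\<close> controls every scale at once, with the twist moved to the other
    side.\<close>
  have uV: "u k (\<zeta> k x) x \<le> epowr (V \<epsilon> \<rho> x) (1 / \<rho>) * ennreal (2 powr (- \<epsilon> * real_of_int k))" if "0 < \<rho>" for \<epsilon> \<rho> k x
  proof -
    have "epowr (ennreal (2 powr (\<epsilon> * real_of_int k)) * u k (\<zeta> k x) x) \<rho> = g \<epsilon> \<rho> k (\<zeta> k x) x"
      using \<zeta> by (simp add: g_def)
    also have "\<dots> \<le> (\<integral>\<^sup>+z. g \<epsilon> \<rho> k z x \<partial>count_space UNIV)" by (rule nn_integral_ge_point) simp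
    also have "\<dots> \<le> V \<epsilon> \<rho> x" unfolding V_def by (rule nn_integral_ge_point) simp
    finally have "ennreal (2 powr (\<epsilon> * real_of_int k)) * u k (\<zeta> k x) x \<le> epowr (V \<epsilon> \<rho> x) (1 / \<rho>)"
      using that by (simp add: epowr_le_swap)
    then have le: "ennreal (2 powr (- \<epsilon> * real_of_int k)) * (ennreal (2 powr (\<epsilon> * real_of_int k)) * u k (\<zeta> k x) x)
      \<le> ennreal (2 powr (- \<epsilon> * real_of_int k)) * epowr (V \<epsilon> \<rho> x) (1 / \<rho>)" by (intro mult_left_mono) auto
    have eq: "ennreal (2 powr (- \<epsilon> * real_of_int k)) * ennreal (2 powr (\<epsilon> * real_of_int k)) = 1"
      by (simp add: ennreal_mult'[symmetric] powr_add[symmetric])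
    show ?thesis using le unfolding mult.assoc[symmetric] eq by (simp only: mult_1 mult.commute)
  qed
  define c where "c = ennreal (2 / (1 - 2 powr (- \<epsilon>)))"
  have norm_eq: "(\<integral>\<^sup>+x. V \<epsilon> \<rho> x * epowr (w x) (\<rho> / q) \<partial>lebesgue) = weighted_grid_norm w q \<epsilon> \<rho> u" for \<epsilon> \<rho>
  proof -
    have "(\<integral>\<^sup>+x. V \<epsilon> \<rho> x * epowr (w x) (\<rho> / q) \<partial>lebesgue)
      = (\<integral>\<^sup>+x. \<integral>\<^sup>+k. \<integral>\<^sup>+z. g \<epsilon> \<rho> k z x * epowr (w x) (\<rho> / q) \<partial>count_space UNIV \<partial>count_space UNIV \<partial>lebesgue)"
      unfolding V_def by (simp add: nn_integral_multc)
    also have "\<dots> = (\<integral>\<^sup>+k. \<integral>\<^sup>+x. \<integral>\<^sup>+z. g \<epsilon> \<rho> k z x * epowr (w x) (\<rho> / q) \<partial>count_space UNIV \<partial>lebesgue \<partial>count_space UNIV)"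
      by (intro nn_integral_count_space_nn_integral borel_measurable_nn_integral_count_space) auto
    also have "\<dots> = (\<integral>\<^sup>+k. \<integral>\<^sup>+z. \<integral>\<^sup>+x. g \<epsilon> \<rho> k z x * epowr (w x) (\<rho> / q) \<partial>lebesgue \<partial>count_space UNIV \<partial>count_space UNIV)"
      by (intro nn_integral_cong nn_integral_count_space_nn_integral) auto
    finally show ?thesis by (simp add: weighted_grid_norm_def g_def ac_simps)
  qed
  define H where "H x = c * epowr (epowr (V \<epsilon> q1 x) (1 / q1) * epowr (V (- \<epsilon>) q2 x) (1 / q2)) (1 / 2)" for x
  have "(\<integral>\<^sup>+x. epowr (H x) q * w x \<partial>lebesgue)
    = (\<integral>\<^sup>+x. epowr c q * (epowr (V \<epsilon> q1 x * epowr (w x) (q1 / q)) (q / (2 * q1)) * epowr (V (- \<epsilon>) q2 x * epowr (w x) (q2 / q)) (q / (2 * q2))) \<partial>lebesgue)"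
  proof (intro nn_integral_cong)
    fix x
    have "epowr (H x) q * w x = epowr c q * (epowr (V \<epsilon> q1 x) (q / (2 * q1)) * epowr (V (- \<epsilon>) q2 x) (q / (2 * q2))) * (epowr (w x) (1 / 2) * epowr (w x) (1 / 2))"
      using q epowr_add[of "1/2" "1/2" "w x"] by (simp add: H_def epowr_mult epowr_epowr field_simps)
    also have "\<dots> = epowr c q * (epowr (V \<epsilon> q1 x * epowr (w x) (q1 / q)) (q / (2 * q1)) * epowr (V (- \<epsilon>) q2 x * epowr (w x) (q2 / q)) (q / (2 * q2)))"
      using q by (simp add: epowr_mult epowr_epowr ac_simps)
    finally show "epowr (H x) q * w x = \<dots>" .
  qed
  also have "\<dots> = epowr c q * (\<integral>\<^sup>+x. epowr (V \<epsilon> q1 x * epowr (w x) (q1 / q)) (q / (2 * q1)) * epowr (V (- \<epsilon>) q2 x * epowr (w x) (q2 / q)) (q / (2 * q2)) \<partial>lebesgue)"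
    by (intro nn_integral_cmult) measurable
  also have "\<dots> \<le> epowr c q * (epowr (weighted_grid_norm w q \<epsilon> q1 u) (q / (2 * q1)) * epowr (weighted_grid_norm w q (- \<epsilon>) q2 u) (q / (2 * q2)))"
  proof -
    have "q / (2 * q1) + q / (2 * q2) = q * ((1 / q1 + 1 / q2) / 2)" by (simp add: field_simps)
    also have "\<dots> = 1" unfolding avg[symmetric] using q(1) by simp
    finally show ?thesis unfolding norm_eq[symmetric] using q by (intro mult_left_mono nn_integral_holder2) auto
  qed
  finally have bound: "(\<integral>\<^sup>+x. epowr (H x) q * w x \<partial>lebesgue)
    \<le> epowr c q * (epowr (weighted_grid_norm w q \<epsilon> q1 u) (q / (2 * q1)) * epowr (weighted_grid_norm w q (- \<epsilon>) q2 u) (q / (2 * q2)))" .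
  show thesis
  proof (rule that[of H])
    show "H \<in> borel_measurable lebesgue" unfolding H_def by measurable
    show "(\<integral>\<^sup>+k. u k (\<zeta> k x) x \<partial>count_space UNIV) \<le> H x" for x
      unfolding c_def H_def using uV[OF q(2), of _ x \<epsilon>] uV[OF q(3), of _ x "- \<epsilon>"] by (intro sum_le_geometric_mean \<epsilon>) simp_all
  qed (use bound in \<open>simp add: c_def\<close>)
qed

subsection \<open>The dyadic majorant of the commutator\<close>

text \<open>The factor 2^(\<alpha> k) is, up to a constant, the kernel 2^(-k (mn - \<alpha>)) times
  the m-th power of the volume. \<open>D\<close> is the John-Nirenberg constant that replaces the
  oscillation of b_j(y) inside the average.\<close>

definition grid_term ::
  "real \<Rightarrow> real \<Rightarrow> ennreal \<Rightarrow> ('m::finite \<Rightarrow> real^'n \<Rightarrow> complex) \<Rightarrow> ('m \<Rightarrow> real^'n \<Rightarrow> ennreal) \<Rightarrow> int \<Rightarrow> ('n \<Rightarrow> int) \<Rightarrow> real^'n \<Rightarrow> ennreal" where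
  "grid_term \<alpha> s D b F k z x = ennreal (2 powr (\<alpha> * real_of_int k))
    * ((\<Prod>j\<in>UNIV. epowr (emean (grid_cube k z) (\<lambda>y. epowr (F j y) s)) (1 / s))
       * (\<Prod>j\<in>UNIV. ennreal (norm (b j x - mean (grid_cube k z) (b j))) + D * bmo_norm (b j)))"

lemma BMO_measurable: "b \<in> BMO \<Longrightarrow> b \<in> borel_measurable lebesgue"
  by (intro locally_integrable_measurable) (simp add: BMO_def)

text \<open>On one cube the averages of \<open>F\<close> are constants, so only oscillations and
  weight are integrated, which leaves the mean of w to the power \<rho> / q. The weight condition
  \<open>K\<close> absorbs it, and \<open>grid_multilinear_sum\<close> with \<beta> = \<epsilon> +
  \<alpha> sums over the cubes. The parameter \<epsilon> may be negative and is used with both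
  signs.\<close>

lemma weighted_grid_norm_bound:
  fixes ps t :: "'m::finite \<Rightarrow> real" and p q \<alpha> \<epsilon> \<rho> :: real and w :: "real^'n \<Rightarrow> real" and \<omega> :: "'m \<Rightarrow> real^'n \<Rightarrow> real"
  assumes t: "\<And>j. 0 < t j" "\<And>j. t j < ps j" and p: "0 < p" "1 / p = (\<Sum>j\<in>UNIV. 1 / ps j)"
    and \<epsilon>: "0 < \<epsilon> + \<alpha>" and \<rho>: "0 < \<rho>" "1 / \<rho> = 1 / p - (\<epsilon> + \<alpha>) / real CARD('n)" and q: "0 < q" "\<rho> < q * (1 + \<delta>)"
    and [measurable]: "w \<in> borel_measurable lebesgue" "\<And>j. \<omega> j \<in> borel_measurable lebesgue"
    and rh: "\<And>Q. Q \<in> cubes \<Longrightarrow> emean Q (\<lambda>x. epowr (ennreal (w x)) (1 + \<delta>)) \<le> A * epowr (emean Q (\<lambda>x. ennreal (w x))) (1 + \<delta>)"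
    and fin: "A < top" "D < top" "K < top"
    and K: "\<And>F Q. (\<And>j. F j \<in> borel_measurable lebesgue) \<Longrightarrow> Q \<in> cubes \<Longrightarrow>
      epowr (emean Q (\<lambda>x. ennreal (w x))) (1 / q) * (\<Prod>j\<in>UNIV. epowr (emean Q (\<lambda>x. epowr (F j x) s)) (1 / s))
      \<le> K * (\<Prod>j\<in>UNIV. epowr (emean Q (\<lambda>x. epowr (F j x * ennreal (\<omega> j x)) (t j))) (1 / t j))"
  shows "\<exists>C<top. \<forall>b F. (\<forall>j. b j \<in> BMO) \<longrightarrow> (\<forall>j. F j \<in> borel_measurable lebesgue) \<longrightarrow>
      weighted_grid_norm (\<lambda>x. ennreal (w x)) q \<epsilon> \<rho> (grid_term \<alpha> s D b F)
      \<le> C * epowr (\<Prod>j\<in>UNIV. bmo_norm (b j)) \<rho>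
          * epowr (\<Prod>j\<in>UNIV. epowr (\<integral>\<^sup>+x. epowr (F j x * ennreal (\<omega> j x)) (ps j) \<partial>lebesgue) (1 / ps j)) \<rho>"
proof -
  note [simp del] = emeasure_completion measure_completion
  define \<beta> where "\<beta> = \<epsilon> + \<alpha>"
  have \<tau>: "0 < \<rho> / q" "\<rho> / q < 1 + \<delta>" using \<rho> q by (auto simp: field_simps)
  obtain C1 where C1: "C1 < top" "\<And>(b :: 'm \<Rightarrow> real^'n \<Rightarrow> complex) Q. (\<And>j. b j \<in> BMO) \<Longrightarrow> Q \<in> cubes \<Longrightarrow>
      emean Q (\<lambda>x. epowr (\<Prod>j\<in>UNIV. ennreal (norm (b j x - mean Q (b j))) + D * bmo_norm (b j)) \<rho> * epowr (ennreal (w x)) (\<rho> / q))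
      \<le> C1 * epowr (\<Prod>j\<in>UNIV. bmo_norm (b j)) \<rho> * epowr (emean Q (\<lambda>x. ennreal (w x))) (\<rho> / q)"
    by (rule emean_bmo_prod_weighted[OF _ rh fin(1) \<rho>(1) \<tau> fin(2)], simp, simp, rule that) (assumption | blast)+
  obtain C2 where C2: "C2 < top" "\<And>G :: 'm \<Rightarrow> real^'n \<Rightarrow> ennreal. (\<And>j. G j \<in> borel_measurable lebesgue) \<Longrightarrow>
      (\<integral>\<^sup>+k. \<integral>\<^sup>+z. emeasure lebesgue (grid_cube k z :: (real^'n) set) * (ennreal (2 powr (\<beta> * \<rho> * real_of_int k))
         * epowr (\<Prod>j\<in>UNIV. epowr (emean (grid_cube k z) (\<lambda>x. epowr (G j x) (t j))) (1 / t j)) \<rho>) \<partial>count_space UNIV \<partial>count_space UNIV)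
      \<le> C2 * epowr (\<Prod>j\<in>UNIV. epowr (\<integral>\<^sup>+x. epowr (G j x) (ps j) \<partial>lebesgue) (1 / ps j)) \<rho>"
    by (rule grid_multilinear_sum[OF t p \<epsilon> \<rho>], rule that) (unfold \<beta>_def, (assumption | blast)+)
  define C where "C = C1 * epowr K \<rho> * C2"
  have "C < top" using C1(1) C2(1) fin \<rho>(1) by (simp add: C_def ennreal_mult_less_top epowr_less_top)
  then show ?thesis
  proof (intro exI[of _ C] conjI allI impI)
    fix b :: "'m \<Rightarrow> real^'n \<Rightarrow> complex" and F :: "'m \<Rightarrow> real^'n \<Rightarrow> ennreal"
    assume "\<forall>j. b j \<in> BMO" and "\<forall>j. F j \<in> borel_measurable lebesgue"
    then have b: "\<And>j. b j \<in> BMO" and Fm [measurable]: "\<And>j. F j \<in> borel_measurable lebesgue" by auto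
    have [measurable]: "b j \<in> borel_measurable lebesgue" for j using b[of j] by (rule BMO_measurable)
    define N where "N = epowr (\<Prod>j\<in>UNIV. bmo_norm (b j)) \<rho>"
    define G where "G j x = F j x * ennreal (\<omega> j x)" for j x
    have [measurable]: "G j \<in> borel_measurable lebesgue" for j unfolding G_def by measurable
    define S where "S k z = emeasure lebesgue (grid_cube k z :: (real^'n) set) * (ennreal (2 powr (\<beta> * \<rho> * real_of_int k))
         * epowr (\<Prod>j\<in>UNIV. epowr (emean (grid_cube k z) (\<lambda>x. epowr (G j x) (t j))) (1 / t j)) \<rho>)" for k z
    have term_le: "(\<integral>\<^sup>+x\<in>grid_cube k z. (epowr (ennreal (2 powr (\<epsilon> * real_of_int k)) * grid_term \<alpha> s D b F k z x) \<rho> * epowr (ennreal (w x)) (\<rho> / q)) \<partial>lebesgue)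
      \<le> C1 * epowr K \<rho> * N * S k z" for k z
    proof -
      let ?Q = "grid_cube k z :: (real^'n) set"
      define a where "a = (\<Prod>j\<in>UNIV. epowr (emean ?Q (\<lambda>y. epowr (F j y) s)) (1 / s))"
      define \<phi> where "\<phi> x = (\<Prod>j\<in>UNIV. ennreal (norm (b j x - mean ?Q (b j))) + D * bmo_norm (b j))" for x
      have [measurable]: "\<phi> \<in> borel_measurable lebesgue" unfolding \<phi>_def by measurable
      define c where "c = ennreal (2 powr (\<beta> * \<rho> * real_of_int k))"
      have c: "epowr (ennreal (2 powr (\<epsilon> * real_of_int k)) * ennreal (2 powr (\<alpha> * real_of_int k))) \<rho> = c"
        by (simp add: c_def \<beta>_def ennreal_mult'[symmetric] powr_add[symmetric] epowr_ennreal_pos powr_powr algebra_simps)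
      have "(\<integral>\<^sup>+x\<in>?Q. (epowr (ennreal (2 powr (\<epsilon> * real_of_int k)) * grid_term \<alpha> s D b F k z x) \<rho> * epowr (ennreal (w x)) (\<rho> / q)) \<partial>lebesgue)
        = (\<integral>\<^sup>+x. c * epowr a \<rho> * (epowr (\<phi> x) \<rho> * epowr (ennreal (w x)) (\<rho> / q) * indicator ?Q x) \<partial>lebesgue)"
        unfolding grid_term_def a_def[symmetric] \<phi>_def[symmetric] c[symmetric]
        using \<rho>(1) by (simp only: epowr_mult less_imp_le mult.assoc)
      also have "\<dots> = c * epowr a \<rho> * (\<integral>\<^sup>+x\<in>?Q. (epowr (\<phi> x) \<rho> * epowr (ennreal (w x)) (\<rho> / q)) \<partial>lebesgue)"
        by (intro nn_integral_cmult) measurable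
      also have "\<dots> = c * epowr a \<rho> * (emean ?Q (\<lambda>x. epowr (\<phi> x) \<rho> * epowr (ennreal (w x)) (\<rho> / q)) * emeasure lebesgue ?Q)"
        by (simp add: emean_mult_emeasure)
      also have "\<dots> \<le> c * epowr a \<rho> * ((C1 * N * epowr (emean ?Q (\<lambda>x. ennreal (w x))) (\<rho> / q)) * emeasure lebesgue ?Q)"
        unfolding \<phi>_def N_def by (intro mult_left_mono mult_right_mono C1 b) auto
      \<comment> \<open>The average of the weight and the averages of \<open>F\<close> recombine
        into one \<rho>-th power of exactly the expression that \<open>K\<close> bounds.\<close>
      also have "\<dots> = C1 * N * (emeasure lebesgue ?Q * (c * epowr (epowr (emean ?Q (\<lambda>x. ennreal (w x))) (1 / q) * a) \<rho>))"
        using \<rho>(1) q(1) by (simp add: epowr_mult epowr_epowr ac_simps)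
      also have "\<dots> \<le> C1 * N * (emeasure lebesgue ?Q * (c * epowr (K * (\<Prod>j\<in>UNIV. epowr (emean ?Q (\<lambda>x. epowr (G j x) (t j))) (1 / t j))) \<rho>))"
        unfolding a_def G_def using \<rho>(1) by (intro mult_left_mono epowr_mono K) auto
      also have "\<dots> = C1 * epowr K \<rho> * N * S k z"
        unfolding S_def c_def[symmetric] using \<rho>(1) by (simp add: epowr_mult ac_simps)
      finally show ?thesis .
    qed
    have "weighted_grid_norm (\<lambda>x. ennreal (w x)) q \<epsilon> \<rho> (grid_term \<alpha> s D b F)
      \<le> (\<integral>\<^sup>+k. \<integral>\<^sup>+z. C1 * epowr K \<rho> * N * S k z \<partial>count_space UNIV \<partial>count_space UNIV)"
      unfolding weighted_grid_norm_def by (intro nn_integral_mono term_le)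
    also have "\<dots> = C1 * epowr K \<rho> * N * (\<integral>\<^sup>+k. \<integral>\<^sup>+z. S k z \<partial>count_space UNIV \<partial>count_space UNIV)"
      by (simp add: nn_integral_cmult)
    also have "\<dots> \<le> C1 * epowr K \<rho> * N * (C2 * epowr (\<Prod>j\<in>UNIV. epowr (\<integral>\<^sup>+x. epowr (G j x) (ps j) \<partial>lebesgue) (1 / ps j)) \<rho>)"
      unfolding S_def by (intro mult_left_mono C2) auto
    finally show "weighted_grid_norm (\<lambda>x. ennreal (w x)) q \<epsilon> \<rho> (grid_term \<alpha> s D b F)
      \<le> C * epowr (\<Prod>j\<in>UNIV. bmo_norm (b j)) \<rho>
          * epowr (\<Prod>j\<in>UNIV. epowr (\<integral>\<^sup>+x. epowr (F j x * ennreal (\<omega> j x)) (ps j) \<partial>lebesgue) (1 / ps j)) \<rho>"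
      by (simp add: C_def N_def G_def[abs_def] ac_simps)
  qed
qed

text \<open>The condition concerns \<omega>^r, so its r-th root is taken: the first factor becomes
  the mean of \<nu>^q to the power 1 / q, and each dual factor trades exponent s for
  \<open>t j\<close> through \<open>dual_factor_holder\<close> at p_j / r.\<close>

lemma multiple_A_holder:
  fixes \<omega> :: "'m::finite \<Rightarrow> real^'n \<Rightarrow> real" and ps t :: "'m \<Rightarrow> real" and q r s :: real
  assumes A: "(\<lambda>i x. \<omega> i x powr r) \<in> multiple_A (\<lambda>i. ps i / r) (q / r)" and pos: "0 < r" "0 < q" "0 < s"
    and t: "\<And>j. 0 < t j" "\<And>j. 1 / t j = 1 / s - 1 / r + 1 / ps j"
    and meas: "\<And>j. \<omega> j \<in> borel_measurable lebesgue" and \<omega>: "\<And>j x. 0 \<le> \<omega> j x" "\<And>j. AE x in lebesgue. 0 < \<omega> j x"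
  obtains K :: ennreal where "K < top"
    "\<And>F Q. (\<And>j. F j \<in> borel_measurable lebesgue) \<Longrightarrow> Q \<in> cubes \<Longrightarrow>
      epowr (emean Q (\<lambda>x. ennreal (weight_product \<omega> x powr q))) (1 / q) * (\<Prod>j\<in>UNIV. epowr (emean Q (\<lambda>x. epowr (F j x) s)) (1 / s))
      \<le> K * (\<Prod>j\<in>UNIV. epowr (emean Q (\<lambda>x. epowr (F j x * ennreal (\<omega> j x)) (t j))) (1 / t j))"
proof -
  define W where "W Q = epowr (emean Q (\<lambda>x. epowr (ennreal (weight_product (\<lambda>i x. \<omega> i x powr r) x)) (q / r))) (1 / (q / r))" for Q :: "(real^'n) set"
  define E where "E j Q = dual_factor (ps j / r) (\<lambda>x. \<omega> j x powr r) Q" for j Q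
  define K where "K = (SUP Q\<in>cubes. W Q * (\<Prod>j\<in>UNIV. E j Q))"
  have K: "K < top" and ps: "1 \<le> ps j / r" for j using A by (auto simp: multiple_A_def K_def W_def E_def)
  have W: "epowr (emean Q (\<lambda>x. ennreal (weight_product \<omega> x powr q))) (1 / q) = epowr (W Q) (1 / r)" for Q
  proof -
    have "epowr (ennreal (weight_product (\<lambda>i x. \<omega> i x powr r) x)) (q / r) = ennreal (weight_product \<omega> x powr q)" for x
    proof -
      have "weight_product (\<lambda>i x. \<omega> i x powr r) x = weight_product \<omega> x powr r"
        by (simp add: weight_product_def prod_powr_distrib \<omega>)
      moreover have "0 \<le> weight_product \<omega> x" by (simp add: weight_product_def prod_nonneg \<omega>)
      ultimately show ?thesis using pos by (simp add: epowr_ennreal powr_powr)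
    qed
    then show ?thesis using pos by (simp add: W_def epowr_epowr)
  qed
  have "epowr K (1 / r) < top" using K pos by (simp add: epowr_less_top)
  then show thesis
  proof (rule that)
    fix F :: "'m \<Rightarrow> real^'n \<Rightarrow> ennreal" and Q :: "(real^'n) set"
    assume F: "\<And>j. F j \<in> borel_measurable lebesgue" and Q: "Q \<in> cubes"
    let ?G = "\<lambda>j. epowr (emean Q (\<lambda>x. epowr (F j x * ennreal (\<omega> j x)) (t j))) (1 / t j)"
    have "epowr (emean Q (\<lambda>x. epowr (F j x) s)) (1 / s) \<le> epowr (E j Q) (1 / r) * ?G j" for j
      unfolding E_def using t pos ps[of j] by (intro dual_factor_holder meas F \<omega> Q) auto
    then have "epowr (W Q) (1 / r) * (\<Prod>j\<in>UNIV. epowr (emean Q (\<lambda>x. epowr (F j x) s)) (1 / s))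
      \<le> epowr (W Q) (1 / r) * (\<Prod>j\<in>UNIV. epowr (E j Q) (1 / r) * ?G j)"
      by (intro mult_left_mono prod_mono_ennreal) auto
    also have "\<dots> = epowr (W Q * (\<Prod>j\<in>UNIV. E j Q)) (1 / r) * (\<Prod>j\<in>UNIV. ?G j)"
      using pos by (simp add: epowr_mult epowr_prod prod.distrib mult.assoc)
    also have "\<dots> \<le> epowr K (1 / r) * (\<Prod>j\<in>UNIV. ?G j)"
      unfolding K_def using pos Q by (intro mult_right_mono epowr_mono SUP_upper) auto
    finally show "epowr (emean Q (\<lambda>x. ennreal (weight_product \<omega> x powr q))) (1 / q) * (\<Prod>j\<in>UNIV. epowr (emean Q (\<lambda>x. epowr (F j x) s)) (1 / s))
      \<le> epowr K (1 / r) * (\<Prod>j\<in>UNIV. ?G j)" unfolding W .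
  qed
qed

section \<open>Pointwise domination by the grid sum\<close>

definition grid_index :: "int \<Rightarrow> real^'n \<Rightarrow> 'n \<Rightarrow> int" where
  "grid_index k x i = \<lfloor>x $ i / 2 powr real_of_int k\<rfloor>"

text \<open>The point \<open>x\<close> lies in the central third of the cube with its own index,
  which leaves a margin of 2^k on every side.\<close>

lemma mem_grid_cube_near:
  assumes "\<And>i. \<bar>x $ i - y $ i\<bar> \<le> 2 powr real_of_int k"
  shows "y \<in> grid_cube k (grid_index k x)"
  unfolding mem_grid_cube grid_index_def
proof
  fix i
  have "0 < 2 powr real_of_int k" by simp
  then have "\<bar>x $ i / 2 powr real_of_int k - y $ i / 2 powr real_of_int k\<bar> \<le> 1"
    using assms[of i] by (simp add: diff_divide_distrib[symmetric])
  then show "y $ i / 2 powr real_of_int k - 2 \<le> real_of_int \<lfloor>x $ i / 2 powr real_of_int k\<rfloor> \<and>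
    real_of_int \<lfloor>x $ i / 2 powr real_of_int k\<rfloor> \<le> y $ i / 2 powr real_of_int k + 1"
    by (intro conjI) linarith+
qed

text \<open>With d the distance from (x,...,x) to y, only the term with 2^(k-1) <= d <= 2^k matters,
  and each y_j is within d of x. Bounding by the sum over all k removes the dependence of k on y, so
  the terms can be integrated one by one.\<close>

lemma commutator_integrand_bound:
  fixes b f :: "'m::finite \<Rightarrow> real^'n \<Rightarrow> complex"
  assumes \<alpha>: "\<alpha> < real CARD('m) * real CARD('n)"
  shows "ennreal (norm (commutator_integrand \<alpha> b f x y))
    \<le> (\<integral>\<^sup>+k. ennreal (2 powr ((1 - real_of_int k) * (real CARD('m) * real CARD('n) - \<alpha>)))
      * (\<Prod>j\<in>UNIV. ennreal (norm (b j x - b j (y $ j))) * ennreal (norm (f j (y $ j))) * indicator (grid_cube k (grid_index k x)) (y $ j)) \<partial>count_space UNIV)"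
    (is "_ \<le> (\<integral>\<^sup>+k. ?T k \<partial>count_space UNIV)")
proof -
  define d where "d = norm (\<chi> j. x - y $ j)"
  define c where "c = real CARD('m) * real CARD('n) - \<alpha>"
  have c: "0 < c" using \<alpha> by (simp add: c_def)
  have eq: "ennreal (norm (commutator_integrand \<alpha> b f x y))
    = ennreal (1 / d powr c) * (\<Prod>j\<in>UNIV. ennreal (norm (b j x - b j (y $ j))) * ennreal (norm (f j (y $ j))))"
    by (simp add: commutator_integrand_def d_def[symmetric] c_def[symmetric] norm_mult norm_divide prod_norm[symmetric]
        prod_ennreal prod.distrib[symmetric] ennreal_mult'[symmetric] mult.assoc)
  show ?thesis
  proof (cases "d = 0")
    \<comment> \<open>At d = 0 the convention 1 / 0 = 0 makes the integrand vanish.\<close>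
    case True
    then show ?thesis unfolding eq by simp
  next
    case False
    then have d: "0 < d" by (simp add: d_def)
    define k where "k = \<lceil>log 2 d\<rceil>"
    have k: "d \<le> 2 powr real_of_int k" "2 powr (real_of_int k - 1) \<le> d"
    proof -
      have "log 2 d \<le> real_of_int k" "real_of_int k - 1 \<le> log 2 d" unfolding k_def by linarith+
      then show "d \<le> 2 powr real_of_int k" "2 powr (real_of_int k - 1) \<le> d"
        using d by (simp_all add: le_log_iff log_le_iff)
    qed
    have ind: "y $ j \<in> grid_cube k (grid_index k x)" for j
    proof (rule mem_grid_cube_near)
      fix i
      have "\<bar>(x - y $ j) $ i\<bar> \<le> norm (x - y $ j)" by (rule component_le_norm_cart)
      also have "\<dots> \<le> d" using Finite_Cartesian_Product.norm_nth_le[of "\<chi> j. x - y $ j" j] by (simp add: d_def)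
      finally show "\<bar>x $ i - y $ j $ i\<bar> \<le> 2 powr real_of_int k" using k(1) by simp
    qed
    have "(2 powr (real_of_int k - 1)) powr c \<le> d powr c" using k(2) c by (intro powr_mono2) auto
    then have "1 / d powr c \<le> 1 / (2 powr (real_of_int k - 1)) powr c" using d by (intro divide_left_mono) auto
    also have "\<dots> = 2 powr ((1 - real_of_int k) * c)" by (simp add: powr_powr powr_minus_divide[symmetric] algebra_simps)
    finally have "ennreal (norm (commutator_integrand \<alpha> b f x y)) \<le> ?T k"
      unfolding eq c_def[symmetric] using ind by (auto intro!: mult_right_mono ennreal_leI)
    also have "\<dots> \<le> (\<integral>\<^sup>+k. ?T k \<partial>count_space UNIV)" by (rule nn_integral_ge_point) simp
    finally show ?thesis .
  qed
qed

text \<open>At a fixed scale the majorant is a product of functions of the single y_j, so Tonelli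
  gives a product of averages over one cube. The powers combine as 2^((1-k)(mn-\<alpha>)) * (3^n
  2^(nk))^m = 3^(nm) 2^(mn-\<alpha>) 2^(\<alpha> k), the source of the constant.\<close>

lemma commutator_integral_bound:
  fixes b f :: "'m::finite \<Rightarrow> real^'n \<Rightarrow> complex"
  assumes \<alpha>: "\<alpha> < real CARD('m) * real CARD('n)" and b: "\<And>j. b j \<in> BMO" and fm: "\<And>j. f j \<in> borel_measurable lebesgue"
    and D: "\<And>(b :: real^'n \<Rightarrow> complex) Q F c. b \<in> BMO \<Longrightarrow> Q \<in> cubes \<Longrightarrow> F \<in> borel_measurable lebesgue \<Longrightarrow>
      emean Q (\<lambda>y. ennreal (norm (c - b y)) * F y)
      \<le> (ennreal (norm (c - mean Q b)) + D * bmo_norm b) * epowr (emean Q (\<lambda>y. epowr (F y) s)) (1 / s)"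
  shows "(\<integral>\<^sup>+y. ennreal (norm (commutator_integrand \<alpha> b f x y)) \<partial>lebesgue)
    \<le> ennreal (3 ^ (CARD('n) * CARD('m)) * 2 powr (real CARD('m) * real CARD('n) - \<alpha>))
      * (\<integral>\<^sup>+k. grid_term \<alpha> s D b (\<lambda>j y. ennreal (norm (f j y))) k (grid_index k x) x \<partial>count_space UNIV)"
proof -
  note [simp del] = emeasure_completion measure_completion
  note [measurable] = fm
  have [measurable]: "b j \<in> borel_measurable lebesgue" for j using b[of j] by (rule BMO_measurable)
  define c where "c = real CARD('m) * real CARD('n) - \<alpha>"
  define h where "h k j y = ennreal (norm (b j x - b j y)) * ennreal (norm (f j y)) * indicator (grid_cube k (grid_index k x)) y" for k j y
  have hm [measurable]: "h k j \<in> borel_measurable lebesgue" for k j unfolding h_def by measurable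
  have hm' [measurable]: "(\<lambda>y :: (real^'n)^'m. h k j (y $ j)) \<in> borel_measurable lebesgue" for k j
    by (rule measurable_compose[OF measurable_vec_nth_lebesgue hm])
  have "(\<integral>\<^sup>+y. ennreal (norm (commutator_integrand \<alpha> b f x y)) \<partial>lebesgue)
    \<le> (\<integral>\<^sup>+y. \<integral>\<^sup>+k. ennreal (2 powr ((1 - real_of_int k) * c)) * (\<Prod>j\<in>UNIV. h k j (y $ j)) \<partial>count_space UNIV \<partial>lebesgue)"
    unfolding h_def c_def by (intro nn_integral_mono commutator_integrand_bound \<alpha>)
  also have "\<dots> = (\<integral>\<^sup>+k. \<integral>\<^sup>+y. ennreal (2 powr ((1 - real_of_int k) * c)) * (\<Prod>j\<in>UNIV. h k j (y $ j)) \<partial>lebesgue \<partial>count_space UNIV)"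
    by (intro nn_integral_count_space_nn_integral) auto
  also have "\<dots> = (\<integral>\<^sup>+k. ennreal (2 powr ((1 - real_of_int k) * c)) * (\<Prod>j\<in>UNIV. \<integral>\<^sup>+y. h k j y \<partial>lebesgue) \<partial>count_space UNIV)"
    by (simp add: nn_integral_cmult nn_integral_lebesgue_vec_prod)
  also have "\<dots> \<le> (\<integral>\<^sup>+k. ennreal (3 ^ (CARD('n) * CARD('m)) * 2 powr c) * grid_term \<alpha> s D b (\<lambda>j y. ennreal (norm (f j y))) k (grid_index k x) x \<partial>count_space UNIV)"
  proof (intro nn_integral_mono)
    fix k :: int
    let ?Q = "grid_cube k (grid_index k x) :: (real^'n) set"
    let ?V = "3 ^ CARD('n) * 2 powr (real CARD('n) * real_of_int k)"
    let ?o = "\<lambda>j. ennreal (norm (b j x - mean ?Q (b j))) + D * bmo_norm (b j)"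
    let ?a = "\<lambda>j. epowr (emean ?Q (\<lambda>y. epowr (ennreal (norm (f j y))) s)) (1 / s)"
    have "(\<integral>\<^sup>+y. h k j y \<partial>lebesgue) \<le> ennreal ?V * (?a j * ?o j)" for j
    proof -
      have "(\<integral>\<^sup>+y. h k j y \<partial>lebesgue) = emean ?Q (\<lambda>y. ennreal (norm (b j x - b j y)) * ennreal (norm (f j y))) * emeasure lebesgue ?Q"
        by (simp add: emean_mult_emeasure h_def)
      also have "\<dots> \<le> (?o j * ?a j) * emeasure lebesgue ?Q"
        by (intro mult_right_mono D b) auto
      finally show ?thesis unfolding emeasure_grid_cube by (simp only: ac_simps)
    qed
    then have "ennreal (2 powr ((1 - real_of_int k) * c)) * (\<Prod>j\<in>UNIV. \<integral>\<^sup>+y. h k j y \<partial>lebesgue)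
      \<le> ennreal (2 powr ((1 - real_of_int k) * c)) * (\<Prod>j\<in>UNIV. ennreal ?V * (?a j * ?o j))"
      by (intro mult_left_mono prod_mono_ennreal) auto
    also have "\<dots> = ennreal (2 powr ((1 - real_of_int k) * c)) * ennreal ?V ^ CARD('m) * ((\<Prod>j\<in>UNIV. ?a j) * (\<Prod>j\<in>UNIV. ?o j))"
      by (simp only: prod.distrib prod_constant mult.assoc)
    also have "ennreal (2 powr ((1 - real_of_int k) * c)) * ennreal ?V ^ CARD('m)
      = ennreal (3 ^ (CARD('n) * CARD('m)) * 2 powr c) * ennreal (2 powr (\<alpha> * real_of_int k))"
    proof -
      have "2 powr ((1 - real_of_int k) * c) * ?V ^ CARD('m) = 3 ^ (CARD('n) * CARD('m)) * (2 powr ((1 - real_of_int k) * c) * 2 powr (real CARD('n) * real_of_int k * real CARD('m)))"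
        by (simp add: power_mult_distrib power_mult powr_realpow[symmetric] powr_powr)
      also have "2 powr ((1 - real_of_int k) * c) * 2 powr (real CARD('n) * real_of_int k * real CARD('m)) = 2 powr c * 2 powr (\<alpha> * real_of_int k)"
        by (simp add: powr_add[symmetric] c_def algebra_simps)
      finally show ?thesis by (simp add: ennreal_power ennreal_mult'[symmetric] mult.assoc)
    qed
    finally show "ennreal (2 powr ((1 - real_of_int k) * c)) * (\<Prod>j\<in>UNIV. \<integral>\<^sup>+y. h k j y \<partial>lebesgue)
      \<le> ennreal (3 ^ (CARD('n) * CARD('m)) * 2 powr c) * grid_term \<alpha> s D b (\<lambda>j y. ennreal (norm (f j y))) k (grid_index k x) x"
      by (simp add: grid_term_def mult.assoc)
  qed
  also have "\<dots> = ennreal (3 ^ (CARD('n) * CARD('m)) * 2 powr c) * (\<integral>\<^sup>+k. grid_term \<alpha> s D b (\<lambda>j y. ennreal (norm (f j y))) k (grid_index k x) x \<partial>count_space UNIV)"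
    by (intro nn_integral_cmult) auto
  finally show ?thesis by (simp add: c_def)
qed

lemma commutator_integrand_measurable:
  fixes b f :: "'m::finite \<Rightarrow> real^'n \<Rightarrow> complex"
  assumes "\<And>j. b j \<in> borel_measurable lebesgue" "\<And>j. f j \<in> borel_measurable lebesgue"
  shows "commutator_integrand \<alpha> b f x \<in> borel_measurable lebesgue"
proof -
  have [measurable]: "(\<lambda>y :: (real^'n)^'m. b j (y $ j)) \<in> borel_measurable lebesgue"
    "(\<lambda>y :: (real^'n)^'m. f j (y $ j)) \<in> borel_measurable lebesgue" for j
    using assms by (auto intro: measurable_compose[OF measurable_vec_nth_lebesgue])
  have "(\<lambda>y :: (real^'n)^'m. norm (\<chi> j. x - y $ j)) \<in> borel_measurable borel"
    by (intro borel_measurable_continuous_onI continuous_intros)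
  then have [measurable]: "(\<lambda>y :: (real^'n)^'m. norm (\<chi> j. x - y $ j)) \<in> borel_measurable lebesgue"
    by (simp add: measurable_completion)
  show ?thesis unfolding commutator_integrand_def[abs_def] by measurable
qed

section \<open>From the grid majorant to the weighted norm inequality\<close>

lemma Lp_norm_mult_weight:
  assumes "0 < p" "\<And>x. 0 \<le> \<omega> x"
  shows "Lp_norm p (\<lambda>x. \<omega> x powr p) f
    = epowr (\<integral>\<^sup>+x. epowr (ennreal (norm (f x)) * ennreal (\<omega> x)) p \<partial>lebesgue) (1 / p)"
proof -
  have "epowr (ennreal (norm (f x)) * ennreal (\<omega> x)) p = ennreal (norm (f x) powr p * \<omega> x powr p)" for x
    using assms by (simp add: epowr_mult epowr_ennreal ennreal_mult')
  then show ?thesis by (simp add: Lp_norm_def)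
qed

text \<open>For a non-integrable function the Bochner integral is 0, so the bound holds there as
  well.\<close>

lemma ennreal_norm_integral_le:
  fixes g :: "'a \<Rightarrow> 'b::{banach, second_countable_topology}"
  shows "ennreal (norm (LINT y|M. g y)) \<le> (\<integral>\<^sup>+y. ennreal (norm (g y)) \<partial>M)"
  by (cases "integrable M g") (auto simp: integral_norm_bound_ennreal not_integrable_integral_eq)

theorem theorem1p3:
  fixes \<alpha> p q r :: real
    and ps :: "'m::finite \<Rightarrow> real"
    and \<omega> :: "'m \<Rightarrow> real^'n::finite \<Rightarrow> real"
  assumes "0 < \<alpha>" and "\<alpha> < real CARD('m) * real CARD('n)"
    and "\<And>i. 1 < ps i"
    and "1 / p = (\<Sum>i\<in>UNIV. 1 / ps i)"
    and "1 / q = 1 / p - \<alpha> / real CARD('n)"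
    and "1 < r"
    and "0 < r * \<alpha>" and "r * \<alpha> < real CARD('m) * real CARD('n)"
    and "\<And>i. \<omega> i \<in> borel_measurable lebesgue"
    and "\<And>i x. 0 \<le> \<omega> i x"
    and "(\<lambda>i x. \<omega> i x powr r) \<in> multiple_A (\<lambda>i. ps i / r) (q / r)"
    and "(\<lambda>x. weight_product \<omega> x powr q) \<in> A_infinity"
  shows "\<exists>C::real. C > 0 \<and>
    (\<forall>(b :: 'm \<Rightarrow> real^'n \<Rightarrow> complex) (f :: 'm \<Rightarrow> real^'n \<Rightarrow> complex).
      (\<forall>j. b j \<in> BMO) \<longrightarrow>
      (\<forall>i. f i \<in> Lp_space (ps i) (\<lambda>x. \<omega> i x powr ps i)) \<longrightarrow>
      (AE x in lebesgue. integrable lebesgue (commutator_integrand \<alpha> b f x)) \<and>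
      Lp_norm q (\<lambda>x. weight_product \<omega> x powr q) (iterated_commutator \<alpha> b f)
        \<le> ennreal C * (\<Prod>j\<in>UNIV. bmo_norm (b j))
            * (\<Prod>i\<in>UNIV. Lp_norm (ps i) (\<lambda>x. \<omega> i x powr ps i) (f i)))"
proof -
  note \<alpha> = assms(1,2) and ps1 = assms(3) and p_eq = assms(4) and q_eq = assms(5) and r1 = assms(6)
  note \<omega>m [measurable] = assms(9) note \<omega>0 = assms(10)
  define n where "n = real CARD('n)"
  have n: "0 < n" by (simp add: n_def)
  have r: "0 < r" using r1 by simp
  have psr: "1 \<le> ps i / r" and "0 < q / r" for i using assms(11) by (auto simp: multiple_A_def)
  then have q: "0 < q" using r by (simp add: zero_less_divide_iff)
  have ps0: "0 < ps i" for i using ps1[of i] by simp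
  have "0 < (\<Sum>i\<in>UNIV. 1 / ps i)" using ps0 by (intro sum_pos) auto
  then have p: "0 < p" unfolding p_eq[symmetric] by simp
  define w where "w x = weight_product \<omega> x powr q" for x
  have wA: "w \<in> A_infinity" using assms(12) by (simp add: w_def[abs_def])
  have w0: "0 \<le> w x" for x by (simp add: w_def)
  have wpos: "AE x in lebesgue. 0 < w x" and wloc: "locally_integrable w"
    using wA by (auto simp: A_infinity_def Muckenhoupt_A_def)
  have wm [measurable]: "w \<in> borel_measurable lebesgue" using wloc by (rule locally_integrable_measurable)
  \<comment> \<open>Membership in A_infinity supplies \<nu>^q > 0 almost everywhere; as
    \<open>0 powr q = 0\<close>, no factor of \<nu> can vanish there.\<close>
  have \<omega>pos: "AE x in lebesgue. 0 < \<omega> i x" for i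
    using wpos
  proof eventually_elim
    case (elim x)
    then have "weight_product \<omega> x \<noteq> 0" by (auto simp: w_def)
    then have "\<omega> i x \<noteq> 0" by (auto simp: weight_product_def)
    then show ?case using \<omega>0[of i x] by simp
  qed
  obtain \<delta> A where RH: "0 < \<delta>" "0 < A"
    "\<And>Q. Q \<in> cubes \<Longrightarrow> emean Q (\<lambda>x. epowr (ennreal (w x)) (1 + \<delta>)) \<le> ennreal A * epowr (emean Q (\<lambda>x. ennreal (w x))) (1 + \<delta>)"
    using that by (rule reverse_holder[OF wA])
  define s where "s = (1 + r) / 2"
  have s: "1 < s" "s < r" using r1 by (auto simp: s_def)
  \<comment> \<open>Solves the exponent relation of \<open>dual_factor_holder\<close> with p_j / r
    in the place of its p; 1 / s > 1 / r yields t_j < p_j.\<close>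
  define t where "t j = 1 / (1 / s - 1 / r + 1 / ps j)" for j
  have sr: "0 < 1 / s - 1 / r" using s by (simp add: field_simps)
  have t: "0 < t j" "1 / t j = 1 / s - 1 / r + 1 / ps j" "t j < ps j" for j
  proof -
    have lt: "1 / ps j < 1 / s - 1 / r + 1 / ps j" using sr by simp
    have pos: "0 < 1 / s - 1 / r + 1 / ps j" using sr ps0[of j] by (simp add: add_pos_pos)
    then show "0 < t j" "1 / t j = 1 / s - 1 / r + 1 / ps j" by (auto simp: t_def)
    have "1 / (1 / s - 1 / r + 1 / ps j) < 1 / (1 / ps j)"
      using lt pos ps0[of j] by (intro divide_strict_left_mono) auto
    then show "t j < ps j" by (simp add: t_def)
  qed
  obtain K where K: "K < top" "\<And>F Q. (\<And>j. F j \<in> borel_measurable lebesgue) \<Longrightarrow> Q \<in> cubes \<Longrightarrow>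
      epowr (emean Q (\<lambda>x. ennreal (weight_product \<omega> x powr q))) (1 / q) * (\<Prod>j\<in>UNIV. epowr (emean Q (\<lambda>x. epowr (F j x) s)) (1 / s))
      \<le> K * (\<Prod>j\<in>UNIV. epowr (emean Q (\<lambda>x. epowr (F j x * ennreal (\<omega> j x)) (t j))) (1 / t j))"
    by (rule multiple_A_holder[OF assms(11) r q _ t(1,2) \<omega>m \<omega>0 \<omega>pos], use s in simp, rule that) (assumption | blast)+
  obtain D where D: "D < top" "\<And>(b :: real^'n \<Rightarrow> complex) Q F c. b \<in> BMO \<Longrightarrow> Q \<in> cubes \<Longrightarrow> F \<in> borel_measurable lebesgue \<Longrightarrow>
      emean Q (\<lambda>y. ennreal (norm (c - b y)) * F y)
      \<le> (ennreal (norm (c - mean Q b)) + D * bmo_norm b) * epowr (emean Q (\<lambda>y. epowr (F y) s)) (1 / s)"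
    by (rule emean_bmo_mult[OF s(1)], rule that) (assumption | blast)+
  \<comment> \<open>The first bound keeps \<alpha> - \<epsilon> positive. The second makes
    \<epsilon> / n at most half of \<delta> / (q (1 + \<delta>)) = 1 / q - 1 / (q (1 + \<delta>)),
    which is the content of \<open>gap\<close>.\<close>
  define \<epsilon> where "\<epsilon> = min (\<alpha> / 2) (n * \<delta> / (2 * q * (1 + \<delta>)))"
  have \<epsilon>: "0 < \<epsilon>" "\<epsilon> < \<alpha>" using \<alpha> n RH(1) q by (auto simp: \<epsilon>_def)
  have gap: "1 / (q * (1 + \<delta>)) < 1 / q - \<epsilon> / n"
  proof -
    have "\<epsilon> / n \<le> \<delta> / (2 * q * (1 + \<delta>))" using n unfolding \<epsilon>_def by (simp add: field_simps min_def)
    also have "\<dots> < \<delta> / (q * (1 + \<delta>))" using RH(1) q by (intro divide_strict_left_mono) auto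
    also have "\<dots> = (1 + \<delta>) / (q * (1 + \<delta>)) - 1 / (q * (1 + \<delta>))" unfolding diff_divide_distrib[symmetric] by simp
    also have "(1 + \<delta>) / (q * (1 + \<delta>)) = 1 / q" using RH(1) by simp
    finally show ?thesis by simp
  qed
  \<comment> \<open>These are the target exponents for the fractional orders \<alpha> + \<epsilon>
    and \<alpha> - \<epsilon> with the same p. Their reciprocals average to 1 / q, as the geometric
    mean of the two grid expressions requires.\<close>
  define q1 where "q1 = 1 / (1 / q - \<epsilon> / n)"
  define q2 where "q2 = 1 / (1 / q + \<epsilon> / n)"
  have "0 < 1 / (q * (1 + \<delta>))" using RH(1) q by simp
  then have d1: "0 < 1 / q - \<epsilon> / n" using gap by linarith
  have d2: "0 < 1 / q + \<epsilon> / n" using q \<epsilon>(1) n by (simp add: add_pos_pos)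
  have q1: "0 < q1" "1 / q1 = 1 / q - \<epsilon> / n" using d1 by (auto simp: q1_def)
  have q2: "0 < q2" "1 / q2 = 1 / q + \<epsilon> / n" using d2 by (auto simp: q2_def)
  have q12: "q1 < q * (1 + \<delta>)" "q2 < q * (1 + \<delta>)"
  proof -
    have "q1 < 1 / (1 / (q * (1 + \<delta>)))" unfolding q1_def
      using gap d1 RH(1) q by (intro divide_strict_left_mono) auto
    then show "q1 < q * (1 + \<delta>)" by simp
    have "q2 < 1 / (1 / q)" unfolding q2_def using \<epsilon>(1) n d2 q by (intro divide_strict_left_mono) auto
    also have "1 / (1 / q) \<le> q * (1 + \<delta>)" using RH(1) q by simp
    finally show "q2 < q * (1 + \<delta>)" .
  qed
  have avg: "1 / q = (1 / q1 + 1 / q2) / 2" unfolding q1(2) q2(2) by simp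
  have e1: "1 / q1 = 1 / p - (\<epsilon> + \<alpha>) / real CARD('n)" unfolding q1(2) q_eq n_def by (simp add: add_divide_distrib)
  have e2: "1 / q2 = 1 / p - (- \<epsilon> + \<alpha>) / real CARD('n)" unfolding q2(2) q_eq n_def by (simp add: diff_divide_distrib)
  have pos1: "0 < \<epsilon> + \<alpha>" and pos2: "0 < - \<epsilon> + \<alpha>" using \<epsilon> by auto
  define N where "N b = (\<Prod>j\<in>UNIV. bmo_norm (b j))" for b :: "'m \<Rightarrow> real^'n \<Rightarrow> complex"
  define L where "L F = (\<Prod>j\<in>UNIV. epowr (\<integral>\<^sup>+x. epowr (F j x * ennreal (\<omega> j x)) (ps j) \<partial>lebesgue) (1 / ps j))" for F
  have "\<exists>C<top. \<forall>b F. (\<forall>j. b j \<in> BMO) \<longrightarrow> (\<forall>j. F j \<in> borel_measurable lebesgue) \<longrightarrow>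
      weighted_grid_norm (\<lambda>x. ennreal (w x)) q \<epsilon> q1 (grid_term \<alpha> s D b F) \<le> C * epowr (N b) q1 * epowr (L F) q1"
    unfolding N_def L_def
  proof (rule weighted_grid_norm_bound[OF t(1,3) p p_eq pos1 q1(1) e1 q q12(1) wm \<omega>m _ ennreal_less_top D(1) K(1)])
    show "emean Q (\<lambda>x. epowr (ennreal (w x)) (1 + \<delta>)) \<le> ennreal A * epowr (emean Q (\<lambda>x. ennreal (w x))) (1 + \<delta>)" if "Q \<in> cubes" for Q
      using that by (rule RH(3))
    show "epowr (emean Q (\<lambda>x. ennreal (w x))) (1 / q) * (\<Prod>j\<in>UNIV. epowr (emean Q (\<lambda>x. epowr (F j x) s)) (1 / s))
      \<le> K * (\<Prod>j\<in>UNIV. epowr (emean Q (\<lambda>x. epowr (F j x * ennreal (\<omega> j x)) (t j))) (1 / t j))"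
      if "\<And>j. F j \<in> borel_measurable lebesgue" "Q \<in> cubes" for F Q
      unfolding w_def using that by (rule K(2))
  qed
  then obtain C1 where C1: "C1 < top" "\<And>b F. \<forall>j. b j \<in> BMO \<Longrightarrow> \<forall>j. F j \<in> borel_measurable lebesgue \<Longrightarrow>
      weighted_grid_norm (\<lambda>x. ennreal (w x)) q \<epsilon> q1 (grid_term \<alpha> s D b F) \<le> C1 * epowr (N b) q1 * epowr (L F) q1"
    by blast
  have "\<exists>C<top. \<forall>b F. (\<forall>j. b j \<in> BMO) \<longrightarrow> (\<forall>j. F j \<in> borel_measurable lebesgue) \<longrightarrow>
      weighted_grid_norm (\<lambda>x. ennreal (w x)) q (- \<epsilon>) q2 (grid_term \<alpha> s D b F) \<le> C * epowr (N b) q2 * epowr (L F) q2"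
    unfolding N_def L_def
  proof (rule weighted_grid_norm_bound[OF t(1,3) p p_eq pos2 q2(1) e2 q q12(2) wm \<omega>m _ ennreal_less_top D(1) K(1)])
    show "emean Q (\<lambda>x. epowr (ennreal (w x)) (1 + \<delta>)) \<le> ennreal A * epowr (emean Q (\<lambda>x. ennreal (w x))) (1 + \<delta>)" if "Q \<in> cubes" for Q
      using that by (rule RH(3))
    show "epowr (emean Q (\<lambda>x. ennreal (w x))) (1 / q) * (\<Prod>j\<in>UNIV. epowr (emean Q (\<lambda>x. epowr (F j x) s)) (1 / s))
      \<le> K * (\<Prod>j\<in>UNIV. epowr (emean Q (\<lambda>x. epowr (F j x * ennreal (\<omega> j x)) (t j))) (1 / t j))"
      if "\<And>j. F j \<in> borel_measurable lebesgue" "Q \<in> cubes" for F Q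
      unfolding w_def using that by (rule K(2))
  qed
  then obtain C2 where C2: "C2 < top" "\<And>b F. \<forall>j. b j \<in> BMO \<Longrightarrow> \<forall>j. F j \<in> borel_measurable lebesgue \<Longrightarrow>
      weighted_grid_norm (\<lambda>x. ennreal (w x)) q (- \<epsilon>) q2 (grid_term \<alpha> s D b F) \<le> C2 * epowr (N b) q2 * epowr (L F) q2"
    by blast
  define c0 where "c0 = ennreal (3 ^ (CARD('n) * CARD('m)) * 2 powr (real CARD('m) * real CARD('n) - \<alpha>))"
  define c1 where "c1 = ennreal (2 / (1 - 2 powr (- \<epsilon>)))"
  define C where "C = epowr c0 q * (epowr c1 q * (epowr C1 (q / (2 * q1)) * epowr C2 (q / (2 * q2))))"
  have Cfin: "C < top" unfolding C_def c0_def c1_def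
    using q q1(1) q2(1) C1(1) C2(1) by (simp add: ennreal_mult_less_top epowr_less_top)
  \<comment> \<open>The added 1 makes the constant positive even if \<open>C\<close> is 0.\<close>
  define C' where "C' = enn2real (epowr C (1 / q)) + 1"
  have "0 < C'" unfolding C'_def by (simp add: add_nonneg_pos)
  have CC': "epowr C (1 / q) \<le> ennreal C'"
  proof -
    have "epowr C (1 / q) < top" using Cfin q by (simp add: epowr_less_top)
    then have "epowr C (1 / q) = ennreal (enn2real (epowr C (1 / q)))" by simp
    also have "\<dots> \<le> ennreal C'" unfolding C'_def by (intro ennreal_leI) simp
    finally show ?thesis .
  qed
  show ?thesis
  proof (intro exI[of _ C'] conjI allI impI)
    show "C' > 0" by fact
    fix b f :: "'m \<Rightarrow> real^'n \<Rightarrow> complex"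
    assume b': "\<forall>j. b j \<in> BMO" and f': "\<forall>i. f i \<in> Lp_space (ps i) (\<lambda>x. \<omega> i x powr ps i)"
    then have b: "\<And>j. b j \<in> BMO" and fm [measurable]: "\<And>j. f j \<in> borel_measurable lebesgue"
      and ffin: "\<And>j. Lp_norm (ps j) (\<lambda>x. \<omega> j x powr ps j) (f j) < top" by (auto simp: Lp_space_def)
    have bm [measurable]: "b j \<in> borel_measurable lebesgue" for j using b by (rule BMO_measurable)
    define F where "F j x = ennreal (norm (f j x))" for j x
    have Fm [measurable]: "F j \<in> borel_measurable lebesgue" for j unfolding F_def by measurable
    have LF: "L F = (\<Prod>i\<in>UNIV. Lp_norm (ps i) (\<lambda>x. \<omega> i x powr ps i) (f i))"
      unfolding L_def F_def using ps0 \<omega>0 by (simp add: Lp_norm_mult_weight)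
    have gm: "grid_term \<alpha> s D b F k z \<in> borel_measurable lebesgue" for k z
      unfolding grid_term_def[abs_def] by measurable
    have mem: "x \<in> grid_cube k (grid_index k x)" for k and x :: "real^'n" by (rule mem_grid_cube_near) simp
    obtain H where H: "H \<in> borel_measurable lebesgue" "\<And>x. (\<integral>\<^sup>+k. grid_term \<alpha> s D b F k (grid_index k x) x \<partial>count_space UNIV) \<le> H x"
      "(\<integral>\<^sup>+x. epowr (H x) q * ennreal (w x) \<partial>lebesgue)
      \<le> epowr (ennreal (2 / (1 - 2 powr (- \<epsilon>)))) q
        * (epowr (weighted_grid_norm (\<lambda>x. ennreal (w x)) q \<epsilon> q1 (grid_term \<alpha> s D b F)) (q / (2 * q1))
          * epowr (weighted_grid_norm (\<lambda>x. ennreal (w x)) q (- \<epsilon>) q2 (grid_term \<alpha> s D b F)) (q / (2 * q2)))"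
      by (rule grid_operator_bound[OF \<epsilon>(1) q q1(1) q2(1) avg _ gm mem, where w = "\<lambda>x. ennreal (w x)"], simp, rule that) (assumption | blast)+
    note [measurable] = H(1)
    define I where "I x = (\<integral>\<^sup>+y. ennreal (norm (commutator_integrand \<alpha> b f x y)) \<partial>lebesgue)" for x
    have IH: "I x \<le> c0 * H x" for x
    proof -
      have "I x \<le> c0 * (\<integral>\<^sup>+k. grid_term \<alpha> s D b F k (grid_index k x) x \<partial>count_space UNIV)"
        unfolding I_def c0_def F_def by (rule commutator_integral_bound[OF \<alpha>(2) b fm D(2)])
      also have "\<dots> \<le> c0 * H x" by (intro mult_left_mono H) auto
      finally show ?thesis .
    qed
    have "(\<integral>\<^sup>+x. epowr (c0 * H x) q * ennreal (w x) \<partial>lebesgue) = epowr c0 q * (\<integral>\<^sup>+x. epowr (H x) q * ennreal (w x) \<partial>lebesgue)"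
      using q by (simp add: epowr_mult mult.assoc nn_integral_cmult)
    also have "\<dots> \<le> epowr c0 q * (epowr c1 q * (epowr (C1 * epowr (N b) q1 * epowr (L F) q1) (q / (2 * q1))
        * epowr (C2 * epowr (N b) q2 * epowr (L F) q2) (q / (2 * q2))))"
    proof (intro mult_left_mono order_trans[OF H(3)])
      show "epowr (ennreal (2 / (1 - 2 powr (- \<epsilon>)))) q
        * (epowr (weighted_grid_norm (\<lambda>x. ennreal (w x)) q \<epsilon> q1 (grid_term \<alpha> s D b F)) (q / (2 * q1))
          * epowr (weighted_grid_norm (\<lambda>x. ennreal (w x)) q (- \<epsilon>) q2 (grid_term \<alpha> s D b F)) (q / (2 * q2)))
        \<le> epowr c1 q * (epowr (C1 * epowr (N b) q1 * epowr (L F) q1) (q / (2 * q1))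
        * epowr (C2 * epowr (N b) q2 * epowr (L F) q2) (q / (2 * q2)))"
        unfolding c1_def using q q1(1) q2(1) by (intro mult_left_mono mult_mono epowr_mono C1(2) C2(2) allI b Fm) auto
    qed simp
    \<comment> \<open>Both grid norms contribute the exponent q / 2, because q_i * q / (2 q_i) = q /
      2 for i = 1, 2. This restores homogeneity in b and f.\<close>
    also have "\<dots> = C * ((epowr (N b) (q / 2) * epowr (N b) (q / 2)) * (epowr (L F) (q / 2) * epowr (L F) (q / 2)))"
      using q q1(1) q2(1) by (simp add: C_def epowr_mult epowr_epowr ac_simps)
    also have "\<dots> = C * (epowr (N b) q * epowr (L F) q)"
      using q epowr_add[of "q / 2" "q / 2" "N b"] epowr_add[of "q / 2" "q / 2" "L F"] by simp
    finally have main: "(\<integral>\<^sup>+x. epowr (c0 * H x) q * ennreal (w x) \<partial>lebesgue) \<le> C * (epowr (N b) q * epowr (L F) q)" .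
    \<comment> \<open>Finite norms make the weighted integral finite, so \<open>c0 * H x\<close> is
      finite wherever the weight is positive, that is almost everywhere. As it dominates the
      integral of the modulus of the integrand, absolute integrability follows.\<close>
    have "N b < top" unfolding N_def less_top[symmetric] using b by (auto simp: ennreal_prod_eq_top BMO_def less_top[symmetric])
    moreover have "L F < top" unfolding LF less_top[symmetric] using ffin by (auto simp: ennreal_prod_eq_top less_top[symmetric])
    ultimately have "C * (epowr (N b) q * epowr (L F) q) < top"
      using q Cfin by (simp add: ennreal_mult_less_top epowr_less_top)
    then have "(\<integral>\<^sup>+x. epowr (c0 * H x) q * ennreal (w x) \<partial>lebesgue) \<noteq> \<infinity>" using main by auto
    then have "AE x in lebesgue. epowr (c0 * H x) q * ennreal (w x) \<noteq> \<infinity>"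
      by (intro nn_integral_PInf_AE) measurable
    then show "AE x in lebesgue. integrable lebesgue (commutator_integrand \<alpha> b f x)"
      using wpos
    proof eventually_elim
      case (elim x)
      then have "epowr (c0 * H x) q \<noteq> top" by (auto simp: ennreal_top_mult ennreal_eq_0_iff not_le)
      then have "c0 * H x \<noteq> top" using q by (auto simp: epowr_eq_top_iff)
      then have "I x < top" using IH[of x] by (auto simp: less_top top_unique)
      then show ?case
        unfolding integrable_iff_bounded I_def using commutator_integrand_measurable[OF bm fm] by simp
    qed
    have "(\<integral>\<^sup>+x. ennreal (norm (iterated_commutator \<alpha> b f x) powr q * w x) \<partial>lebesgue)
      \<le> (\<integral>\<^sup>+x. epowr (c0 * H x) q * ennreal (w x) \<partial>lebesgue)"
    proof (intro nn_integral_mono)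
      fix x
      have "ennreal (norm (iterated_commutator \<alpha> b f x)) \<le> I x"
        unfolding iterated_commutator_def I_def by (rule ennreal_norm_integral_le)
      also have "\<dots> \<le> c0 * H x" by (rule IH)
      finally have "epowr (ennreal (norm (iterated_commutator \<alpha> b f x))) q \<le> epowr (c0 * H x) q" using q by (intro epowr_mono) auto
      then show "ennreal (norm (iterated_commutator \<alpha> b f x) powr q * w x) \<le> epowr (c0 * H x) q * ennreal (w x)"
        using q w0[of x] by (simp add: ennreal_mult' epowr_ennreal mult_right_mono)
    qed
    also note main
    finally have "Lp_norm q w (iterated_commutator \<alpha> b f) \<le> epowr (C * (epowr (N b) q * epowr (L F) q)) (1 / q)"
      unfolding Lp_norm_def using q by (intro epowr_mono) auto
    also have "\<dots> = epowr C (1 / q) * (N b * L F)" using q by (simp add: epowr_mult epowr_epowr)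
    also have "\<dots> \<le> ennreal C' * (N b * L F)" by (intro mult_right_mono CC') auto
    finally show "Lp_norm q (\<lambda>x. weight_product \<omega> x powr q) (iterated_commutator \<alpha> b f)
        \<le> ennreal C' * (\<Prod>j\<in>UNIV. bmo_norm (b j)) * (\<Prod>i\<in>UNIV. Lp_norm (ps i) (\<lambda>x. \<omega> i x powr ps i) (f i))"
      unfolding w_def[abs_def] N_def LF by (simp only: mult.assoc)
  qed
qed

end
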